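(* Let $1\le p\le2$ and let $f\in L^1(\mathbb R)\cap L^p(\mathbb R)$ be complex-valued. Then the transmission coefficient $a_f$ of the Dirac scattering transform of $f$ satisfies $$\big\|(\log|a_f|^2)^{1/2}\big\|_{L^{p'}(\mathbb R)}\le\|f\|_{L^p(\mathbb R)} .$$ At $p=2$ equality holds.
   Context: $p'=p/(p-1)$ is the conjugate exponent, with $1'=\infty$. For $f\in L^1(\mathbb R)$ and $\xi\in\mathbb R$, let $x\mapsto(a(x,\xi),b(x,\xi))$ be the unique absolutely continuous solution (equivalently, the solution of the corresponding Volterra integral equation) of $$\partial_x\binom{a}{b}=\begin{pmatrix}0&\overline{f(x)}e^{2\pi i x\xi}\\ f(x)e^{-2\pi i x\xi}&0\end{pmatrix}\binom{a}{b},\qquad \binom{a}{b}(-\infty,\xi)=\binom10 ,$$ where the initial condition is understood as a limit as $x\to-\infty$. Its limit as $x\to+\infty$ exists for every $\xi$, and is denoted $(a_f(\xi),b_f(\xi))$. One has $|a_f(\xi)|^2-|b_f(\xi)|^2=1$, so $\log|a_f(\xi)|^2\ge0$. *)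

theory Defs
  imports "HOL-Analysis.Analysis" "HOL-Probability.Essential_Supremum"
begin

text \<open>
  The Lebesgue norms on the real line take values in \<^typ>\<open>ennreal\<close>, so that an upper bound also
  asserts finiteness. The exponent is meant to lie in \<open>[1, \<infinity>]\<close>.
\<close>

definition Lp_norm :: "ennreal \<Rightarrow> (real \<Rightarrow> 'b::real_normed_vector) \<Rightarrow> ennreal" where
  "Lp_norm p g =
     (if p = \<infinity> then esssup lebesgue (\<lambda>x. ennreal (norm (g x)))
      else let I = (\<integral>\<^sup>+x. ennreal (norm (g x) powr enn2real p) \<partial>lebesgue)
           in if I = \<infinity> then \<infinity> else ennreal (enn2real I powr (1 / enn2real p)))"

definition Lp_space :: "ennreal \<Rightarrow> (real \<Rightarrow> 'b::real_normed_vector) set" where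
  "Lp_space p = {g. g \<in> borel_measurable lebesgue \<and> Lp_norm p g < \<infinity>}"

definition conj_exponent :: "real \<Rightarrow> ennreal" where
  "conj_exponent p = (if p = 1 then \<infinity> else ennreal (p / (p - 1)))"

text \<open>
  The Dirac system in Volterra form. The integrals start at \<open>-\<infinity>\<close>, which encodes the initial
  condition \<open>(1, 0)\<close> there. Integrability has to be required explicitly, because the Bochner
  integral of a non-integrable function is \<open>0\<close>; together with the equations it forces \<open>a\<close> and \<open>b\<close>
  to be absolutely continuous. Recall that \<open>cis t\<close> is \<open>e\<^sup>i\<^sup>t\<close>.
\<close>

definition dirac_solution ::
  "(real \<Rightarrow> complex) \<Rightarrow> real \<Rightarrow> (real \<Rightarrow> complex) \<Rightarrow> (real \<Rightarrow> complex) \<Rightarrow> bool" where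
  "dirac_solution f \<xi> a b \<longleftrightarrow>
     (\<forall>x. set_integrable lebesgue {..x} (\<lambda>y. cnj (f y) * cis (2 * pi * y * \<xi>) * b y) \<and>
          set_integrable lebesgue {..x} (\<lambda>y. f y * cis (- (2 * pi * y * \<xi>)) * a y) \<and>
          a x = 1 + (LINT y:{..x}|lebesgue. cnj (f y) * cis (2 * pi * y * \<xi>) * b y) \<and>
          b x = (LINT y:{..x}|lebesgue. f y * cis (- (2 * pi * y * \<xi>)) * a y))"

text \<open>
  For \<open>f \<in> L\<^sup>1\<close> the solution exists and is unique as a pair of functions on the whole line,
  and it converges at \<open>+\<infinity>\<close>, so the descriptions below are proper.
\<close>

definition dirac_sol ::
  "(real \<Rightarrow> complex) \<Rightarrow> real \<Rightarrow> (real \<Rightarrow> complex) \<times> (real \<Rightarrow> complex)" where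
  "dirac_sol f \<xi> = (THE ab. dirac_solution f \<xi> (fst ab) (snd ab))"

definition scat_a :: "(real \<Rightarrow> complex) \<Rightarrow> real \<Rightarrow> complex" where
  "scat_a f \<xi> = Lim at_top (fst (dirac_sol f \<xi>))"

end

theory Submission
  imports Defs "HOL-Complex_Analysis.Complex_Analysis"
begin

text \<open>
  Along the solution, \<open>\<rho> = b / cnj a\<close> satisfies \<open>\<rho>' = f e\<^sup>-\<^sup>2\<^sup>\<pi>\<^sup>i\<^sup>x\<^sup>\<xi> / (cnj a)\<^sup>2\<close>, and
  \<open>log |a|\<^sup>2 = - log (1 - |\<rho>|\<^sup>2) = \<Sum>n\<ge>1. |\<rho>\<^sup>n|\<^sup>2 / n\<close>. Hence the square root of \<open>log |a|\<^sup>2\<close> is the norm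
  of the integral of \<open>f\<close> against the \<open>\<ell>\<^sup>2\<close>-valued kernel with entries \<open>\<surd>n \<rho>\<^sup>n\<^sup>-\<^sup>1 (cnj a)\<^sup>-\<^sup>2 e\<^sup>-\<^sup>2\<^sup>\<pi>\<^sup>i\<^sup>x\<^sup>\<xi>\<close>. These
  kernel vectors have norm \<open>1\<close>, and the scalar product of two of them is, as a function of \<open>\<xi>\<close>,
  the boundary value of a bounded analytic function of mean zero. Once the kernel is frozen, it
  therefore defines a linear operator that is a contraction from \<open>L\<^sup>1\<close> to \<open>L\<^sup>\<infinity>\<close> and isometric on
  \<open>L\<^sup>2\<close>, and Riesz--Thorin interpolation, applied to \<open>f\<close> itself, gives the inequality.

  To make the mean value argument exact, \<open>f\<close> is sampled on a grid of width \<open>1 / (n + 1)\<close>: the Dirac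
  system becomes a product of matrices in SU(1,1) and everything is periodic in \<open>\<xi>\<close>. Fatou's lemma
  recovers the inequality in the limit. At \<open>p = 2\<close> the discrete energy identity is exact,
  and no energy escapes to \<open>|\<xi>| = \<infinity>\<close>, because the frozen operator maps Lipschitz functions of compact
  support to functions of size \<open>O(1 / |\<xi>|)\<close>, uniformly in the grid.
\<close>

section \<open>Discrete products in SU(1,1)\<close>

text \<open>Riesz-Thorin needs a linear operator, while the scattering map is nonlinear. The two
  endpoint bounds, however, hold whatever coefficients the kernel is applied to, so the kernel may
  be computed from \<open>f\<close> and then tested on arbitrary data. Norm one comes from
  \<open>\<Sum> (n+1) |\<rho>|^(2n) = (1 - |\<rho>|^2)^-2 = |a|^4\<close>. In general the scalar
  product at grid points \<open>j\<close> and \<open>k\<close> is a phase over the square of the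
  diagonal entry of the transfer matrix between them. For \<open>j < k\<close> that entry continues
  to a zero-free function in the disc, and the phase contributes \<open>w^(k-j)\<close>, which kills
  the mean. Projection onto the direction of \<open>(\<rho>_N^n / sqrt n)_n\<close> makes the
  operator scalar-valued and can only lower norms, which is harmless for upper bounds. For equality
  it loses information, so the lower bound at \<open>p = 2\<close> rests on Jensen's formula for
  \<open>a\<close> instead. The price of discretisation is a second-order error, the sum of squared
  cell integrals. At \<open>p = 2\<close> this error must vanish even after integration over a
  frequency window of length \<open>n + 1\<close>.\<close>

text \<open>Each factor is the matrix with diagonal \<open>1\<close> and off-diagonal entries \<open>cnj (F j)\<close> and \<open>F j\<close>, divided by
  \<open>\<surd>(1 - |F j|\<^sup>2)\<close> so that it lies in SU(1,1).\<close>

fun su11_prod :: "(nat \<Rightarrow> complex) \<Rightarrow> nat \<Rightarrow> complex \<times> complex" where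
  "su11_prod F 0 = (1, 0)"
| "su11_prod F (Suc j) =
     (let (a, b) = su11_prod F j; s = complex_of_real (sqrt (1 - (cmod (F j))\<^sup>2))
      in ((a + cnj (F j) * b) / s, (b + F j * a) / s))"

definition disc_a :: "(nat \<Rightarrow> complex) \<Rightarrow> nat \<Rightarrow> complex" where
  "disc_a F j = fst (su11_prod F j)"

definition disc_b :: "(nat \<Rightarrow> complex) \<Rightarrow> nat \<Rightarrow> complex" where
  "disc_b F j = snd (su11_prod F j)"

definition su11_scale :: "complex \<Rightarrow> complex" where
  "su11_scale z = complex_of_real (sqrt (1 - (cmod z)\<^sup>2))"

lemma disc_a_0 [simp]: "disc_a F 0 = 1" and disc_b_0 [simp]: "disc_b F 0 = 0"
  by (simp_all add: disc_a_def disc_b_def)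

lemma disc_a_Suc: "disc_a F (Suc j) = (disc_a F j + cnj (F j) * disc_b F j) / su11_scale (F j)"
  and disc_b_Suc: "disc_b F (Suc j) = (disc_b F j + F j * disc_a F j) / su11_scale (F j)"
  by (simp_all add: disc_a_def disc_b_def su11_scale_def Let_def case_prod_beta)

lemma su11_scale_mult:
  assumes "cmod z < 1"
  shows "su11_scale z * su11_scale z = 1 - z * cnj z"
proof -
  have "su11_scale z * su11_scale z = complex_of_real (1 - (cmod z)\<^sup>2)"
    unfolding su11_scale_def of_real_mult[symmetric] using assms by (simp add: abs_square_le_1)
  also have "\<dots> = 1 - z * cnj z"
    unfolding of_real_diff complex_norm_square by simp
  finally show ?thesis .
qed

lemma cnj_su11_scale [simp]: "cnj (su11_scale z) = su11_scale z"
  by (simp add: su11_scale_def)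

lemma su11_scale_nz: "cmod z < 1 \<Longrightarrow> su11_scale z \<noteq> 0"
  by (simp add: su11_scale_def abs_square_eq_1)

lemma cmod_su11_scale: "cmod z < 1 \<Longrightarrow> cmod (su11_scale z) = sqrt (1 - (cmod z)\<^sup>2)"
  unfolding su11_scale_def by (simp add: abs_square_le_1)

text \<open>For \<open>j \<le> k\<close>, the first diagonal entry of the product of the factors from \<open>j\<close> to \<open>k - 1\<close>.\<close>

definition disc_D :: "(nat \<Rightarrow> complex) \<Rightarrow> nat \<Rightarrow> nat \<Rightarrow> complex" where
  "disc_D F j k = cnj (disc_a F j) * disc_a F k - disc_b F j * cnj (disc_b F k)"

text \<open>Here \<open>disc_D F j j\<close> is \<open>|a|^2 - |b|^2\<close>, the determinant of the
  partial product; the division by \<open>su11_scale\<close> keeps it equal to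
  \<open>1\<close>.\<close>

lemma disc_D_diag:
  assumes "\<And>j. cmod (F j) < 1"
  shows "disc_D F j j = 1"
proof (induction j)
  case (Suc j)
  have s: "su11_scale (F j) * su11_scale (F j) = 1 - F j * cnj (F j)" "su11_scale (F j) \<noteq> 0"
    using assms su11_scale_mult su11_scale_nz by blast+
  have nz: "1 - F j * cnj (F j) \<noteq> 0" using s by (metis mult_eq_0_iff)
  have "disc_D F (Suc j) (Suc j) * (su11_scale (F j) * su11_scale (F j)) = disc_D F j j * (1 - F j * cnj (F j))"
    using s(2) unfolding disc_D_def disc_a_Suc disc_b_Suc by (simp add: field_simps)
  then show ?case using Suc s nz by simp
qed (simp add: disc_D_def)

lemma cmod_disc_a_disc_b:
  assumes "\<And>j. cmod (F j) < 1"
  shows "(cmod (disc_a F j))\<^sup>2 - (cmod (disc_b F j))\<^sup>2 = 1"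
proof -
  have "complex_of_real ((cmod (disc_a F j))\<^sup>2 - (cmod (disc_b F j))\<^sup>2) = 1"
    using disc_D_diag[of F j, OF assms] unfolding disc_D_def of_real_diff complex_norm_square
    by (simp add: mult.commute)
  then show ?thesis by (metis of_real_eq_1_iff)
qed

text \<open>\<open>disc_D\<close> and \<open>Q\<close> are the entries of the transfer matrix from
  \<open>j\<close> to \<open>k\<close>, up to sign and conjugation, and the first identity is
  multiplicativity of the determinant. So \<open>|disc_D|^2 = 1 + |Q|^2\<close>.\<close>

lemma cmod_disc_D_ge1:
  assumes "\<And>j. cmod (F j) < 1"
  shows "cmod (disc_D F j k) \<ge> 1"
proof -
  define Q where "Q = disc_b F j * cnj (disc_a F k) - cnj (disc_a F j) * disc_b F k"
  have "disc_D F j k * cnj (disc_D F j k) - Q * cnj Q = disc_D F j j * disc_D F k k"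
    unfolding disc_D_def Q_def by (simp add: algebra_simps)
  then have "complex_of_real ((cmod (disc_D F j k))\<^sup>2 - (cmod Q)\<^sup>2) = 1"
    unfolding of_real_diff complex_norm_square using disc_D_diag[of F, OF assms] by simp
  then have "(cmod (disc_D F j k))\<^sup>2 - (cmod Q)\<^sup>2 = 1"
    by (metis of_real_eq_1_iff)
  then have "1 \<le> (cmod (disc_D F j k))\<^sup>2" by (smt (verit) zero_le_power2)
  then show ?thesis by (simp add: one_le_power abs_le_square_iff[of 1 "cmod (disc_D F j k)", simplified])
qed

lemma cmod_disc_a_ge1:
  assumes "\<And>j. cmod (F j) < 1"
  shows "cmod (disc_a F j) \<ge> 1"
  using cmod_disc_D_ge1[of F 0 j, OF assms] by (simp add: disc_D_def)

text \<open>One factor multiplies \<open>|a| + |b|\<close> by at most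
  \<open>(1 + x) / sqrt (1 - x^2)\<close> with \<open>x = |F j|\<close>, which is at most
  \<open>exp (2 x)\<close> on \<open>[0, 1/2]\<close>. The bound depends only on the sum of the
  \<open>|F i|\<close>, not on their number, and therefore survives refinement of the grid.\<close>

lemma cmod_disc_a_disc_b_growth:
  assumes "\<And>j. cmod (F j) \<le> 1 / 2"
  shows "cmod (disc_a F j) + cmod (disc_b F j) \<le> exp (2 * (\<Sum>i<j. cmod (F i)))"
proof (induction j)
  case (Suc j)
  define x where "x = cmod (F j)"
  have x: "0 \<le> x" "x \<le> 1/2" using assms[of j] by (auto simp: x_def)
  have lt: "cmod (F j) < 1" using x by (simp add: x_def)
  define r where "r = sqrt (1 - (cmod (F j))\<^sup>2)"
  have x1: "x\<^sup>2 < 1" using x by (simp add: abs_square_less_1)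
  have r2: "r\<^sup>2 = 1 - x\<^sup>2" unfolding r_def x_def[symmetric] by (rule real_sqrt_pow2) (use x1 in linarith)
  have r0: "r > 0" unfolding r_def x_def[symmetric] using x1 by (simp only: real_sqrt_gt_0_iff)
  \<comment> \<open>Squared, this is \<open>(1 + x)^2 \<le> exp (4 x) (1 - x^2)\<close>; the
    quadratic Taylor minorant of \<open>exp (4 x)\<close> already suffices.\<close>
  have e: "(1 + x) / r \<le> exp (2 * x)"
  proof -
    have "1 + 4 * x + (4 * x)\<^sup>2 / 2 \<le> exp (4 * x)"
      using exp_lower_Taylor_quadratic[of "4 * x"] x by simp
    then have "(1 + 4 * x + (4 * x)\<^sup>2 / 2) * (1 - x\<^sup>2) \<le> exp (4 * x) * (1 - x\<^sup>2)"
      by (rule mult_right_mono) (use x1 in linarith)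
    moreover have "(1 + x)\<^sup>2 \<le> (1 + 4 * x + (4 * x)\<^sup>2 / 2) * (1 - x\<^sup>2)"
    proof -
      have d: "(1 + 4 * x + (4 * x)\<^sup>2 / 2) * (1 - x\<^sup>2) - (1 + x)\<^sup>2
          = x * (2 + 6 * x - 4 * x\<^sup>2 - 8 * (x\<^sup>2 * x))"
        by (simp add: field_simps power2_eq_square)
      have "x\<^sup>2 \<le> x / 2"
        using x mult_left_mono[of x "1/2" x] by (simp add: power2_eq_square)
      moreover have "x\<^sup>2 * x \<le> x / 4"
      proof -
        have "x\<^sup>2 \<le> (1/2)\<^sup>2" using x by (intro power_mono) auto
        then show ?thesis using mult_right_mono[of "x\<^sup>2" "1/4" x] x by (simp add: power2_eq_square)
      qed
      ultimately have "0 \<le> 2 + 6 * x - 4 * x\<^sup>2 - 8 * (x\<^sup>2 * x)" using x by linarith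
      then have "0 \<le> x * (2 + 6 * x - 4 * x\<^sup>2 - 8 * (x\<^sup>2 * x))"
        using x(1) by (rule mult_nonneg_nonneg[rotated])
      with d show ?thesis by linarith
    qed
    moreover have "(exp (2 * x) * r)\<^sup>2 = exp (4 * x) * (1 - x\<^sup>2)"
      using exp_double[of "2 * x"] by (simp add: power_mult_distrib r2)
    ultimately have "(1 + x)\<^sup>2 \<le> (exp (2 * x) * r)\<^sup>2" by linarith
    then have "1 + x \<le> exp (2 * x) * r"
      by (rule power2_le_imp_le) (use r0 in simp)
    then show ?thesis using r0 by (simp add: divide_le_eq)
  qed
  have "cmod (disc_a F (Suc j)) + cmod (disc_b F (Suc j))
      = (cmod (disc_a F j + cnj (F j) * disc_b F j) + cmod (disc_b F j + F j * disc_a F j)) / r"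
    unfolding disc_a_Suc disc_b_Suc norm_divide cmod_su11_scale[OF lt] r_def[symmetric] by (simp add: add_divide_distrib)
  also have "\<dots> \<le> ((cmod (disc_a F j) + cmod (disc_b F j)) * (1 + x)) / r"
  proof (rule divide_right_mono)
    show "cmod (disc_a F j + cnj (F j) * disc_b F j) + cmod (disc_b F j + F j * disc_a F j)
       \<le> (cmod (disc_a F j) + cmod (disc_b F j)) * (1 + x)"
      using norm_triangle_ineq[of "disc_a F j" "cnj (F j) * disc_b F j"]
        norm_triangle_ineq[of "disc_b F j" "F j * disc_a F j"]
      by (simp add: norm_mult x_def algebra_simps)
  qed (use r0 in simp)
  also have "\<dots> \<le> exp (2 * (\<Sum>i<j. cmod (F i))) * exp (2 * x)"
  proof -
    have "(cmod (disc_a F j) + cmod (disc_b F j)) * ((1 + x) / r)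
       \<le> exp (2 * (\<Sum>i<j. cmod (F i))) * exp (2 * x)"
      using Suc e r0 x by (intro mult_mono) auto
    then show ?thesis by simp
  qed
  also have "\<dots> = exp (2 * (\<Sum>i<Suc j. cmod (F i)))"
    by (simp add: x_def distrib_left exp_add)
  finally show ?case .
qed simp

section \<open>The power series kernel and its Gram matrix\<close>

lemma sums_Cauchy_Schwarz:
  fixes x y :: "nat \<Rightarrow> complex"
  assumes "(\<lambda>n. x n * y n) sums S" "(\<lambda>n. (cmod (x n))\<^sup>2) sums A" "(\<lambda>n. (cmod (y n))\<^sup>2) sums B"
  shows "(cmod S)\<^sup>2 \<le> A * B"
proof -
  have "(\<lambda>n. (cmod (\<Sum>i<n. x i * y i))\<^sup>2) \<longlonglongrightarrow> (cmod S)\<^sup>2"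
    using assms(1) unfolding sums_def by (intro tendsto_intros)
  moreover have "(\<lambda>n. (\<Sum>i<n. (cmod (x i))\<^sup>2) * (\<Sum>i<n. (cmod (y i))\<^sup>2)) \<longlonglongrightarrow> A * B"
    using assms(2,3) unfolding sums_def by (intro tendsto_intros)
  moreover have "(cmod (\<Sum>i<n. x i * y i))\<^sup>2 \<le> (\<Sum>i<n. (cmod (x i))\<^sup>2) * (\<Sum>i<n. (cmod (y i))\<^sup>2)" for n
  proof -
    have "cmod (\<Sum>i<n. x i * y i) \<le> (\<Sum>i<n. cmod (x i) * cmod (y i))"
      using norm_sum[of "\<lambda>i. x i * y i" "{..<n}"] by (simp add: norm_mult)
    then have "(cmod (\<Sum>i<n. x i * y i))\<^sup>2 \<le> (\<Sum>i<n. cmod (x i) * cmod (y i))\<^sup>2"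
      by (intro power_mono) auto
    also have "\<dots> \<le> (\<Sum>i<n. (cmod (x i))\<^sup>2) * (\<Sum>i<n. (cmod (y i))\<^sup>2)"
      by (rule Cauchy_Schwarz_ineq_sum)
    finally show ?thesis .
  qed
  ultimately show ?thesis by (intro LIMSEQ_le) auto
qed

text \<open>Cauchy-Schwarz for the sequences \<open>X\<close> and \<open>Y\<close>. Expanding the
  left side as a geometric series gives \<open>\<Sum> X n Y n\<close>; the squares of
  \<open>X\<close> sum to a form with the Bergman kernel \<open>1 / (1 - z cnj w)^2\<close> of the
  disc, those of \<open>Y\<close> to the logarithm series. The weight \<open>sqrt (Suc n)\<close> is
  placed so that this logarithm becomes \<open>log |a|^2\<close> when \<open>q\<close> is the last
  reflection coefficient.\<close>

lemma disc_kernel_Cauchy_Schwarz: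
  fixes v z :: "'i \<Rightarrow> complex" and q :: complex
  assumes z: "\<And>j. j \<in> I \<Longrightarrow> cmod (z j) < 1" and q: "cmod q < 1" and fin: "finite I"
  shows "(cmod (\<Sum>j\<in>I. v j * cnj q / (1 - z j * cnj q)))\<^sup>2
     \<le> Re (\<Sum>j\<in>I. \<Sum>k\<in>I. v j * cnj (v k) / (1 - z j * cnj (z k))\<^sup>2) * (- ln (1 - (cmod q)\<^sup>2))"
proof -
  define X where "X n = (\<Sum>j\<in>I. v j * complex_of_real (sqrt (Suc n)) * z j ^ n)" for n
  define Y where "Y n = cnj q ^ Suc n / complex_of_real (sqrt (Suc n))" for n
  have 1: "(\<lambda>n. X n * Y n) sums (\<Sum>j\<in>I. v j * cnj q / (1 - z j * cnj q))"
  proof -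
    have "X n * Y n = (\<Sum>j\<in>I. v j * cnj q * (z j * cnj q) ^ n)" for n
    proof -
      have "complex_of_real (sqrt (Suc n)) \<noteq> 0" by (simp del: of_nat_Suc)
      then show ?thesis
        unfolding X_def Y_def sum_distrib_right
        by (intro sum.cong refl) (simp add: power_mult_distrib del: of_nat_Suc)
    qed
    moreover have "(\<lambda>n. \<Sum>j\<in>I. v j * cnj q * (z j * cnj q) ^ n) sums (\<Sum>j\<in>I. v j * cnj q * (1 / (1 - z j * cnj q)))"
    proof (intro sums_sum sums_mult geometric_sums)
      fix j assume "j \<in> I"
      then show "norm (z j * cnj q) < 1"
        using z[of j] q mult_strict_mono'[of "cmod (z j)" 1 "cmod q" 1] by (simp add: norm_mult)
    qed
    ultimately show ?thesis by simp
  qed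
  have 2: "(\<lambda>n. (cmod (X n))\<^sup>2) sums Re (\<Sum>j\<in>I. \<Sum>k\<in>I. v j * cnj (v k) / (1 - z j * cnj (z k))\<^sup>2)"
  proof -
    have "complex_of_real ((cmod (X n))\<^sup>2) = (\<Sum>j\<in>I. \<Sum>k\<in>I. v j * cnj (v k) * (of_nat (Suc n) * (z j * cnj (z k)) ^ n))" for n
    proof -
      have "complex_of_real ((cmod (X n))\<^sup>2) = X n * cnj (X n)" by (rule complex_norm_square)
      also have "\<dots> = (\<Sum>j\<in>I. \<Sum>k\<in>I. (v j * complex_of_real (sqrt (Suc n)) * z j ^ n) *
         (cnj (v k) * complex_of_real (sqrt (Suc n)) * cnj (z k) ^ n))"
        unfolding X_def by (simp add: sum_product del: of_nat_Suc)
      also have "\<dots> = (\<Sum>j\<in>I. \<Sum>k\<in>I. v j * cnj (v k) * (of_nat (Suc n) * (z j * cnj (z k)) ^ n))"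
      proof (intro sum.cong refl)
        fix j k
        define s where "s = complex_of_real (sqrt (Suc n))"
        have "s * s = of_nat (Suc n)"
          unfolding s_def by (simp flip: of_real_mult del: of_nat_Suc)
        moreover have "(v j * s * z j ^ n) * (cnj (v k) * s * cnj (z k) ^ n)
            = v j * cnj (v k) * ((s * s) * (z j * cnj (z k)) ^ n)"
          by (simp add: power_mult_distrib mult_ac)
        ultimately show "(v j * complex_of_real (sqrt (Suc n)) * z j ^ n) *
         (cnj (v k) * complex_of_real (sqrt (Suc n)) * cnj (z k) ^ n) = v j * cnj (v k) * (of_nat (Suc n) * (z j * cnj (z k)) ^ n)"
          unfolding s_def by simp
      qed
      finally show ?thesis .
    qed
    moreover have "(\<lambda>n. \<Sum>j\<in>I. \<Sum>k\<in>I. v j * cnj (v k) * (of_nat (Suc n) * (z j * cnj (z k)) ^ n)) sums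
        (\<Sum>j\<in>I. \<Sum>k\<in>I. v j * cnj (v k) * (1 / (1 - z j * cnj (z k))\<^sup>2))"
    proof (intro sums_sum sums_mult geometric_deriv_sums)
      fix j k assume "j \<in> I" "k \<in> I"
      then show "norm (z j * cnj (z k)) < 1"
        using z[of j] z[of k] mult_strict_mono'[of "cmod (z j)" 1 "cmod (z k)" 1] by (simp add: norm_mult)
    qed
    ultimately have "(\<lambda>n. complex_of_real ((cmod (X n))\<^sup>2)) sums (\<Sum>j\<in>I. \<Sum>k\<in>I. v j * cnj (v k) / (1 - z j * cnj (z k))\<^sup>2)"
      by simp
    from sums_Re[OF this] show ?thesis by simp
  qed
  have 3: "(\<lambda>n. (cmod (Y n))\<^sup>2) sums (- ln (1 - (cmod q)\<^sup>2))"
  proof -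
    define t where "t = (cmod q)\<^sup>2"
    have t: "0 \<le> t" "t < 1" using q by (auto simp: t_def abs_square_less_1)
    have "(\<lambda>n. - ((-(-t)) ^ n) / of_nat n) sums ln (1 + (-t))"
      using ln_series'[of "-t"] t by simp
    then have "(\<lambda>n. - (- (t ^ n) / of_nat n)) sums (- ln (1 - t))"
      by (intro sums_minus) simp
    then have "(\<lambda>n. t ^ n / of_nat n) sums (- ln (1 - t))" by simp
    then have "(\<lambda>n. t ^ Suc n / of_nat (Suc n)) sums (- ln (1 - t))"
      by (subst sums_Suc_iff) simp
    moreover have "(cmod (Y n))\<^sup>2 = t ^ Suc n / of_nat (Suc n)" for n
      unfolding Y_def t_def by (simp add: norm_divide norm_power power_divide power_even_eq[symmetric]
        power_mult[symmetric] mult.commute power_mult_distrib norm_mult)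
    ultimately show ?thesis unfolding t_def[symmetric] by simp
  qed
  from sums_Cauchy_Schwarz[OF 1 2 3] show ?thesis .
qed

lemma cnj_disc_D: "cnj (disc_D F j k) = disc_D F k j"
  by (simp add: disc_D_def mult.commute)

lemma disc_D_0: "disc_D F 0 k = disc_a F k"
  by (simp add: disc_D_def)

definition disc_log :: "(nat \<Rightarrow> complex) \<Rightarrow> nat \<Rightarrow> real" where
  "disc_log F N = ln ((cmod (disc_a F N))\<^sup>2)"

text \<open>With \<open>\<rho>\<^sub>j = b\<^sub>j / cnj a\<^sub>j\<close>, this is the scalar product of \<open>(\<surd>n \<rho>\<^sub>j\<^sup>n\<^sup>-\<^sup>1 (cnj a\<^sub>j)\<^sup>-\<^sup>2)\<^sub>n\<close> with the direction of
  \<open>(\<rho>\<^sub>N\<^sup>n / \<surd>n)\<^sub>n\<close>, summed as a geometric series. It is \<open>0\<close> if the direction is undefined.\<close>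

definition disc_ker :: "(nat \<Rightarrow> complex) \<Rightarrow> nat \<Rightarrow> nat \<Rightarrow> complex" where
  "disc_ker F N j = cnj (disc_b F N) / (complex_of_real (sqrt (disc_log F N)) * cnj (disc_a F j) * disc_D F j N)"

context
  fixes F :: "nat \<Rightarrow> complex"
  assumes F1: "\<And>j. cmod (F j) < 1"
begin

lemma disc_log_nonneg: "0 \<le> disc_log F N"
  unfolding disc_log_def using cmod_disc_a_ge1[of F N, OF F1] by (intro ln_ge_zero) (simp add: one_le_power)

lemma disc_a_nz: "disc_a F j \<noteq> 0"
  using cmod_disc_a_ge1[of F j, OF F1] by auto

lemma disc_D_nz: "disc_D F j k \<noteq> 0"
  using cmod_disc_D_ge1[of F j k, OF F1] by auto

lemma cmod_refl_less_1: "cmod (disc_b F j / cnj (disc_a F j)) < 1"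
proof -
  have "(cmod (disc_b F j))\<^sup>2 < (cmod (disc_a F j))\<^sup>2" using cmod_disc_a_disc_b[of F j, OF F1] by linarith
  then have "cmod (disc_b F j) < cmod (disc_a F j)" by (rule power2_less_imp_less) simp
  then show ?thesis using disc_a_nz[of j] by (simp add: norm_divide divide_less_eq)
qed

text \<open>At reflection coefficients the Bergman kernel is \<open>1 / disc_D^2\<close> up to
  factors that depend on one index alone. These factors are absorbed into the vectors, so the Gram
  matrix involves only transfer matrices between grid points.\<close>

lemma one_minus_refl: "1 - disc_b F j / cnj (disc_a F j) * cnj (disc_b F k / cnj (disc_a F k)) = disc_D F j k / (cnj (disc_a F j) * disc_a F k)"
  using disc_a_nz[of j] disc_a_nz[of k] by (simp add: disc_D_def field_simps)

text \<open>The right side is the squared norm of the combination of kernel vectors, and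
  \<open>disc_ker\<close> is their component along a unit vector. Take \<open>q\<close> as the
  reflection coefficient at \<open>N\<close> and divide by
  \<open>disc_log F N = - ln (1 - |q|^2)\<close>.\<close>

lemma kernel_Gram_bound:
  assumes fin: "finite I"
  shows "(cmod (\<Sum>j\<in>I. h j * disc_ker F N j))\<^sup>2 \<le> Re (\<Sum>j\<in>I. \<Sum>k\<in>I. h j * cnj (h k) / (disc_D F j k)\<^sup>2)"
proof -
  define z where "z j = disc_b F j / cnj (disc_a F j)" for j
  define v where "v j = h j / (cnj (disc_a F j))\<^sup>2" for j
  define G where "G = Re (\<Sum>j\<in>I. \<Sum>k\<in>I. h j * cnj (h k) / (disc_D F j k)\<^sup>2)"
  have G: "Re (\<Sum>j\<in>I. \<Sum>k\<in>I. v j * cnj (v k) / (1 - z j * cnj (z k))\<^sup>2) = G"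
    unfolding G_def
  proof (intro arg_cong[where f = Re] sum.cong refl)
    fix j k
    show "v j * cnj (v k) / (1 - z j * cnj (z k))\<^sup>2 = h j * cnj (h k) / (disc_D F j k)\<^sup>2"
      unfolding z_def one_minus_refl v_def using disc_a_nz[of j] disc_a_nz[of k] disc_D_nz[of j k]
      by (simp add: field_simps)
  qed
  have 1: "(cmod (\<Sum>j\<in>I. v j * cnj q / (1 - z j * cnj q)))\<^sup>2 \<le> G * (- ln (1 - (cmod q)\<^sup>2))"
    if "cmod q < 1" for q
    unfolding G[symmetric] using cmod_refl_less_1 that fin
    by (intro disc_kernel_Cauchy_Schwarz) (auto simp: z_def)
  show ?thesis
  proof (cases "disc_log F N = 0")
    case True
    \<comment> \<open>Division by zero makes \<open>disc_ker\<close> vanish here, so only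
      nonnegativity of the form remains; any nonzero \<open>q\<close> in the disc shows it.\<close>
    have h: "cmod (1/2) < 1" by (simp add: norm_divide)
    have "0 \<le> G * (- ln (1 - (cmod (1/2))\<^sup>2))"
      by (rule order_trans[OF zero_le_power2 1[OF h]])
    moreover have "- ln (1 - (cmod (1/2))\<^sup>2) > 0"
      by (simp add: norm_divide power2_eq_square)
    ultimately have "0 \<le> G" by (meson mult_neg_pos not_le)
    then show ?thesis using True by (simp add: disc_ker_def G_def)
  next
    case False
    then have u: "disc_log F N > 0" using disc_log_nonneg[of N] by simp
    define t where "t = complex_of_real (sqrt (disc_log F N))"
    have t: "t \<noteq> 0" using u by (simp add: t_def)
    have "1 - (cmod (z N))\<^sup>2 = 1 / (cmod (disc_a F N))\<^sup>2"
    proof -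
      have b: "(cmod (disc_b F N))\<^sup>2 = (cmod (disc_a F N))\<^sup>2 - 1"
        using cmod_disc_a_disc_b[of F N, OF F1] by linarith
      show ?thesis unfolding z_def norm_divide power_divide b complex_mod_cnj
        using disc_a_nz[of N] by (simp add: field_simps)
    qed
    then have 2: "- ln (1 - (cmod (z N))\<^sup>2) = disc_log F N"
      using disc_a_nz[of N] by (simp add: disc_log_def ln_div)
    have 3: "(\<Sum>j\<in>I. v j * cnj (z N) / (1 - z j * cnj (z N))) = t * (\<Sum>j\<in>I. h j * disc_ker F N j)"
      unfolding sum_distrib_left
    proof (intro sum.cong refl)
      fix j
      show "v j * cnj (z N) / (1 - z j * cnj (z N)) = t * (h j * disc_ker F N j)"
        unfolding z_def one_minus_refl v_def disc_ker_def t_def[symmetric]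
        using disc_a_nz[of j] disc_a_nz[of N] disc_D_nz[of j N] t by (simp add: power2_eq_square field_simps)
    qed
    have "(cmod t)\<^sup>2 = disc_log F N" using u by (simp add: t_def)
    with 1[of "z N"] cmod_refl_less_1[of N] have "(cmod (\<Sum>j\<in>I. h j * disc_ker F N j))\<^sup>2 * disc_log F N \<le> G * disc_log F N"
      unfolding 2 3 norm_mult power_mult_distrib by (simp add: z_def mult.commute)
    then show ?thesis using u by (simp add: G_def)
  qed
qed

text \<open>The case of a single index: the diagonal Gram entry is \<open>1\<close>, that is, each
  kernel vector has norm one.\<close>

lemma cmod_disc_ker_le_1: "cmod (disc_ker F N j) \<le> 1"
proof -
  have "(cmod (disc_ker F N j))\<^sup>2 \<le> 1"
    using kernel_Gram_bound[of "{j}" "\<lambda>_. 1" N] disc_D_diag[of F j, OF F1] by simp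
  then show ?thesis by (simp add: abs_square_le_1)
qed

end

section \<open>The logarithm expressed through the kernel\<close>

lemma minus_ln_cmod_one_minus_le:
  assumes "cmod \<eta> \<le> 1 / 5"
  shows "- ln (cmod (1 - \<eta>)) \<le> Re \<eta> + 5 * (cmod \<eta>)\<^sup>2"
proof -
  define r where "r = cmod \<eta>"
  \<comment> \<open>\<open>|1 - \<eta>|^2 = 1 - t\<close>, and \<open>ln (1 - t)\<close> is expanded
    to second order. With \<open>|t| \<le> (11/5) r\<close> the remainder
    \<open>t^2 - r^2 / 2\<close> stays below \<open>5 r^2\<close>.\<close>
  define t where "t = 2 * Re \<eta> - r\<^sup>2"
  have r: "0 \<le> r" "r \<le> 1/5" using assms by (auto simp: r_def)
  have r2: "r\<^sup>2 \<le> r / 5" using mult_left_mono[of r "1/5" r] r by (simp add: power2_eq_square)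
  have re: "\<bar>Re \<eta>\<bar> \<le> r" by (simp add: r_def abs_Re_le_cmod)
  have t1: "\<bar>t\<bar> \<le> 11/5 * r" using re r2 r zero_le_power2[of r] unfolding t_def by linarith
  have eq: "(cmod (1 - \<eta>))\<^sup>2 = 1 - t"
    unfolding t_def r_def cmod_power2 by (simp add: power2_eq_square algebra_simps)
  have pos: "cmod (1 - \<eta>) > 0" using assms by auto
  have "\<bar>ln (1 + (- t)) - (- t)\<bar> \<le> 2 * (- t)\<^sup>2"
    by (rule abs_ln_one_plus_x_minus_x_bound) (use t1 r in auto)
  then have "- ln (1 - t) \<le> t + 2 * t\<^sup>2" by simp
  moreover have "ln (1 - t) = 2 * ln (cmod (1 - \<eta>))"
    unfolding eq[symmetric] using pos by (simp add: ln_realpow)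
  moreover have "t\<^sup>2 \<le> (11/5 * r)\<^sup>2" using t1 by (metis abs_ge_zero power2_abs power_mono)
  ultimately have "- ln (cmod (1 - \<eta>)) \<le> Re \<eta> - r\<^sup>2 / 2 + 121 / 25 * r\<^sup>2"
    unfolding t_def by (simp add: power_mult_distrib power_divide)
  also have "\<dots> \<le> Re \<eta> + 5 * r\<^sup>2" using zero_le_power2[of r] by simp
  finally show ?thesis by (simp add: r_def)
qed

text \<open>A discrete fundamental theorem of calculus. Along the product, \<open>log |a|^2\<close>
  accumulates in increments that are \<open>U = sqrt (disc_log F N)\<close> times the real part of
  \<open>F j\<close> times the kernel, up to second order in \<open>F j\<close>. They sum to
  \<open>U^2\<close>, so one factor \<open>U\<close> cancels.\<close>

lemma sqrt_disc_log_le: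
  assumes F1: "\<And>j. cmod (F j) \<le> 1 / 2" and small: "\<And>j. cmod (F j) * sqrt (disc_log F N) \<le> 1 / 10"
  shows "sqrt (disc_log F N) \<le> Re (\<Sum>j<N. F j * disc_ker F N j) + (\<Sum>j<N. (cmod (F j))\<^sup>2) * (2 + 20 * sqrt (disc_log F N))"
proof (cases "disc_log F N = 0")
  case True
  then have "Re (\<Sum>j<N. F j * disc_ker F N j) = 0" by (simp add: disc_ker_def)
  then show ?thesis using True by (simp add: sum_nonneg)
next
  case False
  have F2: "cmod (F j) < 1" for j using F1[of j] by linarith
  define U where "U = sqrt (disc_log F N)"
  have U: "U > 0" "U\<^sup>2 = disc_log F N" using False disc_log_nonneg[of F N, OF F2] by (auto simp: U_def)
  \<comment> \<open>By \<open>one_minus_refl\<close>, \<open>L j\<close> equals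
    \<open>- ln |a_N| - ln |1 - \<rho>_j cnj \<rho>_N|\<close>. It moves from
    \<open>- ln |a_N|\<close> at \<open>0\<close> to \<open>ln |a_N|\<close> at \<open>N\<close>, so
    its total increment is \<open>U^2\<close>.\<close>
  define L where "L j = ln (cmod (disc_a F j)) - ln (cmod (disc_D F j N))" for j
  note nz = disc_a_nz[of F, OF F2] disc_D_nz[of F, OF F2]
  have step: "L (Suc j) - L j \<le> Re (F j * disc_ker F N j) * U + (2 * U + 20 * U\<^sup>2) * (cmod (F j))\<^sup>2" for j
  proof -
    define a where "a = disc_a F j"
    define b where "b = disc_b F j"
    \<comment> \<open>\<open>G\<close> is, up to sign, the first-order relative change of
      \<open>disc_D F j N / cnj (disc_a F j)\<close> in one step, and \<open>1 + zz\<close> is the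
      relative change of \<open>cnj (disc_a F j)\<close> before rescaling. The quotient
      \<open>\<eta>\<close> makes the change exact.\<close>
    define G where "G = F j * disc_ker F N j * complex_of_real U"
    define zz where "zz = F j * cnj b / cnj a"
    define \<eta> where "\<eta> = G / (1 + zz)"
    have a: "cmod a \<ge> 1" "a \<noteq> 0" using cmod_disc_a_ge1[of F j, OF F2] nz(1) by (auto simp: a_def)
    have "cmod (b / cnj a) < 1" using cmod_refl_less_1[of F j, OF F2] by (simp add: a_def b_def)
    then have zz: "cmod zz \<le> cmod (F j)" "cmod zz \<le> 1/2"
    proof -
      assume *: "cmod (b / cnj a) < 1"
      have "cmod zz = cmod (F j) * cmod (b / cnj a)" by (simp add: zz_def norm_mult norm_divide)
      also have "\<dots> \<le> cmod (F j) * 1" using * by (intro mult_left_mono) auto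
      finally show "cmod zz \<le> cmod (F j)" by simp
      then show "cmod zz \<le> 1/2" using F1[of j] by linarith
    qed
    have zz1: "cmod (1 + zz) \<ge> 1/2"
      using norm_triangle_ineq2[of 1 "- zz"] zz by simp
    then have zz0: "1 + zz \<noteq> 0" by auto
    have G: "cmod G \<le> cmod (F j) * U"
    proof -
      have "cmod G = cmod (F j) * cmod (disc_ker F N j) * U" using U by (simp add: G_def norm_mult)
      also have "\<dots> \<le> cmod (F j) * 1 * U" using U cmod_disc_ker_le_1[of F N j, OF F2]
        by (intro mult_right_mono mult_left_mono) auto
      finally show ?thesis by simp
    qed
    have eta: "cmod \<eta> \<le> 2 * cmod G"
      unfolding \<eta>_def norm_divide using zz1 zz0 mult_left_mono[of "1/2" "cmod (1+zz)" "2 * cmod G"]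
      by (simp add: divide_le_eq)
    have etaG: "Re \<eta> \<le> Re G + 2 * cmod (F j) * cmod G"
    proof -
      have "\<eta> - G = - (\<eta> * zz)" unfolding \<eta>_def using zz0 by (simp add: field_simps)
      then have "cmod (\<eta> - G) = cmod \<eta> * cmod zz" by (simp add: norm_mult)
      also have "\<dots> \<le> (2 * cmod G) * cmod (F j)" using eta zz by (intro mult_mono) auto
      finally have "Re (\<eta> - G) \<le> 2 * cmod G * cmod (F j)" using complex_Re_le_cmod order_trans by blast
      then show ?thesis by (simp add: mult_ac)
    qed
    have eta5: "cmod \<eta> \<le> 1/5" using eta G small[of j] by (simp add: U_def)
    have ratio: "disc_D F (Suc j) N / cnj (disc_a F (Suc j)) = (disc_D F j N / cnj a) * (1 - \<eta>)"
    proof -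
      define s where "s = su11_scale (F j)"
      have s: "s \<noteq> 0" "cnj s = s" using su11_scale_nz[OF F2] by (auto simp: s_def)
      have D1: "cnj a * a - b * cnj b = 1" using disc_D_diag[of F j, OF F2] by (simp add: disc_D_def a_def b_def)
      have d0: "cnj a + F j * cnj b \<noteq> 0"
      proof -
        have "cnj a + F j * cnj b = cnj a * (1 + zz)" using a by (simp add: zz_def field_simps)
        then show ?thesis using a zz0 by simp
      qed
      have e1: "\<eta> = F j * cnj (disc_b F N) / ((cnj a + F j * cnj b) * disc_D F j N)"
      proof -
        have "cnj a + F j * cnj b = cnj a * (1 + zz)" using a by (simp add: zz_def field_simps)
        then show ?thesis
          unfolding \<eta>_def G_def disc_ker_def U_def[symmetric] a_def[symmetric] using U a zz0 nz(2)[of j N]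
          by (simp add: field_simps)
      qed
      have e2: "disc_D F (Suc j) N / cnj (disc_a F (Suc j)) = disc_a F N - (b + F j * a) / (cnj a + F j * cnj b) * cnj (disc_b F N)"
      proof -
        define d where "d = cnj a + F j * cnj b"
        have 1: "cnj (disc_a F (Suc j)) = d / s"
          unfolding disc_a_Suc a_def[symmetric] b_def[symmetric] s_def[symmetric] d_def using s by simp
        have 2: "disc_b F (Suc j) = (b + F j * a) / s"
          unfolding disc_b_Suc a_def[symmetric] b_def[symmetric] s_def[symmetric] ..
        have "d \<noteq> 0" using d0 by (simp add: d_def)
        then show ?thesis unfolding disc_D_def 1 2 d_def[symmetric] using s
          by (simp add: field_simps)
      qed
      define d where "d = cnj a + F j * cnj b"
      define D where "D = disc_D F j N"
      define cb where "cb = cnj (disc_b F N)"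
      have nn: "d \<noteq> 0" "D \<noteq> 0" "cnj a \<noteq> 0"
        using d0 nz(2)[of j N] a by (simp_all add: d_def D_def)
      have e3: "(D / cnj a) * (1 - F j * cb / (d * D)) = D / cnj a - F j * cb / (cnj a * d)"
        using nn by (simp add: right_diff_distrib)
      have e4: "(b + F j * a) / d = b / cnj a + F j / (cnj a * d)"
      proof -
        have "(b + F j * a) * cnj a = b * d + F j * (cnj a * a - b * cnj b)"
          by (simp add: d_def algebra_simps)
        then have "(b + F j * a) * cnj a = b * d + F j" using D1 by simp
        then have "(b + F j * a) / d = (b * d + F j) / (cnj a * d)"
          using nn by (simp add: frac_eq_eq)
        then show ?thesis using nn by (simp add: add_divide_distrib)
      qed
      have e5: "D / cnj a = disc_a F N - b / cnj a * cb"
        using nn by (simp add: D_def disc_D_def a_def b_def cb_def diff_divide_distrib)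
      show ?thesis
        unfolding e2 e1 d_def[symmetric] D_def[symmetric] cb_def[symmetric] e3 e4
        unfolding e5 by (simp add: algebra_simps)
    qed
    have "L (Suc j) - L j = - ln (cmod (1 - \<eta>))"
    proof -
      have "1 - \<eta> \<noteq> 0" using eta5 by auto
      then have "ln (cmod (disc_D F (Suc j) N / cnj (disc_a F (Suc j)))) = ln (cmod (disc_D F j N / cnj a)) + ln (cmod (1 - \<eta>))"
        unfolding ratio norm_mult using a nz by (intro ln_mult_pos) auto
      then show ?thesis unfolding norm_divide L_def using nz a by (simp add: ln_div a_def)
    qed
    also have "\<dots> \<le> Re \<eta> + 5 * (cmod \<eta>)\<^sup>2" by (rule minus_ln_cmod_one_minus_le[OF eta5])
    \<comment> \<open>\<open>|\<eta>| \<le> 2 |F j| U\<close> turns the logarithm's remainder into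
      \<open>20 |F j|^2 U^2\<close>, and replacing \<open>\<eta>\<close> by \<open>G\<close> costs
      \<open>2 |F j|^2 U\<close>.\<close>
    also have "\<dots> \<le> Re G + 2 * cmod (F j) * (cmod (F j) * U) + 5 * (2 * (cmod (F j) * U))\<^sup>2"
    proof -
      have "cmod \<eta> \<le> 2 * (cmod (F j) * U)" using eta G by linarith
      then have "(cmod \<eta>)\<^sup>2 \<le> (2 * (cmod (F j) * U))\<^sup>2" by (intro power_mono) auto
      moreover have "2 * cmod (F j) * cmod G \<le> 2 * cmod (F j) * (cmod (F j) * U)"
        using G by (intro mult_left_mono) auto
      ultimately show ?thesis using etaG by linarith
    qed
    also have "Re G = Re (F j * disc_ker F N j) * U" by (simp add: G_def)
    finally show ?thesis by (simp add: power2_eq_square algebra_simps)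
  qed
  have "L N - L 0 = (\<Sum>j<N. L (Suc j) - L j)" by (simp add: sum_lessThan_telescope)
  also have "\<dots> \<le> (\<Sum>j<N. Re (F j * disc_ker F N j) * U + (2 * U + 20 * U\<^sup>2) * (cmod (F j))\<^sup>2)"
    by (intro sum_mono step)
  also have "\<dots> = (\<Sum>j<N. Re (F j * disc_ker F N j)) * U + (2 * U + 20 * U\<^sup>2) * (\<Sum>j<N. (cmod (F j))\<^sup>2)"
    by (simp only: sum.distrib sum_distrib_left sum_distrib_right)
  also have "\<dots> = U * (Re (\<Sum>j<N. F j * disc_ker F N j) + (\<Sum>j<N. (cmod (F j))\<^sup>2) * (2 + 20 * U))"
    unfolding Re_sum by (simp only: power2_eq_square distrib_left distrib_right mult_ac add_ac)
  finally have "L N - L 0 \<le> U * (Re (\<Sum>j<N. F j * disc_ker F N j) + (\<Sum>j<N. (cmod (F j))\<^sup>2) * (2 + 20 * U))" .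
  moreover have "L N - L 0 = U * U"
  proof -
    have "U * U = 2 * ln (cmod (disc_a F N))"
      using U nz(1)[of N] by (simp add: power2_eq_square[symmetric] disc_log_def ln_realpow)
    then show ?thesis using disc_D_diag[of F N, OF F2] by (simp add: L_def disc_D_0)
  qed
  ultimately have "U \<le> Re (\<Sum>j<N. F j * disc_ker F N j) + (\<Sum>j<N. (cmod (F j))\<^sup>2) * (2 + 20 * U)"
    using U by (metis mult_le_cancel_left_pos)
  then show ?thesis by (simp add: U_def)
qed

section \<open>The kernel operator on the circle\<close>

text \<open>With the phases conjugated away, the entries of the transfer matrix over the sites
  \<open>k, ..., k + m - 1\<close> become polynomials in \<open>w\<close>: the phase difference of
  neighbouring sites is the factor \<open>w\<close> in \<open>shift_b\<close>. This continues
  \<open>disc_D\<close> from the circle into the disc.\<close>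

fun shift_a shift_b :: "(nat \<Rightarrow> complex) \<Rightarrow> nat \<Rightarrow> nat \<Rightarrow> complex \<Rightarrow> complex" where
  "shift_a c k 0 w = 1"
| "shift_a c k (Suc m) w = (shift_a c k m w + cnj (c (k + m)) * shift_b c k m w) / su11_scale (c (k + m))"
| "shift_b c k 0 w = 0"
| "shift_b c k (Suc m) w = w * (shift_b c k m w + c (k + m) * shift_a c k m w) / su11_scale (c (k + m))"

lemma holomorphic_shift_a_shift_b: "shift_a c k m holomorphic_on S" "shift_b c k m holomorphic_on S"
proof (induction m)
  case 0
  have "shift_a c k 0 = (\<lambda>_. 1)" "shift_b c k 0 = (\<lambda>_. 0)" by auto
  then show "shift_a c k 0 holomorphic_on S" "shift_b c k 0 holomorphic_on S" by simp_all
next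
  case (Suc m)
  have eq: "shift_a c k (Suc m) = (\<lambda>w. (shift_a c k m w + cnj (c (k + m)) * shift_b c k m w) * inverse (su11_scale (c (k + m))))"
    "shift_b c k (Suc m) = (\<lambda>w. w * (shift_b c k m w + c (k + m) * shift_a c k m w) * inverse (su11_scale (c (k + m))))"
    by (auto simp: divide_inverse)
  show "shift_a c k (Suc m) holomorphic_on S" "shift_b c k (Suc m) holomorphic_on S"
    unfolding eq by (intro holomorphic_intros Suc)+
qed

lemma shift_b_at_0 [simp]: "shift_b c k m 0 = 0"
  by (cases m) simp_all

lemma shift_a_at_0: "shift_a c k m 0 = (\<Prod>i<m. 1 / su11_scale (c (k + i)))"
  by (induction m) simp_all

text \<open>Each SU(1,1) step preserves \<open>|A|^2 - |B|^2\<close>, and the factor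
  \<open>w\<close> only shrinks \<open>B\<close> when \<open>|w| \<le> 1\<close>. Hence the
  continued diagonal entry has no zeros in the closed disc, so that its reciprocal and its logarithm
  are holomorphic.\<close>

lemma shift_a_shift_b_disc:
  assumes c: "\<And>j. cmod (c j) < 1" and w: "cmod w \<le> 1"
  shows "1 + (cmod (shift_b c k m w))\<^sup>2 \<le> (cmod (shift_a c k m w))\<^sup>2"
proof (induction m)
  case (Suc m)
  define A where "A = shift_a c k m w"
  define B where "B = shift_b c k m w"
  define z where "z = c (k + m)"
  have z: "su11_scale z * cnj (su11_scale z) = 1 - z * cnj z" "su11_scale z \<noteq> 0"
    using su11_scale_mult[of z] su11_scale_nz[of z] c[of "k+m"] by (simp_all add: z_def)
  define A' where "A' = (A + cnj z * B) / su11_scale z"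
  define B' where "B' = (B + z * A) / su11_scale z"
  have "(A' * cnj A' - B' * cnj B') * (su11_scale z * cnj (su11_scale z)) = (A * cnj A - B * cnj B) * (1 - z * cnj z)"
    unfolding A'_def B'_def using z(2) by (simp add: field_simps)
  then have "A' * cnj A' - B' * cnj B' = A * cnj A - B * cnj B"
    using z by (metis mult_right_cancel mult_eq_0_iff complex_cnj_zero_iff)
  then have "complex_of_real ((cmod A')\<^sup>2 - (cmod B')\<^sup>2) = complex_of_real ((cmod A)\<^sup>2 - (cmod B)\<^sup>2)"
    unfolding of_real_diff complex_norm_square .
  then have "(cmod A')\<^sup>2 - (cmod B')\<^sup>2 = (cmod A)\<^sup>2 - (cmod B)\<^sup>2" by (simp only: of_real_eq_iff)
  moreover have "(cmod (w * B'))\<^sup>2 \<le> (cmod B')\<^sup>2"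
    using w by (intro power_mono) (auto simp: norm_mult mult_left_le_one_le)
  moreover have eq: "shift_a c k (Suc m) w = A'" "shift_b c k (Suc m) w = w * B'"
    by (simp_all add: A'_def B'_def A_def B_def z_def)
  ultimately show ?case using Suc unfolding eq A_def B_def by linarith
qed simp

lemma shift_a_disc_nz:
  assumes "\<And>j. cmod (c j) < 1" "cmod w \<le> 1"
  shows "shift_a c k m w \<noteq> 0"
proof
  assume "shift_a c k m w = 0"
  then show False using shift_a_shift_b_disc[of c w k m] assms zero_le_power2[of "cmod (shift_b c k m w)"] by simp
qed

lemma su11_scale_cong: "cmod x = cmod y \<Longrightarrow> su11_scale x = su11_scale y"
  by (simp add: su11_scale_def)

text \<open>Conjugation by a diagonal phase matrix leaves the diagonal entries alone. The induction
  has to carry the other entry \<open>Q\<close> as well, whose phase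
  \<open>\<kappa> cnj w ^ j\<close> is removed by the factor in front.\<close>

lemma disc_D_eq_shift_a:
  assumes c: "\<And>j. cmod (c j) < 1" and w: "cmod w = 1" and \<kappa>: "cmod \<kappa> = 1"
  defines "F \<equiv> \<lambda>j. c j * \<kappa> * cnj w ^ j"
  shows "disc_D F k (k + m) = shift_a c k m w"
proof -
  have ww: "w * cnj w = 1" "cnj w * w = 1" and kk: "\<kappa> * cnj \<kappa> = 1" "cnj \<kappa> * \<kappa> = 1"
    using w \<kappa> complex_norm_square[of w] complex_norm_square[of \<kappa>] by (simp_all add: mult.commute)
  have F1: "cmod (F j) < 1" for j using c[of j] by (simp add: F_def norm_mult norm_power w \<kappa>)
  have snF: "su11_scale (F j) = su11_scale (c j)" for j by (rule su11_scale_cong) (simp add: F_def norm_mult norm_power w \<kappa>)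
  define Q where "Q j = disc_b F j * cnj (disc_a F k) - cnj (disc_a F j) * disc_b F k" for j
  have P: "disc_D F k (Suc j) = (disc_D F k j + cnj (F j) * Q j) / su11_scale (c j)" for j
    unfolding disc_D_def Q_def disc_a_Suc disc_b_Suc snF by (simp add: field_simps diff_divide_distrib[symmetric])
  have Q: "Q (Suc j) = (Q j + F j * disc_D F k j) / su11_scale (c j)" for j
    unfolding disc_D_def Q_def disc_a_Suc disc_b_Suc snF by (simp add: field_simps diff_divide_distrib[symmetric])
  have "disc_D F k (k + m) = shift_a c k m w \<and> cnj \<kappa> * w ^ (k + m) * Q (k + m) = shift_b c k m w"
  proof (induction m)
    case 0
    then show ?case using disc_D_diag[of F k, OF F1] by (simp add: Q_def)
  next
    case (Suc m)
    define j where "j = k + m"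
    have wj: "w ^ j * cnj w ^ j = 1" using ww by (simp add: power_mult_distrib[symmetric])
    have Qj: "Q j = \<kappa> * cnj w ^ j * shift_b c k m w"
    proof -
      have "\<kappa> * cnj w ^ j * shift_b c k m w = (\<kappa> * cnj \<kappa>) * (w ^ j * cnj w ^ j) * Q j"
        using Suc by (simp add: j_def[symmetric] mult_ac)
      then show ?thesis using kk wj by simp
    qed
    have 1: "cnj (F j) * Q j = cnj (c j) * shift_b c k m w"
    proof -
      have "cnj (F j) * Q j = cnj (c j) * shift_b c k m w * (\<kappa> * cnj \<kappa>) * (w ^ j * cnj w ^ j)"
        unfolding Qj F_def by (simp add: mult_ac)
      then show ?thesis using kk wj by simp
    qed
    have 2: "cnj \<kappa> * w ^ j * (Q j + F j * disc_D F k j) = shift_b c k m w + c j * shift_a c k m w"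
    proof -
      have "cnj \<kappa> * w ^ j * (Q j + F j * disc_D F k j) = cnj \<kappa> * w ^ j * Q j + c j * disc_D F k j * (\<kappa> * cnj \<kappa>) * (w ^ j * cnj w ^ j)"
        unfolding F_def by (simp add: algebra_simps)
      then show ?thesis using kk wj Suc by (simp add: j_def)
    qed
    have "disc_D F k (k + Suc m) = shift_a c k (Suc m) w"
      using P[of j] 1 Suc by (simp add: j_def)
    moreover have "cnj \<kappa> * w ^ (k + Suc m) * Q (k + Suc m) = w * (cnj \<kappa> * w ^ j * (Q j + F j * disc_D F k j)) / su11_scale (c j)"
      using Q[of j] by (simp add: j_def mult_ac)
    ultimately show ?case unfolding 2 by (simp add: j_def)
  qed
  then show ?thesis by simp
qed

section \<open>Mean values over one period\<close>

definition period :: "real measure" where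
  "period = restrict_space lborel {-1/2..1/2}"

lemma finite_measure_period: "finite_measure period"
  by (rule finite_measureI) (simp add: period_def emeasure_restrict_space space_restrict_space)

lemma borel_measurable_period: "f \<in> borel_measurable borel \<Longrightarrow> f \<in> borel_measurable period"
  unfolding period_def by (rule measurable_restrict_space1) simp

lemma integral_period:
  fixes f :: "real \<Rightarrow> complex"
  assumes "continuous_on {-1/2..1/2} f" "(f has_integral I) {-1/2..1/2}"
  shows "integrable period f" "(\<integral>t. f t \<partial>period) = I"
proof -
  have "set_integrable lborel {-1/2..1/2} f" by (rule borel_integrable_atLeastAtMost'[OF assms(1)])
  then show "integrable period f" unfolding period_def
    by (subst integrable_restrict_space) (simp_all add: set_integrable_def)
  have "(\<integral>t. f t \<partial>period) = (LINT t:{-1/2..1/2}|lborel. f t)"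
    unfolding period_def set_lebesgue_integral_def by (rule integral_restrict_space) simp
  also have "\<dots> = I"
    using set_borel_integral_eq_integral(2)[OF \<open>set_integrable lborel {-1/2..1/2} f\<close>] assms(2) by (simp add: integral_unique)
  finally show "(\<integral>t. f t \<partial>period) = I" .
qed

lemma circle_mean_value:
  fixes g :: "complex \<Rightarrow> complex"
  assumes hol: "g holomorphic_on cball 0 1"
  shows "integrable period (\<lambda>t. g (cis (2 * pi * t)))" "(\<integral>t. g (cis (2 * pi * t)) \<partial>period) = g 0"
proof -
  have cont: "continuous_on (cball 0 1) g" using hol by (rule holomorphic_on_imp_continuous_on)
  have c1: "continuous_on {-1/2..1/2} (\<lambda>t::real. g (cis (2 * pi * t)))"
    by (intro continuous_on_compose2[OF cont] continuous_intros) auto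
  \<comment> \<open>The contour is parametrised over \<open>[0, 1]\<close>, whereas the period is
    centred at \<open>0\<close>; the shift by half a period is the reflection of \<open>w\<close> to
    \<open>- w\<close>.\<close>
  have hol': "(\<lambda>w. g (- w)) holomorphic_on cball 0 1"
    by (rule holomorphic_on_compose_gen[OF _ hol, unfolded o_def]) (auto intro!: holomorphic_intros)
  define d where "d = 2 * complex_of_real pi * \<i>"
  have d: "d \<noteq> 0" by (simp add: d_def)
  have "((\<lambda>u. g (- u) / (u - 0)) has_contour_integral (d * g 0)) (circlepath 0 1)"
    using Cauchy_integral_circlepath_simple[OF hol', of 0] by (simp add: d_def)
  then have "((\<lambda>x. g (- exp (d * x)) * d) has_integral (d * g 0)) {0..1::real}"
    unfolding has_contour_integral_def
    by (rule has_integral_eq[rotated]) (auto simp: vector_derivative_circlepath01 circlepath_def[symmetric] circlepath[of 0 1, THEN fun_cong] d_def mult_ac)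
  then have "((\<lambda>x. (g (- exp (d * x)) * d) * inverse d) has_integral (d * g 0) * inverse d) {0..1::real}"
    by (rule has_integral_mult_left)
  moreover have "(d * g 0) * inverse d = g 0" "(g (- exp (d * x)) * d) * inverse d = g (- exp (d * x))" for x
    using d by (simp_all add: mult.assoc)
  ultimately have "((\<lambda>x. g (- exp (d * x))) has_integral g 0) {0..1::real}" by simp
  moreover have "- exp (d * x) = cis (2 * pi * (- (1/2) + x))" for x :: real
  proof -
    have "cis (2 * pi * (- (1/2) + x)) = cis (- pi) * cis (2 * pi * x)"
      unfolding cis_mult by (simp add: algebra_simps)
    also have "cis (2 * pi * x) = exp (d * x)" by (simp add: cis_conv_exp d_def mult_ac)
    also have "cis (- pi) = -1" by (simp add: cis.code complex_eq_iff)
    finally show ?thesis by simp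
  qed
  ultimately have "((\<lambda>x. g (cis (2 * pi * (- (1/2) + x)))) has_integral g 0) {0..1::real}" by simp
  then have "((\<lambda>x. g (cis (2 * pi * x))) has_integral g 0) {-1/2..1/2::real}"
    using has_integral_shift_Icc_real[of "\<lambda>x. g (cis (2 * pi * x))" "-(1/2)" "g 0" 0 1] by (simp add: o_def)
  from integral_period[OF c1 this]
  show "integrable period (\<lambda>t. g (cis (2 * pi * t)))" "(\<integral>t. g (cis (2 * pi * t)) \<partial>period) = g 0" .
qed

text \<open>This is \<open>w\<^sup>K\<^sup>-\<^sup>j\<close> for \<open>w = e\<^sup>2\<^sup>\<pi>\<^sup>i\<^sup>t\<close>; the exponent may be negative.\<close>

definition phase :: "nat \<Rightarrow> nat \<Rightarrow> real \<Rightarrow> complex" where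
  "phase K j t = cis (2 * pi * t) ^ K * cnj (cis (2 * pi * t)) ^ j"

lemma cmod_phase [simp]: "cmod (phase K j t) = 1"
  by (simp add: phase_def norm_mult norm_power)

text \<open>For \<open>j \<le> k\<close> the integrand is \<open>w^(k-j) / shift_a^2\<close> on the
  circle, holomorphic in the closed disc, so its mean is the value at \<open>0\<close>. This is zero
  unless \<open>j = k\<close>, when \<open>shift_a\<close> is constantly \<open>1\<close>. The
  opposite order follows by conjugation.\<close>

lemma phase_orthonormal:
  assumes c: "\<And>j. cmod (c j) < 1"
  shows "integrable period (\<lambda>t. phase K j t * cnj (phase K k t) / (disc_D (\<lambda>i. c i * phase K i t) j k)\<^sup>2)" (is "integrable _ (?f j k)")
    and "(\<integral>t. phase K j t * cnj (phase K k t) / (disc_D (\<lambda>i. c i * phase K i t) j k)\<^sup>2 \<partial>period) = (if j = k then 1 else 0)"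
proof -
  have F: "(\<lambda>i. c i * phase K i t) = (\<lambda>i. c i * cis (2 * pi * t) ^ K * cnj (cis (2 * pi * t)) ^ i)" for t
    by (simp add: phase_def mult_ac)
  have le: "integrable period (?f j (j + m)) \<and> (\<integral>t. ?f j (j + m) t \<partial>period) = (if m = 0 then 1 else 0)" for j m
  proof -
    define g where "g w = w ^ m / (shift_a c j m w)\<^sup>2" for w
    have "?f j (j + m) = (\<lambda>t. g (cis (2 * pi * t)))"
    proof
      fix t :: real
      define w where "w = cis (2 * pi * t)"
      have w: "cmod w = 1" "w * cnj w = 1" by (simp_all add: w_def cis_cnj cis_mult)
      have wn: "w ^ n * cnj w ^ n = 1" for n using w(2) by (simp add: power_mult_distrib[symmetric])
      have "disc_D (\<lambda>i. c i * phase K i t) j (j + m) = shift_a c j m w"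
        unfolding F w_def[symmetric] by (rule disc_D_eq_shift_a[OF c]) (simp_all add: w norm_power)
      moreover have "phase K j t * cnj (phase K (j + m) t) = w ^ m * (w ^ K * cnj w ^ K) * (w ^ j * cnj w ^ j)"
        unfolding phase_def w_def[symmetric] by (simp add: power_add mult_ac)
      ultimately show "?f j (j + m) t = g (cis (2 * pi * t))"
        unfolding g_def w_def[symmetric] by (simp add: wn)
    qed
    moreover have "g holomorphic_on cball 0 1"
      unfolding g_def using shift_a_disc_nz[of c, OF c] by (intro holomorphic_intros holomorphic_shift_a_shift_b) auto
    moreover have "g 0 = (if m = 0 then 1 else 0)" by (simp add: g_def)
    ultimately show ?thesis using circle_mean_value[of g] by simp
  qed
  have sym: "?f k j = (\<lambda>t. cnj (?f j k t))" for j k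
    by (simp add: cnj_disc_D mult.commute)
  have sym': "?f j k = (\<lambda>t. cnj (?f k j t))" by (rule sym)
  have "integrable period (?f j k) \<and> (\<integral>t. ?f j k t \<partial>period) = (if j = k then 1 else 0)"
  proof (cases "j \<le> k")
    case True
    then obtain m where "k = j + m" using le_Suc_ex by blast
    then show ?thesis using le[of j m] by simp
  next
    case False
    then obtain m where m: "j = k + m" using le_Suc_ex[of k j] by auto
    have cnj: "integrable period (\<lambda>t. cnj (q t)) \<and> (\<integral>t. cnj (q t) \<partial>period) = 0"
      if "integrable period q \<and> (\<integral>t. q t \<partial>period) = 0" for q
      using that by simp
    have "integrable period (?f k j) \<and> (\<integral>t. ?f k j t \<partial>period) = 0"
      using le[of k m] False unfolding m by simp
    from cnj[OF this] show ?thesis unfolding sym' using False by simp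
  qed
  then show "integrable period (?f j k)" "(\<integral>t. ?f j k t \<partial>period) = (if j = k then 1 else 0)" by auto
qed

lemma borel_measurable_phase [measurable]: "phase K j \<in> borel_measurable borel"
  unfolding phase_def by (intro borel_measurable_continuous_onI continuous_intros)

lemma continuous_disc_a_disc_b:
  assumes c: "\<And>j. cmod (c j) < 1"
  shows "continuous_on UNIV (\<lambda>t. disc_a (\<lambda>i. c i * phase K i t) j)" "continuous_on UNIV (\<lambda>t. disc_b (\<lambda>i. c i * phase K i t) j)"
proof (induction j)
  case (Suc j)
  have s: "su11_scale (c j * phase K j t) = su11_scale (c j)" for t by (rule su11_scale_cong) (simp add: norm_mult)
  have ph: "continuous_on UNIV (phase K j)" unfolding phase_def by (intro continuous_intros)
  show "continuous_on UNIV (\<lambda>t. disc_a (\<lambda>i. c i * phase K i t) (Suc j))" "continuous_on UNIV (\<lambda>t. disc_b (\<lambda>i. c i * phase K i t) (Suc j))"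
    unfolding disc_a_Suc disc_b_Suc s using su11_scale_nz[OF c] by (intro continuous_intros ph Suc; simp)+
qed simp_all

lemma borel_measurable_disc_ker:
  assumes c: "\<And>j. cmod (c j) < 1"
  shows "(\<lambda>t. disc_ker (\<lambda>i. c i * phase K i t) N j) \<in> borel_measurable borel"
    "(\<lambda>t. disc_log (\<lambda>i. c i * phase K i t) N) \<in> borel_measurable borel"
proof -
  note [measurable] = borel_measurable_continuous_onI[OF continuous_disc_a_disc_b(1)[OF c]]
    borel_measurable_continuous_onI[OF continuous_disc_a_disc_b(2)[OF c]]
    borel_measurable_continuous_onI[of cnj, OF continuous_on_cnj[OF continuous_on_id]]
  show "(\<lambda>t. disc_ker (\<lambda>i. c i * phase K i t) N j) \<in> borel_measurable borel"
    "(\<lambda>t. disc_log (\<lambda>i. c i * phase K i t) N) \<in> borel_measurable borel"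
    unfolding disc_ker_def disc_log_def disc_D_def by measurable
qed

text \<open>Averaged over a period the Gram matrix becomes the identity, so
  \<open>kernel_Gram_bound\<close> yields a Bessel inequality. The coefficients \<open>h\<close> are
  unrelated to the data \<open>c\<close> of the kernel: this is the linear operator to be
  interpolated.\<close>

lemma kernel_L2_contraction:
  assumes c: "\<And>j. cmod (c j) < 1"
  shows "(\<integral>t. (cmod (\<Sum>j<N. h j * (phase K j t * disc_ker (\<lambda>i. c i * phase K i t) N' j)))\<^sup>2 \<partial>period) \<le> (\<Sum>j<N. (cmod (h j))\<^sup>2)"
proof -
  define f where "f j k t = phase K j t * cnj (phase K k t) / (disc_D (\<lambda>i. c i * phase K i t) j k)\<^sup>2" for j k t
  have f: "integrable period (f j k)" "(\<integral>t. f j k t \<partial>period) = (if j = k then 1 else 0)" for j k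
    unfolding f_def by (rule phase_orthonormal[of c, OF c])+
  define G where "G t = (\<Sum>j<N. \<Sum>k<N. h j * cnj (h k) * f j k t)" for t
  have F1: "cmod (c i * phase K i t) < 1" for i t using c by (simp add: norm_mult)
  have G: "integrable period G" "(\<integral>t. G t \<partial>period) = (\<Sum>j<N. \<Sum>k<N. h j * cnj (h k) * (if j = k then 1 else 0))"
    unfolding G_def using f by simp_all
  have "(\<Sum>j<N. \<Sum>k<N. h j * cnj (h k) * (if j = k then 1 else 0)) = (\<Sum>j<N. h j * cnj (h j))"
    by (intro sum.cong refl) (simp add: if_distrib cong: if_cong)
  also have "\<dots> = complex_of_real (\<Sum>j<N. (cmod (h j))\<^sup>2)" by (simp only: of_real_sum complex_norm_square)
  finally have G2: "(\<integral>t. G t \<partial>period) = complex_of_real (\<Sum>j<N. (cmod (h j))\<^sup>2)" using G by simp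
  have le: "(cmod (\<Sum>j<N. h j * (phase K j t * disc_ker (\<lambda>i. c i * phase K i t) N' j)))\<^sup>2 \<le> Re (G t)" for t
  proof -
    have "(cmod (\<Sum>j<N. (h j * phase K j t) * disc_ker (\<lambda>i. c i * phase K i t) N' j))\<^sup>2
      \<le> Re (\<Sum>j<N. \<Sum>k<N. (h j * phase K j t) * cnj (h k * phase K k t) / (disc_D (\<lambda>i. c i * phase K i t) j k)\<^sup>2)"
      by (rule kernel_Gram_bound[OF F1]) simp
    then show ?thesis unfolding G_def f_def by (simp add: mult_ac)
  qed
  have G0: "0 \<le> Re (G t)" for t by (rule order_trans[OF zero_le_power2 le])
  have "(\<integral>t. (cmod (\<Sum>j<N. h j * (phase K j t * disc_ker (\<lambda>i. c i * phase K i t) N' j)))\<^sup>2 \<partial>period) \<le> (\<integral>t. Re (G t) \<partial>period)"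
    by (intro integral_mono_AE' AE_I2 le G0) (use G in auto)
  also have "\<dots> = Re (\<integral>t. G t \<partial>period)" using G(1) by (rule integral_Re)
  also have "\<dots> = (\<Sum>j<N. (cmod (h j))\<^sup>2)" unfolding G2 by (rule Re_complex_of_real)
  finally show ?thesis .
qed

text \<open>Jensen's formula without zeros: \<open>ln |shift_a|^2\<close> is twice the real part of
  a holomorphic logarithm, and its mean is the value at the centre, where \<open>shift_a\<close> is
  the product of the normalising factors.\<close>

lemma log_Parseval:
  assumes c: "\<And>j. cmod (c j) < 1"
  shows "integrable period (\<lambda>t. disc_log (\<lambda>i. c i * phase K i t) N)"
    "(\<integral>t. disc_log (\<lambda>i. c i * phase K i t) N \<partial>period) = (\<Sum>j<N. - ln (1 - (cmod (c j))\<^sup>2))"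
proof -
  have nz: "shift_a c 0 N w \<noteq> 0" if "w \<in> cball 0 1" for w using shift_a_disc_nz[of c w 0 N, OF c] that by simp
  obtain g where g: "g holomorphic_on cball 0 1" "\<And>w. w \<in> cball 0 1 \<Longrightarrow> shift_a c 0 N w = exp (g w)"
    using contractible_imp_holomorphic_log[OF holomorphic_shift_a_shift_b(1) _ nz]
    by (metis convex_cball convex_imp_contractible)
  have eq: "disc_log (\<lambda>i. c i * phase K i t) N = 2 * Re (g (cis (2 * pi * t)))" for t
  proof -
    have F: "(\<lambda>i. c i * phase K i t) = (\<lambda>i. c i * cis (2 * pi * t) ^ K * cnj (cis (2 * pi * t)) ^ i)"
      by (simp add: phase_def mult_ac)
    have "disc_D (\<lambda>i. c i * phase K i t) 0 (0 + N) = shift_a c 0 N (cis (2 * pi * t))"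
      unfolding F by (rule disc_D_eq_shift_a[OF c]) (simp_all add: norm_power)
    then have "disc_a (\<lambda>i. c i * phase K i t) N = exp (g (cis (2 * pi * t)))"
      using g(2)[of "cis (2 * pi * t)"] by (simp add: disc_D_0)
    then show ?thesis by (simp add: disc_log_def norm_exp_eq_Re ln_realpow)
  qed
  have m: "integrable period (\<lambda>t. g (cis (2 * pi * t)))" "(\<integral>t. g (cis (2 * pi * t)) \<partial>period) = g 0"
    using circle_mean_value[OF g(1)] by auto
  show "integrable period (\<lambda>t. disc_log (\<lambda>i. c i * phase K i t) N)" unfolding eq using m(1) by simp
  have "(\<integral>t. disc_log (\<lambda>i. c i * phase K i t) N \<partial>period) = 2 * Re (g 0)"
    unfolding eq using m by simp
  also have "Re (g 0) = ln (cmod (shift_a c 0 N 0))" using g(2)[of 0] by simp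
  also have "cmod (shift_a c 0 N 0) = (\<Prod>i<N. 1 / sqrt (1 - (cmod (c i))\<^sup>2))"
    unfolding shift_a_at_0 prod_norm[symmetric] by (intro prod.cong refl) (simp add: norm_divide cmod_su11_scale[OF c])
  also have "ln \<dots> = (\<Sum>i<N. ln (1 / sqrt (1 - (cmod (c i))\<^sup>2)))"
  proof (intro ln_prod finite_lessThan)
    fix i assume "i \<in> {..<N}"
    have "1 - (cmod (c i))\<^sup>2 > 0" using c[of i] by (simp add: abs_square_less_1)
    then show "1 / sqrt (1 - (cmod (c i))\<^sup>2) \<noteq> 0" by simp
  qed
  also have "2 * \<dots> = (\<Sum>i<N. - ln (1 - (cmod (c i))\<^sup>2))"
    unfolding sum_distrib_left
  proof (intro sum.cong refl)
    fix i assume "i \<in> {..<N}"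
    have "1 - (cmod (c i))\<^sup>2 > 0" using c[of i] by (simp add: abs_square_less_1)
    then show "2 * ln (1 / sqrt (1 - (cmod (c i))\<^sup>2)) = - ln (1 - (cmod (c i))\<^sup>2)"
      by (simp add: ln_div ln_sqrt)
  qed
  finally show "(\<integral>t. disc_log (\<lambda>i. c i * phase K i t) N \<partial>period) = (\<Sum>j<N. - ln (1 - (cmod (c j))\<^sup>2))" .
qed

section \<open>Interpolation\<close>

text \<open>An exponential factor normalises both boundary values to \<open>1\<close>, and
  \<open>exp (\<delta> (z^2 - 1))\<close> damps along the strip; then \<open>\<delta>\<close> tends
  to \<open>0\<close>. \<open>F\<close> is entire because it will be a finite exponential
  sum.\<close>

lemma three_lines:
  fixes F :: "complex \<Rightarrow> complex"
  assumes hol: "F holomorphic_on UNIV"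
    and bd: "\<And>z. 0 \<le> Re z \<Longrightarrow> Re z \<le> 1 \<Longrightarrow> cmod (F z) \<le> B"
    and F0: "\<And>z. Re z = 0 \<Longrightarrow> cmod (F z) \<le> M0" and F1: "\<And>z. Re z = 1 \<Longrightarrow> cmod (F z) \<le> M1"
    and M: "0 < M0" "0 < M1" and \<theta>: "0 \<le> \<theta>" "\<theta> \<le> 1"
  shows "cmod (F (complex_of_real \<theta>)) \<le> M0 powr (1 - \<theta>) * M1 powr \<theta>"
proof -
  define H where "H z = F z * exp ((z - 1) * ln M0 - z * ln M1)" for z
  define K where "K = exp (\<bar>ln M0\<bar> + \<bar>ln M1\<bar>)"
  have normH: "cmod (H z) = cmod (F z) * exp ((Re z - 1) * ln M0 - Re z * ln M1)" for z
    by (simp add: H_def norm_mult)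
  have B0: "0 \<le> B" using bd[of 0] norm_ge_zero[of "F 0"] by (simp del: norm_ge_zero)
  have Hb: "cmod (H z) \<le> B * K" if "0 \<le> Re z" "Re z \<le> 1" for z
  proof -
    have "(Re z - 1) * ln M0 \<le> \<bar>Re z - 1\<bar> * \<bar>ln M0\<bar>" by (metis abs_ge_self abs_mult)
    also have "\<dots> \<le> 1 * \<bar>ln M0\<bar>" using that by (intro mult_right_mono) auto
    finally have 1: "(Re z - 1) * ln M0 \<le> \<bar>ln M0\<bar>" by simp
    have "- (Re z * ln M1) \<le> \<bar>Re z\<bar> * \<bar>ln M1\<bar>" by (metis abs_ge_minus_self abs_mult)
    also have "\<dots> \<le> 1 * \<bar>ln M1\<bar>" using that by (intro mult_right_mono) auto
    finally have "(Re z - 1) * ln M0 - Re z * ln M1 \<le> \<bar>ln M0\<bar> + \<bar>ln M1\<bar>" using 1 by simp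
    then show ?thesis unfolding normH K_def using bd[OF that] B0 by (intro mult_mono) auto
  qed
  have H0: "cmod (H z) \<le> 1" if "Re z = 0" for z
    unfolding normH using F0[OF that] that M by (simp add: exp_minus field_simps)
  have H1: "cmod (H z) \<le> 1" if "Re z = 1" for z
    unfolding normH using F1[OF that] that M by (simp add: exp_minus field_simps)
  have "cmod (H \<theta>) \<le> exp \<delta>" if \<delta>: "\<delta> > 0" for \<delta>
  proof -
    define f where "f z = H z * exp (of_real \<delta> * (z\<^sup>2 - 1))" for z
    have nf: "cmod (f z) = cmod (H z) * exp (\<delta> * ((Re z)\<^sup>2 - (Im z)\<^sup>2 - 1))" for z
      by (simp add: f_def norm_mult Re_power2)
    \<comment> \<open>At height \<open>Y\<close> the damping is at most \<open>exp (- B K)\<close>,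
      and \<open>x exp (- x) \<le> 1\<close> then bounds \<open>f\<close> by \<open>1\<close> there.
      A single rectangle thus serves for each \<open>\<delta>\<close>.\<close>
    define Y where "Y = sqrt (B * K / \<delta>)"
    have Y0: "0 \<le> Y" using B0 \<delta> by (simp add: Y_def K_def)
    have Y2: "\<delta> * Y\<^sup>2 = B * K" using B0 \<delta> by (simp add: Y_def K_def)
    define S where "S = cbox (Complex 0 (- Y)) (Complex 1 Y)"
    have inS: "z \<in> S \<longleftrightarrow> 0 \<le> Re z \<and> Re z \<le> 1 \<and> - Y \<le> Im z \<and> Im z \<le> Y" for z
      by (auto simp: S_def in_cbox_complex_iff)
    have small: "exp (\<delta> * ((Re z)\<^sup>2 - (Im z)\<^sup>2 - 1)) \<le> exp (- (\<delta> * (Im z)\<^sup>2))" if "z \<in> S" for z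
    proof -
      have "(Re z)\<^sup>2 \<le> 1" using that by (simp add: inS abs_square_le_1)
      then have "\<delta> * (Re z)\<^sup>2 \<le> \<delta> * 1" using \<delta> by (intro mult_left_mono) auto
      then show ?thesis by (simp add: algebra_simps)
    qed
    have fr: "cmod (f z) \<le> 1" if "z \<in> frontier S" for z
    proof -
      have zS: "z \<in> S" using that by (simp add: S_def frontier_cbox)
      have "z \<notin> box (Complex 0 (- Y)) (Complex 1 Y)" using that by (simp add: S_def frontier_cbox)
      then have c: "Re z = 0 \<or> Re z = 1 \<or> \<bar>Im z\<bar> = Y"
        using zS by (auto simp: inS in_box_complex_iff)
      have e1: "exp (\<delta> * ((Re z)\<^sup>2 - (Im z)\<^sup>2 - 1)) \<le> 1"
        by (rule order_trans[OF small[OF zS]]) (use \<delta> in simp)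
      show ?thesis
      proof (cases "\<bar>Im z\<bar> = Y")
        case True
        then have "(Im z)\<^sup>2 = Y\<^sup>2" by (metis power2_abs)
        then have "exp (\<delta> * ((Re z)\<^sup>2 - (Im z)\<^sup>2 - 1)) \<le> exp (- (B * K))"
          using small[OF zS] by (simp add: Y2)
        then have "cmod (f z) \<le> (B * K) * exp (- (B * K))"
          unfolding nf using Hb[of z] zS B0 by (intro mult_mono) (auto simp: inS K_def)
        also have "\<dots> \<le> 1"
        proof -
          have "B * K \<le> exp (B * K)" using exp_ge_add_one_self[of "B * K"] by linarith
          then show ?thesis by (simp add: exp_minus field_simps)
        qed
        finally show ?thesis .
      next
        case False
        then have "cmod (H z) \<le> 1" using c H0 H1 by blast
        then show ?thesis unfolding nf using e1 mult_mono[of "cmod (H z)" 1 _ 1] by simp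
      qed
    qed
    have holf: "f holomorphic_on UNIV"
      unfolding f_def H_def by (intro holomorphic_intros hol)
    have "cmod (f \<theta>) \<le> 1"
    proof (rule maximum_modulus_frontier[of f S])
      show "f holomorphic_on interior S" using holf holomorphic_on_subset by blast
      show "continuous_on (closure S) f" using holf holomorphic_on_imp_continuous_on holomorphic_on_subset by blast
      show "bounded S" by (simp add: S_def)
      show "complex_of_real \<theta> \<in> S" using \<theta> Y0 by (simp add: inS)
    qed (use fr in auto)
    then have "cmod (H \<theta>) * exp (\<delta> * (\<theta>\<^sup>2 - 1)) \<le> 1" by (simp add: nf)
    then have "cmod (H \<theta>) \<le> exp (\<delta> * (1 - \<theta>\<^sup>2))"
      by (simp add: right_diff_distrib exp_diff field_simps)
    also have "\<dots> \<le> exp \<delta>" using \<delta> by simp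
    finally show ?thesis .
  qed
  then have "\<forall>\<^sub>F \<delta> in at_right 0. cmod (H \<theta>) \<le> exp \<delta>"
    by (auto simp: eventually_at_right_less eventually_at_right[of 0 1] intro!: exI[of _ 1])
  moreover have "((\<lambda>\<delta>::real. exp \<delta>) \<longlongrightarrow> exp 0) (at_right 0)" by (intro tendsto_intros)
  ultimately have "cmod (H \<theta>) \<le> exp 0"
    by (intro tendsto_lowerbound) auto
  then have "cmod (F \<theta>) * exp ((\<theta> - 1) * ln M0 - \<theta> * ln M1) \<le> 1" by (simp add: normH)
  then have "cmod (F \<theta>) \<le> exp ((1 - \<theta>) * ln M0 + \<theta> * ln M1)"
    by (simp add: exp_diff exp_add field_simps left_diff_distrib)
  also have "\<dots> = M0 powr (1 - \<theta>) * M1 powr \<theta>"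
    using M by (simp add: powr_def exp_add)
  finally show ?thesis .
qed

lemma cmod_integral_le:
  fixes f :: "'a \<Rightarrow> complex"
  assumes "integrable M f" "integrable M g" "\<And>x. x \<in> space M \<Longrightarrow> cmod (f x) \<le> g x"
  shows "cmod (\<integral>x. f x \<partial>M) \<le> (\<integral>x. g x \<partial>M)"
proof -
  have "cmod (\<integral>x. f x \<partial>M) \<le> (\<integral>x. cmod (f x) \<partial>M)" by (rule integral_norm_bound)
  also have "\<dots> \<le> (\<integral>x. g x \<partial>M)" using assms by (intro integral_mono) auto
  finally show ?thesis .
qed

text \<open>The dual function of the usual Riesz--Thorin argument is replaced by a simple function below
  the modulus, so that the analytic family is a finite exponential sum.\<close>

lemma kernel_interpolation_simple:
  fixes T :: "'i \<Rightarrow> 't \<Rightarrow> complex" and p :: real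
  assumes M: "finite_measure M" and fin: "finite I" and [measurable]: "\<And>i. i \<in> I \<Longrightarrow> T i \<in> borel_measurable M"
    and T1: "\<And>i t. i \<in> I \<Longrightarrow> cmod (T i t) \<le> 1"
    and L2: "\<And>h. (\<integral>t. (cmod (\<Sum>i\<in>I. h i * T i t))\<^sup>2 \<partial>M) \<le> (\<Sum>i\<in>I. (cmod (h i))\<^sup>2)"
    and p: "1 < p" "p \<le> 2" and c: "\<And>i. i \<in> I \<Longrightarrow> c i \<noteq> 0"
    and s: "simple_function M s" "\<And>t. 0 \<le> s t" "\<And>t. s t \<le> cmod (\<Sum>i\<in>I. c i * T i t)"
  shows "(\<integral>t. s t powr (p / (p - 1)) \<partial>M) \<le> (\<Sum>i\<in>I. cmod (c i) powr p) powr (1 / (p - 1))"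
proof -
  interpret finite_measure M by (rule M)
  define p' where "p' = p / (p - 1)"
  have p': "p' > 0" "p' \<ge> 1" using p by (auto simp: p'_def field_simps)
  define v where "v t = (\<Sum>i\<in>I. c i * T i t)" for t
  define C where "C = (\<Sum>i\<in>I. cmod (c i) powr p)"
  define V where "V = (\<integral>t. s t powr p' \<partial>M)"
  have vm [measurable]: "v \<in> borel_measurable M" unfolding v_def by measurable
  have sm [measurable]: "s \<in> borel_measurable M" using s(1) by (rule borel_measurable_simple_function)
  define R where "R = s ` space M - {0}"
  have finR: "finite R" using simple_functionD(1)[OF s(1)] by (simp add: R_def)
  have Rpos: "r > 0" if "r \<in> R" for r using that s(2) by (auto simp: R_def less_le)
  define E where "E r = {t \<in> space M. s t = r}" for r
  have Em [measurable]: "E r \<in> sets M" for r unfolding E_def by measurable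
  define sg where "sg t = cnj (sgn (v t))" for t
  have sgm [measurable]: "sg \<in> borel_measurable M"
  proof -
    have "sg = (\<lambda>t. cnj (v t / of_real (cmod (v t))))"
      by (auto simp: sg_def sgn_eq)
    moreover have [measurable]: "cnj \<in> borel_measurable borel"
      by (intro borel_measurable_continuous_onI continuous_intros)
    ultimately show ?thesis by simp
  qed
  have sg1: "cmod (sg t) \<le> 1" for t by (simp add: sg_def norm_sgn)
  have vsg: "v t * sg t = of_real (cmod (v t))" for t
    by (cases "v t = 0") (simp_all add: sg_def sgn_eq complex_norm_square[symmetric] power2_eq_square field_simps)
  define bnd where "bnd = (\<Sum>i\<in>I. cmod (c i))"
  define Rm where "Rm = Max (insert 1 (s ` space M))"
  have sR: "s t \<le> Rm" if "t \<in> space M" for t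
    unfolding Rm_def using that simple_functionD(1)[OF s(1)] by (intro Max_ge) auto
  \<comment> \<open>The modulus of \<open>G z\<close> is at most
    \<open>s^(p' (1 - Re z / 2))\<close>, and \<open>h z\<close> below is built likewise from
    \<open>p\<close> and \<open>|c i|\<close>. At \<open>Re z = 0\<close> this pairs
    \<open>l^1\<close> coefficients with an \<open>L^1\<close> function, at \<open>Re z = 1\<close>
    \<open>l^2\<close> with \<open>L^2\<close>.\<close>
  define G where "G z t = sg t * (\<Sum>r\<in>R. indicator (E r) t * exp (of_real (p' * ln r) * (1 - z / 2)))" for z t
  have Gm [measurable]: "G z \<in> borel_measurable M" for z unfolding G_def by measurable
  have Gval: "G z t = (if s t = 0 then 0 else sg t * exp (of_real (p' * ln (s t)) * (1 - z / 2)))" if "t \<in> space M" for z t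
  proof (cases "s t = 0")
    case True
    then have "(\<Sum>r\<in>R. indicator (E r) t * exp (of_real (p' * ln r) * (1 - z / 2))) = 0"
      by (intro sum.neutral) (auto simp: E_def R_def)
    then show ?thesis using True by (simp add: G_def)
  next
    case False
    then have sR: "s t \<in> R" using that by (auto simp: R_def)
    have "(\<Sum>r\<in>R. indicator (E r) t * exp (of_real (p' * ln r) * (1 - z / 2))) =
        (\<Sum>r\<in>R. if r = s t then exp (of_real (p' * ln (s t)) * (1 - z / 2)) else (0::complex))"
      using that by (intro sum.cong refl) (auto simp: E_def)
    then show ?thesis using False sR finR by (simp add: G_def)
  qed
  have Gnorm: "cmod (G z t) \<le> s t powr (p' * (1 - Re z / 2))" if "t \<in> space M" for z t
  proof (cases "s t = 0")
    case False
    then have "cmod (G z t) \<le> 1 * exp (p' * ln (s t) * (1 - Re z / 2))"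
      unfolding Gval[OF that] using sg1[of t] by (simp add: norm_mult mult_right_mono)
    then show ?thesis using False s(2)[of t] by (simp add: powr_def mult_ac)
  qed (simp add: Gval[OF that])
  define h where "h z i = sgn (c i) * exp (of_real (p * ln (cmod (c i))) * (1 - z / 2))" for z i
  have hnorm: "cmod (h z i) = cmod (c i) powr (p * (1 - Re z / 2))" if "i \<in> I" for z i
    using c[OF that] by (simp add: h_def norm_mult norm_sgn powr_def mult_ac)
  define F where "F z = (\<Sum>i\<in>I. h z i * (\<Sum>r\<in>R. (\<integral>t. T i t * sg t * indicator (E r) t \<partial>M) * exp (of_real (p' * ln r) * (1 - z / 2))))" for z
  have Tsg: "integrable M (\<lambda>t. T i t * sg t * indicator (E r) t)" if "i \<in> I" for i r
  proof (rule integrable_const_bound[where B = 1])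
    show "AE t in M. norm (T i t * sg t * indicator (E r) t) \<le> 1"
      using T1[OF that] sg1 by (intro AE_I2) (auto simp: norm_mult indicator_def intro!: mult_le_one)
  qed (use that in measurable)
  have TG: "integrable M (\<lambda>t. T i t * G z t)" "(\<integral>t. T i t * G z t \<partial>M) = (\<Sum>r\<in>R. (\<integral>t. T i t * sg t * indicator (E r) t \<partial>M) * exp (of_real (p' * ln r) * (1 - z / 2)))"
    if "i \<in> I" for i z
  proof -
    have eq: "(\<lambda>t. T i t * G z t) = (\<lambda>t. \<Sum>r\<in>R. (T i t * sg t * indicator (E r) t) * exp (of_real (p' * ln r) * (1 - z / 2)))"
      by (simp add: G_def sum_distrib_left mult_ac)
    show "integrable M (\<lambda>t. T i t * G z t)" "(\<integral>t. T i t * G z t \<partial>M) = (\<Sum>r\<in>R. (\<integral>t. T i t * sg t * indicator (E r) t \<partial>M) * exp (of_real (p' * ln r) * (1 - z / 2)))"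
      unfolding eq using Tsg[OF that] by simp_all
  qed
  have FI: "F z = (\<integral>t. (\<Sum>i\<in>I. h z i * T i t) * G z t \<partial>M)" for z
  proof -
    have "F z = (\<Sum>i\<in>I. h z i * (\<integral>t. T i t * G z t \<partial>M))" unfolding F_def using TG(2) by simp
    also have "\<dots> = (\<integral>t. (\<Sum>i\<in>I. h z i * (T i t * G z t)) \<partial>M)" using TG(1) by simp
    finally show ?thesis by (simp add: sum_distrib_right mult.assoc)
  qed
  have hol: "F holomorphic_on UNIV" unfolding F_def h_def by (intro holomorphic_intros) auto
  have spint: "integrable M (\<lambda>t. s t powr q)" for q
  proof (rule integrable_const_bound[where B = "Max ((\<lambda>r. r powr q) ` (s ` space M) \<union> {0})"])
    show "AE t in M. norm (s t powr q) \<le> Max ((\<lambda>r. r powr q) ` (s ` space M) \<union> {0})"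
      using simple_functionD(1)[OF s(1)] by (intro AE_I2) (auto intro!: Max_ge)
  qed measurable
  have Fbd: "\<exists>B. \<forall>z. 0 \<le> Re z \<longrightarrow> Re z \<le> 1 \<longrightarrow> cmod (F z) \<le> B"
  proof -
    define B where "B = (\<Sum>i\<in>I. exp \<bar>p * ln (cmod (c i))\<bar> * (\<Sum>r\<in>R. cmod (\<integral>t. T i t * sg t * indicator (E r) t \<partial>M) * exp \<bar>p' * ln r\<bar>))"
    have e: "cmod (exp (of_real x * (1 - z / 2))) \<le> exp \<bar>x\<bar>" if "0 \<le> Re z" "Re z \<le> 1" for x z
    proof -
      have "x * (1 - Re z / 2) \<le> \<bar>x\<bar> * \<bar>1 - Re z / 2\<bar>" by (metis abs_ge_self abs_mult)
      also have "\<dots> \<le> \<bar>x\<bar> * 1" using that by (intro mult_left_mono) auto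
      finally show ?thesis by simp
    qed
    have "cmod (F z) \<le> B" if "0 \<le> Re z" "Re z \<le> 1" for z
      unfolding F_def B_def
    proof (intro order_trans[OF norm_sum] sum_mono)
      fix i assume "i \<in> I"
      have "cmod (h z i) \<le> exp \<bar>p * ln (cmod (c i))\<bar>"
        using e[OF that, of "p * ln (cmod (c i))"] c[OF \<open>i \<in> I\<close>] by (simp add: h_def norm_mult norm_sgn)
      moreover have "cmod (\<Sum>r\<in>R. (\<integral>t. T i t * sg t * indicator (E r) t \<partial>M) * exp (of_real (p' * ln r) * (1 - z / 2)))
          \<le> (\<Sum>r\<in>R. cmod (\<integral>t. T i t * sg t * indicator (E r) t \<partial>M) * exp \<bar>p' * ln r\<bar>)"
        by (intro order_trans[OF norm_sum] sum_mono) (simp add: norm_mult mult_left_mono e[OF that, of "p' * ln _", unfolded of_real_mult] del: norm_exp_eq_Re)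
      ultimately show "cmod (h z i * (\<Sum>r\<in>R. (\<integral>t. T i t * sg t * indicator (E r) t \<partial>M) * exp (of_real (p' * ln r) * (1 - z / 2))))
          \<le> exp \<bar>p * ln (cmod (c i))\<bar> * (\<Sum>r\<in>R. cmod (\<integral>t. T i t * sg t * indicator (E r) t \<partial>M) * exp \<bar>p' * ln r\<bar>)"
        unfolding norm_mult by (intro mult_mono) (auto intro: sum_nonneg)
    qed
    then show ?thesis by blast
  qed
  have C0: "0 \<le> C" by (simp add: C_def sum_nonneg)
  have V0: "0 \<le> V" by (simp add: V_def)
  show ?thesis
  proof (cases "V = 0 \<or> C = 0")
    case True
    then show ?thesis
    proof
      assume "V = 0" then show ?thesis by (simp add: V_def p'_def)
    next
      assume "C = 0"
      then have "I = {}" using c fin by (auto simp: C_def sum_nonneg_eq_0_iff)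
      then have "s t = 0" for t using s(2)[of t] s(3)[of t] by simp
      then show ?thesis by simp
    qed
  next
    case False
    then have CV: "C > 0" "V > 0" using C0 V0 by auto
    \<comment> \<open>Chosen so that \<open>1 - \<theta> / 2 = 1 / p\<close>: then
      \<open>h \<theta>\<close> is \<open>c\<close> itself and \<open>G \<theta>\<close> has modulus
      \<open>s^(p' - 1)\<close>.\<close>
    define \<theta> where "\<theta> = 2 - 2 / p"
    have \<theta>: "0 \<le> \<theta>" "\<theta> \<le> 1" "1 - \<theta> / 2 = 1 / p" using p by (auto simp: \<theta>_def field_simps)
    obtain B where B: "\<And>z. 0 \<le> Re z \<Longrightarrow> Re z \<le> 1 \<Longrightarrow> cmod (F z) \<le> B" using Fbd by blast
    have ThG: "integrable M (\<lambda>t. (\<Sum>i\<in>I. h z i * T i t) * G z t)" for z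
    proof -
      have "integrable M (\<lambda>t. (\<Sum>i\<in>I. h z i * (T i t * G z t)))" using TG(1) by simp
      then show ?thesis by (simp add: sum_distrib_right mult.assoc)
    qed
    \<comment> \<open>The edge of the bound from \<open>l^1\<close> to the supremum norm, which uses
      only \<open>|T| \<le> 1\<close>.\<close>
    have F0: "cmod (F z) \<le> C * V" if z: "Re z = 0" for z
    proof -
      have "cmod (F z) \<le> (\<integral>t. C * s t powr p' \<partial>M)"
        unfolding FI
      proof (rule cmod_integral_le[OF ThG])
        show "integrable M (\<lambda>t. C * s t powr p')" using spint by simp
        fix t assume t: "t \<in> space M"
        have "cmod (\<Sum>i\<in>I. h z i * T i t) \<le> C"
          unfolding C_def
        proof (intro order_trans[OF norm_sum] sum_mono)
          fix i assume i: "i \<in> I"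
          then show "cmod (h z i * T i t) \<le> cmod (c i) powr p"
            using hnorm[OF i, of z] T1[OF i, of t] z mult_left_mono[of "cmod (T i t)" 1 "cmod (c i) powr p"] by (simp add: norm_mult)
        qed
        moreover have "cmod (G z t) \<le> s t powr p'" using Gnorm[OF t, of z] z by simp
        ultimately show "cmod ((\<Sum>i\<in>I. h z i * T i t) * G z t) \<le> C * s t powr p'"
          unfolding norm_mult using C0 by (intro mult_mono) auto
      qed
      then show ?thesis by (simp add: V_def)
    qed
    have F1: "cmod (F z) \<le> sqrt (C * V)" if z: "Re z = 1" for z
    proof -
      \<comment> \<open>Cauchy-Schwarz in the form \<open>w g \<le> l w^2 / 2 + g^2 / (2 l)\<close>.
        The weight \<open>l = sqrt (V / C)\<close> balances the two terms after the
        \<open>L^2\<close> contraction has bounded the integral of \<open>w^2\<close> by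
        \<open>C\<close>.\<close>
      define l where "l = sqrt (V / C)"
      have l: "l > 0" using CV by (simp add: l_def)
      define w where "w t = cmod (\<Sum>i\<in>I. h z i * T i t)" for t
      have hb: "w t \<le> (\<Sum>i\<in>I. cmod (h z i))" for t
        unfolding w_def using T1 by (intro order_trans[OF norm_sum] sum_mono) (simp add: norm_mult mult_left_le)
      have wi: "integrable M (\<lambda>t. (w t)\<^sup>2)"
      proof (rule integrable_const_bound[where B = "(\<Sum>i\<in>I. cmod (h z i))\<^sup>2"])
        show "AE t in M. norm ((w t)\<^sup>2) \<le> (\<Sum>i\<in>I. cmod (h z i))\<^sup>2"
          using hb by (intro AE_I2) (auto simp: w_def intro!: power_mono)
        show "(\<lambda>t. (w t)\<^sup>2) \<in> borel_measurable M" unfolding w_def by measurable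
      qed
      have "(\<integral>t. (w t)\<^sup>2 \<partial>M) \<le> (\<Sum>i\<in>I. (cmod (h z i))\<^sup>2)" unfolding w_def by (rule L2)
      also have "\<dots> = C"
        unfolding C_def
      proof (intro sum.cong refl)
        fix i assume i: "i \<in> I"
        show "(cmod (h z i))\<^sup>2 = cmod (c i) powr p"
          unfolding hnorm[OF i] z by (simp add: powr_half_sqrt_powr powr_powr power2_eq_square powr_add[symmetric])
      qed
      finally have wC: "(\<integral>t. (w t)\<^sup>2 \<partial>M) \<le> C" .
      have "cmod (F z) \<le> (\<integral>t. (l / 2) * (w t)\<^sup>2 + (1 / (2 * l)) * s t powr p' \<partial>M)"
        unfolding FI
      proof (rule cmod_integral_le[OF ThG])
        show "integrable M (\<lambda>t. (l / 2) * (w t)\<^sup>2 + (1 / (2 * l)) * s t powr p')" using spint wi by simp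
        fix t assume t: "t \<in> space M"
        define g where "g = s t powr (p' / 2)"
        have "cmod (G z t) \<le> g" using Gnorm[OF t, of z] z by (simp add: g_def)
        then have "norm ((\<Sum>i\<in>I. h z i * T i t) * G z t) \<le> w t * g"
          unfolding norm_mult w_def[symmetric] by (intro mult_left_mono) (auto simp: w_def)
        also have "\<dots> \<le> (l / 2) * (w t)\<^sup>2 + (1 / (2 * l)) * g\<^sup>2"
        proof -
          have "0 \<le> (l * w t - g)\<^sup>2" by simp
          then have "2 * (l * (w t * g)) \<le> l * (l * (w t)\<^sup>2) + g\<^sup>2"
            by (simp add: power2_eq_square algebra_simps)
          then show ?thesis using l by (simp add: field_simps power2_eq_square)
        qed
        also have "g\<^sup>2 = s t powr p'" by (simp add: g_def power2_eq_square powr_add[symmetric])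
        finally show "cmod ((\<Sum>i\<in>I. h z i * T i t) * G z t) \<le> (l / 2) * (w t)\<^sup>2 + (1 / (2 * l)) * s t powr p'" .
      qed
      also have "\<dots> = (l / 2) * (\<integral>t. (w t)\<^sup>2 \<partial>M) + (1 / (2 * l)) * V"
        unfolding V_def using spint wi by simp
      also have "\<dots> \<le> (l / 2) * C + (1 / (2 * l)) * V" using wC l by simp
      also have "\<dots> = sqrt (C * V)"
      proof -
        have lC: "l * sqrt C = sqrt V" using CV by (simp add: l_def real_sqrt_divide)
        have "l * C = sqrt (C * V)"
          using lC CV by (metis real_sqrt_mult real_sqrt_mult_self abs_of_pos mult.assoc mult.commute)
        moreover have "V / l = sqrt (C * V)"
        proof -
          have "V = sqrt V * (l * sqrt C)" unfolding lC using CV by simp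
          then have "V / l = sqrt V * sqrt C" using l by (simp add: field_simps)
          then show ?thesis by (simp add: real_sqrt_mult)
        qed
        ultimately show ?thesis by (simp add: field_simps)
      qed
      finally show ?thesis .
    qed
    have "cmod (F \<theta>) \<le> (C * V) powr (1 - \<theta>) * sqrt (C * V) powr \<theta>"
      by (rule three_lines[OF hol B F0 F1]) (use CV \<theta> in auto)
    also have "\<dots> = (C * V) powr (1 / p)"
      using CV \<theta>(3) by (simp add: powr_half_sqrt[symmetric] powr_powr powr_add[symmetric])
    finally have up: "cmod (F \<theta>) \<le> (C * V) powr (1 / p)" .
    have hc: "h \<theta> i = c i" if "i \<in> I" for i
    proof -
      have "complex_of_real (p * ln (cmod (c i))) * (1 - complex_of_real \<theta> / 2) = of_real (p * ln (cmod (c i)) * (1 - \<theta> / 2))" by simp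
      also have "\<dots> = of_real (ln (cmod (c i)))" unfolding \<theta>(3) using p by simp
      finally show ?thesis using c[OF that] by (simp add: h_def exp_of_real sgn_eq del: of_real_mult)
    qed
    have p'p: "p' * (1 - \<theta> / 2) = p' - 1" unfolding \<theta>(3) using p by (simp add: p'_def field_simps)
    \<comment> \<open>Since \<open>v sg = |v|\<close> and \<open>s \<le> |v|\<close>, the pairing at
      \<open>\<theta>\<close> dominates the integral of \<open>s s^(p' - 1)\<close>, which is
      \<open>V\<close>. With the upper bound this reads \<open>V \<le> (C V)^(1/p)\<close> and is
      solved for \<open>V\<close>.\<close>
    have "V \<le> cmod (F \<theta>)"
    proof -
      have vG: "(\<Sum>i\<in>I. h \<theta> i * T i t) * G \<theta> t = of_real (cmod (v t) * s t powr (p' - 1))" if t: "t \<in> space M" for t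
      proof -
        have "(\<Sum>i\<in>I. h \<theta> i * T i t) = v t" unfolding v_def using hc by simp
        moreover have "G \<theta> t = sg t * of_real (s t powr (p' - 1))"
        proof (cases "s t = 0")
          case False
          have "complex_of_real (p' * ln (s t)) * (1 - complex_of_real \<theta> / 2) = of_real (ln (s t) * (p' * (1 - \<theta> / 2)))" by simp
          then show ?thesis using False s(2)[of t] unfolding Gval[OF t] p'p
            by (simp add: powr_def exp_of_real mult.commute del: of_real_mult)
        qed (simp add: Gval[OF t])
        ultimately show ?thesis using vsg[of t] by (simp add: mult.assoc[symmetric])
      qed
      have "F \<theta> = (\<integral>t. of_real (cmod (v t) * s t powr (p' - 1)) \<partial>M)"
        unfolding FI by (rule Bochner_Integration.integral_cong) (use vG in auto)
      also have "\<dots> = complex_of_real (\<integral>t. cmod (v t) * s t powr (p' - 1) \<partial>M)" by (rule integral_complex_of_real)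
      finally have Feq: "F \<theta> = complex_of_real (\<integral>t. cmod (v t) * s t powr (p' - 1) \<partial>M)" .
      have "V \<le> (\<integral>t. cmod (v t) * s t powr (p' - 1) \<partial>M)"
        unfolding V_def
      proof (rule integral_mono_AE)
        have "integrable M (\<lambda>t. complex_of_real (cmod (v t) * s t powr (p' - 1)))"
        proof -
          have "integrable M (\<lambda>t. complex_of_real (cmod (v t) * s t powr (p' - 1)))
             \<longleftrightarrow> integrable M (\<lambda>t. (\<Sum>i\<in>I. h \<theta> i * T i t) * G \<theta> t)"
            by (intro Bochner_Integration.integrable_cong refl) (simp only: vG)
          then show ?thesis using ThG[of \<theta>] by blast
        qed
        from integrable_Re[OF this] show "integrable M (\<lambda>t. cmod (v t) * s t powr (p' - 1))" by (simp only: Re_complex_of_real)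
        show "AE t in M. s t powr p' \<le> cmod (v t) * s t powr (p' - 1)"
        proof (rule AE_I2)
          fix t
          have "s t powr p' = s t * s t powr (p' - 1)"
            using s(2)[of t] powr_add[of "s t" 1 "p' - 1"] by (cases "s t = 0") auto
          then show "s t powr p' \<le> cmod (v t) * s t powr (p' - 1)"
            using s(3)[of t] by (simp add: v_def mult_right_mono)
        qed
      qed (rule spint)
      then show ?thesis unfolding Feq by simp
    qed
    with up have "V \<le> (C * V) powr (1 / p)" by simp
    then have "V powr p \<le> ((C * V) powr (1 / p)) powr p" using CV p by (intro powr_mono2) auto
    also have "\<dots> = C * V" using CV p by (simp add: powr_powr)
    finally have "V powr (p - 1) \<le> C" using CV by (simp add: powr_diff field_simps)
    then have "(V powr (p - 1)) powr (1 / (p - 1)) \<le> C powr (1 / (p - 1))" using p by (intro powr_mono2) auto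
    then show ?thesis using CV p by (simp add: powr_powr V_def C_def p'_def)
  qed
qed

text \<open>Vanishing coefficients are dropped, as the analytic family involves
  \<open>ln |c i|\<close>, and the modulus is approached from below by simple functions, with
  Fatou's lemma in the limit.\<close>

lemma kernel_interpolation:
  fixes T :: "'i \<Rightarrow> 't \<Rightarrow> complex" and p :: real
  assumes M: "finite_measure M" and fin: "finite I" and meas: "\<And>i. i \<in> I \<Longrightarrow> T i \<in> borel_measurable M"
    and T1: "\<And>i t. i \<in> I \<Longrightarrow> cmod (T i t) \<le> 1"
    and L2: "\<And>h. (\<integral>t. (cmod (\<Sum>i\<in>I. h i * T i t))\<^sup>2 \<partial>M) \<le> (\<Sum>i\<in>I. (cmod (h i))\<^sup>2)"
    and p: "1 < p" "p \<le> 2"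
  shows "(\<integral>\<^sup>+t. ennreal (cmod (\<Sum>i\<in>I. c i * T i t) powr (p / (p - 1))) \<partial>M)
     \<le> ennreal ((\<Sum>i\<in>I. cmod (c i) powr p) powr (1 / (p - 1)))"
proof -
  define J where "J = {i \<in> I. c i \<noteq> 0}"
  have J: "finite J" "J \<subseteq> I" using fin by (auto simp: J_def)
  define v where "v t = cmod (\<Sum>i\<in>I. c i * T i t)" for t
  have vJ: "v t = cmod (\<Sum>i\<in>J. c i * T i t)" for t
    unfolding v_def using fin by (intro arg_cong[where f = cmod] sum.mono_neutral_right) (auto simp: J_def)
  have CJ: "(\<Sum>i\<in>J. cmod (c i) powr p) = (\<Sum>i\<in>I. cmod (c i) powr p)"
    using fin by (intro sum.mono_neutral_left) (auto simp: J_def)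
  have vm: "v \<in> borel_measurable M" unfolding v_def using meas by measurable
  define q where "q = p / (p - 1)"
  have q: "q > 0" using p by (simp add: q_def)
  have L2J: "(\<integral>t. (cmod (\<Sum>i\<in>J. h i * T i t))\<^sup>2 \<partial>M) \<le> (\<Sum>i\<in>J. (cmod (h i))\<^sup>2)" for h
  proof -
    define h' where "h' i = (if i \<in> J then h i else 0)" for i
    have "(\<Sum>i\<in>J. h i * T i t) = (\<Sum>i\<in>I. h' i * T i t)" for t
      using fin J by (intro sum.mono_neutral_cong_left) (auto simp: h'_def)
    moreover have "(\<Sum>i\<in>J. (cmod (h i))\<^sup>2) = (\<Sum>i\<in>I. (cmod (h' i))\<^sup>2)"
      using fin J by (intro sum.mono_neutral_cong_left) (auto simp: h'_def)
    ultimately show ?thesis using L2[of h'] by simp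
  qed
  obtain s where s: "\<And>i. simple_function M (s i)" "incseq s" "\<And>x. bdd_above (range (\<lambda>i. s i x))" "\<And>i x. 0 \<le> s i x" "v = (SUP i. s i)"
    using borel_measurable_implies_simple_function_sequence_real[OF vm] by (metis norm_ge_zero v_def)
  have sv: "s i t \<le> v t" for i t
    unfolding s(5) SUP_apply using s(3) by (intro cSUP_upper) auto
  have lim: "(\<lambda>i. s i t) \<longlonglongrightarrow> v t" for t
    unfolding s(5) SUP_apply using s(2,3) by (intro LIMSEQ_incseq_SUP) (auto simp: incseq_def le_fun_def)
  have bnd: "(\<integral>\<^sup>+t. ennreal (s i t powr q) \<partial>M) \<le> ennreal ((\<Sum>i\<in>I. cmod (c i) powr p) powr (1 / (p - 1)))" for i
  proof -
    interpret finite_measure M by (rule M)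
    have "integrable M (\<lambda>t. s i t powr q)"
    proof (rule integrable_const_bound[where B = "Max ((\<lambda>r. r powr q) ` (s i ` space M) \<union> {0})"])
      show "AE t in M. norm (s i t powr q) \<le> Max ((\<lambda>r. r powr q) ` (s i ` space M) \<union> {0})"
        using simple_functionD(1)[OF s(1)] by (intro AE_I2) (auto intro!: Max_ge)
      show "(\<lambda>t. s i t powr q) \<in> borel_measurable M" using borel_measurable_simple_function[OF s(1)] by measurable
    qed
    then have "(\<integral>\<^sup>+t. ennreal (s i t powr q) \<partial>M) = ennreal (\<integral>t. s i t powr q \<partial>M)"
      by (intro nn_integral_eq_integral) auto
    also have "(\<integral>t. s i t powr q \<partial>M) \<le> (\<Sum>i\<in>J. cmod (c i) powr p) powr (1 / (p - 1))"
    proof -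
      have "c i \<noteq> 0" if "i \<in> J" for i using that by (simp add: J_def)
      then show ?thesis
        unfolding q_def using J s(4) sv meas T1 L2J
        by (intro kernel_interpolation_simple[where T = T] M s(1) p) (auto simp: vJ[symmetric])
    qed
    finally show ?thesis by (simp add: CJ ennreal_leI)
  qed
  have "(\<integral>\<^sup>+t. ennreal (v t powr q) \<partial>M) = (\<integral>\<^sup>+t. liminf (\<lambda>i. ennreal (s i t powr q)) \<partial>M)"
  proof (rule nn_integral_cong)
    fix t
    have "(\<lambda>i. ennreal (s i t powr q)) \<longlonglongrightarrow> ennreal (v t powr q)"
      using lim[of t] q s(4) by (intro tendsto_ennrealI tendsto_powr') (auto simp: v_def)
    then show "ennreal (v t powr q) = liminf (\<lambda>i. ennreal (s i t powr q))"
      by (metis lim_imp_Liminf sequentially_bot)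
  qed
  also have "\<dots> \<le> liminf (\<lambda>i. \<integral>\<^sup>+t. ennreal (s i t powr q) \<partial>M)"
    using borel_measurable_simple_function[OF s(1)] by (intro nn_integral_liminf) measurable
  also have "\<dots> \<le> ennreal ((\<Sum>i\<in>I. cmod (c i) powr p) powr (1 / (p - 1)))"
    by (intro Liminf_le) (auto simp: bnd)
  finally show ?thesis by (simp add: v_def q_def)
qed

section \<open>Discretisation of the Dirac system\<close>

lemma truncation_L1:
  fixes \<phi> :: "real \<Rightarrow> real"
  assumes \<phi>: "integrable lebesgue \<phi>" "\<And>x. 0 \<le> \<phi> x" and \<delta>: "\<delta> > 0"
  shows "\<exists>n\<ge>1. (\<integral>x. \<phi> x - min (\<phi> x) (real n) * indicator {-real n..real n} x \<partial>lebesgue) \<le> \<delta>"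
proof -
  define g where "g n x = \<phi> x - min (\<phi> x) (real n) * indicator {-real n..real n} x" for n :: nat and x
  have [measurable]: "\<phi> \<in> borel_measurable lebesgue" using \<phi>(1) by (rule borel_measurable_integrable)
  have [measurable]: "{-real n..real n} \<in> sets lebesgue" for n by simp
  have "(\<lambda>n. \<integral>x. g n x \<partial>lebesgue) \<longlonglongrightarrow> (\<integral>x. 0 \<partial>(lebesgue :: real measure))"
  proof (rule integral_dominated_convergence[where w = \<phi>])
    show "g n \<in> borel_measurable lebesgue" for n unfolding g_def by measurable
    show "AE x in lebesgue. (\<lambda>n. g n x) \<longlonglongrightarrow> 0"
    proof (rule AE_I2, rule tendsto_eventually)
      fix x
      obtain N :: nat where N: "real N \<ge> max (\<phi> x) \<bar>x\<bar>" using real_arch_simple by blast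
      show "\<forall>\<^sub>F n in sequentially. g n x = 0"
        using eventually_ge_at_top[of N]
      proof eventually_elim
        case (elim n)
        then have "real n \<ge> max (\<phi> x) \<bar>x\<bar>" using N by linarith
        then show ?case by (auto simp: g_def indicator_def)
      qed
    qed
    show "AE x in lebesgue. norm (g n x) \<le> \<phi> x" for n
      using \<phi>(2) by (intro AE_I2) (auto simp: g_def indicator_def min_def)
  qed (use \<phi> in auto)
  then have "(\<lambda>n. \<integral>x. g n x \<partial>lebesgue) \<longlonglongrightarrow> 0" by simp
  then have "\<forall>\<^sub>F n in sequentially. (\<integral>x. g n x \<partial>lebesgue) < \<delta>" using \<delta> by (rule order_tendstoD)
  then have "\<forall>\<^sub>F n in sequentially. 1 \<le> n \<and> (\<integral>x. g n x \<partial>lebesgue) < \<delta>"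
    using eventually_ge_at_top[of 1] by eventually_elim auto
  then obtain n where "1 \<le> n" "(\<integral>x. g n x \<partial>lebesgue) < \<delta>"
    by (auto simp: eventually_sequentially)
  then show ?thesis unfolding g_def using less_imp_le by blast
qed

text \<open>The weight \<open>w\<close> absorbs the bounded, compactly supported part of \<open>\<phi>\<close>; the remaining part
  of \<open>\<phi>\<close> has integral at most \<open>1/4\<close>. This avoids the chain rule for absolutely continuous functions.\<close>

lemma gronwall_L1:
  fixes \<phi> :: "real \<Rightarrow> real"
  assumes \<phi>: "integrable lebesgue \<phi>" "\<And>x. 0 \<le> \<phi> x"
  shows "\<exists>C\<ge>0. \<forall>d e. 0 \<le> e \<and> (\<forall>x. 0 \<le> d x) \<and> bdd_above (range d) \<and>
     (\<forall>x. set_integrable lebesgue {..x} (\<lambda>y. \<phi> y * d y)) \<and>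
     (\<forall>x. d x \<le> e + (LINT y:{..x}|lebesgue. \<phi> y * d y)) \<longrightarrow> (\<forall>x. d x \<le> C * e)"
proof -
  have "\<exists>n\<ge>1. (\<integral>x. \<phi> x - min (\<phi> x) (real n) * indicator {-real n..real n} x \<partial>lebesgue) \<le> 1 / 4"
    by (rule truncation_L1[OF \<phi>(1)], rule \<phi>(2)) simp
  then obtain n :: nat where n: "n \<ge> 1"
    and small: "(\<integral>x. \<phi> x - min (\<phi> x) (real n) * indicator {-real n..real n} x \<partial>lebesgue) \<le> 1 / 4"
    by blast
  define \<phi>1 where "\<phi>1 x = min (\<phi> x) (real n) * indicator {-real n..real n} x" for x
  define \<phi>2 where "\<phi>2 x = \<phi> x - \<phi>1 x" for x
  define cl where "cl x = max (- real n) (min (real n) x)" for x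
  \<comment> \<open>The logarithmic derivative \<open>4 n\<close> on the window is four times the
    bound \<open>n\<close> on \<open>\<phi>1\<close>, so the integral of \<open>\<phi>1 w\<close> up
    to \<open>x\<close> is at most \<open>w x / 4\<close>. The remainder \<open>\<phi>2\<close> adds
    another quarter, as \<open>w\<close> is nondecreasing.\<close>
  define w where "w x = exp (4 * real n * (cl x + real n))" for x
  have [measurable]: "\<phi> \<in> borel_measurable lebesgue" using \<phi>(1) by (rule borel_measurable_integrable)
  have clm: "cl \<in> borel_measurable borel" unfolding cl_def by measurable
  note clm [measurable]
  have "w \<in> borel_measurable lborel" unfolding w_def by measurable
  then have [measurable]: "w \<in> borel_measurable lebesgue" by (rule measurable_completion)
  have [measurable]: "{-real n..real n} \<in> sets lebesgue" "{..x} \<in> sets lebesgue" for x :: real by simp_all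
  have pos: "0 \<le> \<phi>1 x" "0 \<le> \<phi>2 x" "\<phi>1 x \<le> \<phi> x" "\<phi>2 x \<le> \<phi> x" for x
    using \<phi>(2)[of x] by (auto simp: \<phi>1_def \<phi>2_def indicator_def min_def)
  have m1 [measurable]: "\<phi>1 \<in> borel_measurable lebesgue" unfolding \<phi>1_def by measurable
  have m2 [measurable]: "\<phi>2 \<in> borel_measurable lebesgue" unfolding \<phi>2_def by measurable
  have i2: "integrable lebesgue \<phi>2"
    by (rule Bochner_Integration.integrable_bound[OF \<phi>(1)]) (use pos \<phi>(2) in auto)
  have clb: "- real n \<le> cl x" "cl x \<le> real n" for x by (auto simp: cl_def)
  have w1: "1 \<le> w x" for x using clb[of x] by (simp add: w_def)
  have wmono: "w x \<le> w y" if "x \<le> y" for x y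
  proof -
    have "cl x \<le> cl y" using that by (auto simp: cl_def)
    then show ?thesis using n by (simp add: w_def)
  qed
  define W where "W = exp (4 * real n * (2 * real n))"
  have wW: "w x \<le> W" for x using clb[of x] n by (simp add: w_def W_def)
  have iw: "integrable lebesgue (\<lambda>y. indicator {..x} y * (g y * w y))"
    if "integrable lebesgue g" for g :: "real \<Rightarrow> real" and x
  proof (rule Bochner_Integration.integrable_bound[of _ "\<lambda>y. W * g y"])
    have [measurable]: "g \<in> borel_measurable lebesgue" using that by (rule borel_measurable_integrable)
    show "(\<lambda>y. indicator {..x} y * (g y * w y)) \<in> borel_measurable lebesgue" by measurable
    show "AE y in lebesgue. norm (indicator {..x} y * (g y * w y)) \<le> norm (W * g y)"
    proof (rule AE_I2)
      fix y
      have "\<bar>g y\<bar> * w y \<le> \<bar>g y\<bar> * W" by (intro mult_left_mono wW) auto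
      moreover have "0 < w y" "0 < W" by (auto simp: w_def W_def)
      ultimately show "norm (indicator {..x} y * (g y * w y)) \<le> norm (W * g y)"
        by (auto simp: indicator_def abs_mult mult.commute[of W])
    qed
  qed (use that in simp)
  have A1: "(\<integral>y. indicator {..x} y * (\<phi>1 y * w y) \<partial>lebesgue) \<le> w x / 4" for x
  proof -
    define c where "c = cl x"
    define h where "h y = exp (4 * real n * (y + real n)) / 4" for y
    define h' where "h' y = real n * exp (4 * real n * (y + real n))" for y
    have FTC: "has_bochner_integral lborel (\<lambda>y. h' y * indicator {- real n..c} y) (h c - h (- real n))"
    proof (rule has_bochner_integral_FTC_Icc_real)
      show "- real n \<le> c" by (simp add: c_def clb)
      show "(h has_real_derivative h' y) (at y)" for y
        unfolding h_def h'_def by (auto intro!: derivative_eq_intros)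
      show "isCont h' y" for y unfolding h'_def by (intro continuous_intros)
    qed
    have hm: "(\<lambda>y. h' y * indicator {- real n..c} y) \<in> borel_measurable lborel"
      using FTC by (rule borel_measurable_has_bochner_integral)
    have "(\<integral>y. indicator {..x} y * (\<phi>1 y * w y) \<partial>lebesgue) \<le> (\<integral>y. h' y * indicator {- real n..c} y \<partial>lebesgue)"
    proof (rule integral_mono_AE')
      show "integrable lebesgue (\<lambda>y. h' y * indicator {- real n..c} y)"
        using FTC integrable_completion[OF hm] by (auto simp: has_bochner_integral_iff)
      show "AE y in lebesgue. indicator {..x} y * (\<phi>1 y * w y) \<le> h' y * indicator {- real n..c} y"
      proof (rule AE_I2)
        fix y
        show "indicator {..x} y * (\<phi>1 y * w y) \<le> h' y * indicator {- real n..c} y"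
        proof (cases "y \<in> {-real n..real n} \<and> y \<le> x")
          case True
          then have y: "y \<in> {- real n..c}" "cl y = y" by (auto simp: c_def cl_def)
          have "\<phi>1 y \<le> real n" by (auto simp: \<phi>1_def indicator_def)
          then have "\<phi>1 y * w y \<le> real n * w y" by (intro mult_right_mono) (auto simp: w_def)
          then show ?thesis using True y by (simp add: h'_def w_def)
        next
          case False
          then have z: "indicator {..x} y * (\<phi>1 y * w y) = 0" by (auto simp: \<phi>1_def indicator_def)
          show ?thesis unfolding z by (simp add: h'_def)
        qed
      qed
      show "AE y in lebesgue. 0 \<le> h' y * indicator {- real n..c} y" by (intro AE_I2) (auto simp: h'_def)
    qed
    also have "\<dots> = h c - h (- real n)"
      using FTC integral_completion[OF hm] by (auto simp: has_bochner_integral_iff)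
    also have "\<dots> \<le> w x / 4" by (simp add: h_def w_def c_def)
    finally show ?thesis .
  qed
  have A2: "(\<integral>y. indicator {..x} y * (\<phi>2 y * w y) \<partial>lebesgue) \<le> w x / 4" for x
  proof -
    have "(\<integral>y. indicator {..x} y * (\<phi>2 y * w y) \<partial>lebesgue) \<le> (\<integral>y. \<phi>2 y * w x \<partial>lebesgue)"
    proof (rule integral_mono_AE')
      show "integrable lebesgue (\<lambda>y. \<phi>2 y * w x)" using i2 by simp
      show "AE y in lebesgue. indicator {..x} y * (\<phi>2 y * w y) \<le> \<phi>2 y * w x"
      proof (rule AE_I2)
        fix y
        have "0 \<le> \<phi>2 y * w x" using pos by (intro mult_nonneg_nonneg) (auto simp: w_def)
        then show "indicator {..x} y * (\<phi>2 y * w y) \<le> \<phi>2 y * w x"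
          using mult_left_mono[OF wmono[of y x] pos(2)[of y]] by (auto simp: indicator_def)
      qed
      show "AE y in lebesgue. 0 \<le> \<phi>2 y * w x"
        using pos by (intro AE_I2 mult_nonneg_nonneg) (auto simp: w_def)
    qed
    also have "\<dots> = (\<integral>y. \<phi>2 y \<partial>lebesgue) * w x" by simp
    also have "\<dots> \<le> 1/4 * w x" using small w1[of x] by (intro mult_right_mono) (auto simp: \<phi>2_def \<phi>1_def)
    finally show ?thesis by simp
  qed
  have i1: "integrable lebesgue \<phi>1"
    by (rule Bochner_Integration.integrable_bound[OF \<phi>(1)]) (use pos \<phi>(2) in auto)
  have A: "(\<integral>y. indicator {..x} y * (\<phi> y * w y) \<partial>lebesgue) \<le> w x / 2" for x
  proof -
    have J: "integrable lebesgue (\<lambda>y. indicator {..x} y * (\<phi>1 y * w y))"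
      "integrable lebesgue (\<lambda>y. indicator {..x} y * (\<phi>2 y * w y))"
      using iw[of \<phi>1 x] iw[of \<phi>2 x] i1 i2 by blast+
    define g1 where "g1 y = indicator {..x} y * (\<phi>1 y * w y)" for y
    define g2 where "g2 y = indicator {..x} y * (\<phi>2 y * w y)" for y
    have "(\<lambda>y. indicator {..x} y * (\<phi> y * w y)) = (\<lambda>y. g1 y + g2 y)"
      by (rule ext) (simp add: g1_def g2_def \<phi>2_def algebra_simps)
    moreover have "(\<integral>y. g1 y + g2 y \<partial>lebesgue) = (\<integral>y. g1 y \<partial>lebesgue) + (\<integral>y. g2 y \<partial>lebesgue)"
      using J unfolding g1_def[symmetric] g2_def[symmetric] by simp
    moreover have "(\<integral>y. g1 y \<partial>lebesgue) \<le> w x / 4" "(\<integral>y. g2 y \<partial>lebesgue) \<le> w x / 4"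
      unfolding g1_def g2_def by (rule A1, rule A2)
    ultimately show ?thesis by simp
  qed
  have main: "\<forall>x. d x \<le> 2 * W * e"
    if e0: "0 \<le> e" and d0: "\<And>x. 0 \<le> d x" and bd: "bdd_above (range d)"
      and int: "\<And>x. set_integrable lebesgue {..x} (\<lambda>y. \<phi> y * d y)"
      and le: "\<And>x. d x \<le> e + (LINT y:{..x}|lebesgue. \<phi> y * d y)"
    for d :: "real \<Rightarrow> real" and e :: real
  proof
    fix x
    \<comment> \<open>In the norm \<open>sup (d / w)\<close> the integral operator is a contraction
      with factor \<open>1/2\<close>, whence \<open>D \<le> e + D / 2\<close>. Boundedness of
      \<open>d\<close> makes \<open>D\<close> finite, so that this can be solved for
      \<open>D\<close>.\<close>
    define D where "D = (SUP x. d x / w x)"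
    have w0: "0 < w x" for x by (simp add: w_def)
    have bd': "bdd_above (range (\<lambda>x. d x / w x))"
    proof -
      obtain B where B: "\<And>x. d x \<le> B" using bd by (auto simp: bdd_above_def)
      have "d x / w x \<le> B" for x
      proof -
        have "d x / w x \<le> d x / 1" using w1[of x] d0[of x] by (intro divide_left_mono) auto
        then show ?thesis using B[of x] by simp
      qed
      then show ?thesis by (auto simp: bdd_above_def)
    qed
    have dD': "d x / w x \<le> D" for x unfolding D_def by (rule cSUP_upper[OF _ bd']) simp
    have dD: "d x \<le> D * w x" for x using dD'[of x] w0[of x] by (simp add: divide_le_eq)
    have D0: "0 \<le> D" using dD'[of 0] d0[of 0] w0[of 0] by (meson divide_nonneg_pos order_trans)
    have "d x / w x \<le> e + D / 2" for x
    proof -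
      have "(LINT y:{..x}|lebesgue. \<phi> y * d y) \<le> (\<integral>y. D * (indicator {..x} y * (\<phi> y * w y)) \<partial>lebesgue)"
        unfolding set_lebesgue_integral_def
      proof (rule integral_mono)
        show "integrable lebesgue (\<lambda>y. indicat_real {..x} y *\<^sub>R (\<phi> y * d y))"
          using int[of x] by (simp add: set_integrable_def)
        show "integrable lebesgue (\<lambda>y. D * (indicator {..x} y * (\<phi> y * w y)))" using iw[OF \<phi>(1)] by simp
        show "indicat_real {..x} y *\<^sub>R (\<phi> y * d y) \<le> D * (indicator {..x} y * (\<phi> y * w y))" for y
          using mult_left_mono[OF dD[of y] \<phi>(2)[of y]] by (auto simp: indicator_def mult_ac)
      qed
      also have "\<dots> = D * (\<integral>y. indicator {..x} y * (\<phi> y * w y) \<partial>lebesgue)" by simp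
      also have "\<dots> \<le> D * (w x / 2)" using A D0 by (intro mult_left_mono)
      finally have "d x \<le> e + D * (w x / 2)" using le[of x] by linarith
      then have "d x / w x \<le> (e + D * (w x / 2)) / w x" using w0[of x] by (intro divide_right_mono) auto
      also have "\<dots> = e / w x + D / 2" using w0[of x] by (simp add: add_divide_distrib)
      finally have "d x / w x \<le> e / w x + D / 2" .
      moreover have "e / w x \<le> e" using divide_left_mono[of 1 "w x" e] e0 w1[of x] by simp
      ultimately show ?thesis by linarith
    qed
    then have "D \<le> e + D / 2" unfolding D_def by (intro cSUP_least) auto
    then have De: "D \<le> 2 * e" by simp
    have "0 \<le> W" by (simp add: W_def)
    then have 1: "D * W \<le> 2 * e * W" using De by (rule mult_right_mono[rotated])
    have 2: "D * w x \<le> D * W" using D0 by (rule mult_left_mono[OF wW])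
    have "2 * e * W = 2 * W * e" by simp
    then show "d x \<le> 2 * W * e" using dD[of x] 1 2 by linarith
  qed
  show ?thesis
  proof (intro exI[of _ "2 * W"] conjI allI impI)
    show "0 \<le> 2 * W" by (simp add: W_def)
    fix d e x
    assume "0 \<le> e \<and> (\<forall>x. 0 \<le> d x) \<and> bdd_above (range d) \<and>
     (\<forall>x. set_integrable lebesgue {..x} (\<lambda>y. \<phi> y * d y)) \<and>
     (\<forall>x. d x \<le> e + (LINT y:{..x}|lebesgue. \<phi> y * d y))"
    then show "d x \<le> 2 * W * e" using main[of e d] by blast
  qed
qed

section \<open>The grid and its sampled coefficients\<close>

definition node :: "nat \<Rightarrow> nat \<Rightarrow> real" where
  "node n j = real j / real (Suc n) - real (Suc n)"

text \<open>One parameter controls both the mesh \<open>1 / (n + 1)\<close> and the window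
  \<open>[-(n + 1), n + 1]\<close>, so refinement also exhausts the line.\<close>

definition ncell :: "nat \<Rightarrow> nat" where
  "ncell n = 2 * (Suc n)\<^sup>2"

definition cell :: "nat \<Rightarrow> nat \<Rightarrow> real set" where
  "cell n j = {node n j..<node n (Suc j)}"

definition cell_int :: "(real \<Rightarrow> complex) \<Rightarrow> nat \<Rightarrow> nat \<Rightarrow> complex" where
  "cell_int f n j = (LINT y:cell n j|lebesgue. f y)"

text \<open>Since \<open>node n j = (j - (n + 1)^2) / (n + 1)\<close>, the offset
  \<open>(n + 1)^2\<close> produces the phase \<open>exp (-2 \<pi> i node \<xi>)\<close> at the left
  end of the cell, periodic in \<open>\<xi>\<close> with period \<open>n + 1\<close>. Only the phase
  is sampled; \<open>f\<close> is integrated exactly over the cell, so integrability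
  suffices.\<close>

definition samples :: "(real \<Rightarrow> complex) \<Rightarrow> nat \<Rightarrow> real \<Rightarrow> nat \<Rightarrow> complex" where
  "samples f n \<xi> j = cell_int f n j * phase ((Suc n)\<^sup>2) j (\<xi> / real (Suc n))"

text \<open>\<open>nat\<close> sends points left of the window to \<open>0\<close> and the minimum
  sends points right of it to \<open>ncell n\<close>, so the step functions built from
  \<open>idx\<close> are constant on either side.\<close>

definition idx :: "nat \<Rightarrow> real \<Rightarrow> nat" where
  "idx n x = min (ncell n) (nat \<lfloor>(x + real (Suc n)) * real (Suc n)\<rfloor>)"

lemma node_Suc: "node n (Suc j) = node n j + 1 / real (Suc n)"
  by (simp add: node_def add_divide_distrib del: of_nat_Suc) (simp add: field_simps)

lemma real_ncell: "real (ncell n) = 2 * (real (Suc n))\<^sup>2"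
  by (simp only: ncell_def of_nat_mult of_nat_numeral of_nat_power)

lemma node_0: "node n 0 = - real (Suc n)" and node_ncell: "node n (ncell n) = real (Suc n)"
  unfolding node_def real_ncell by (simp_all add: power2_eq_square del: of_nat_Suc)

lemma node_mono: "i \<le> j \<Longrightarrow> node n i \<le> node n j"
  by (simp add: node_def divide_right_mono del: of_nat_Suc)

lemma phase_node: "phase ((Suc n)\<^sup>2) j (\<xi> / real (Suc n)) = cis (- (2 * pi * node n j * \<xi>))"
proof -
  have "phase ((Suc n)\<^sup>2) j (\<xi> / real (Suc n)) = cis (real ((Suc n)\<^sup>2) * (2 * pi * (\<xi> / real (Suc n))) + real j * - (2 * pi * (\<xi> / real (Suc n))))"
    unfolding phase_def cis_cnj Complex.DeMoivre cis_mult ..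
  also have "real ((Suc n)\<^sup>2) * (2 * pi * (\<xi> / real (Suc n))) + real j * - (2 * pi * (\<xi> / real (Suc n))) = - (2 * pi * node n j * \<xi>)"
  proof -
    have "m\<^sup>2 * (2 * pi * (\<xi> / m)) + r * - (2 * pi * (\<xi> / m)) = - (2 * pi * (r / m - m) * \<xi>)" if "m \<noteq> 0" for m r :: real
      using that by (simp add: power2_eq_square field_simps)
    from this[of "real (Suc n)" "real j"] show ?thesis unfolding of_nat_power node_def by (simp del: of_nat_Suc)
  qed
  finally show ?thesis .
qed

lemma node_le_iff: "node n j \<le> x \<longleftrightarrow> real j \<le> (x + real (Suc n)) * real (Suc n)"
proof -
  have "0 < real (Suc n)" by simp
  then show ?thesis unfolding node_def by (simp only: diff_le_eq pos_divide_le_eq)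
qed

lemma less_node_iff: "x < node n j \<longleftrightarrow> (x + real (Suc n)) * real (Suc n) < real j"
  using node_le_iff[of n j x] by linarith

lemma mem_cell_iff: "x \<in> cell n j \<longleftrightarrow> \<lfloor>(x + real (Suc n)) * real (Suc n)\<rfloor> = int j"
  unfolding cell_def atLeastLessThan_iff node_le_iff less_node_iff floor_eq_iff by auto

lemma idx_cell:
  assumes "x \<in> cell n j" "j < ncell n"
  shows "idx n x = j"
  using assms by (simp add: mem_cell_iff idx_def)

lemma idx_cases:
  obtains "x < node n 0" "idx n x = 0" | "idx n x < ncell n" "x \<in> cell n (idx n x)"
    | "node n (ncell n) \<le> x" "idx n x = ncell n"
proof -
  define y where "y = (x + real (Suc n)) * real (Suc n)"
  consider "y < 0" | "0 \<le> y" "y < real (ncell n)" | "real (ncell n) \<le> y" by linarith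
  then show ?thesis
  proof cases
    case 1
    then have "x < node n 0" unfolding less_node_iff y_def by simp
    moreover have "idx n x = 0" using 1 unfolding idx_def y_def[symmetric] by simp
    ultimately show ?thesis by (rule that(1))
  next
    case 2
    define j where "j = nat \<lfloor>y\<rfloor>"
    have j: "real j \<le> y" "y < real j + 1" using 2 by (auto simp: j_def)
    then have "j < ncell n" using 2 by linarith
    moreover have "idx n x = j" unfolding idx_def y_def[symmetric] j_def[symmetric] using \<open>j < ncell n\<close> by simp
    moreover have "x \<in> cell n j" using j unfolding mem_cell_iff y_def floor_eq_iff by simp
    ultimately show ?thesis using that(2) by simp
  next
    case 3
    have "node n (ncell n) \<le> x" using 3 unfolding y_def node_le_iff .
    moreover have "int (ncell n) \<le> \<lfloor>y\<rfloor>" using 3 by (simp add: le_floor_iff)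
    then have "idx n x = ncell n" unfolding idx_def y_def[symmetric] by simp
    ultimately show ?thesis by (rule that(3))
  qed
qed

lemma cell_meas [measurable]: "cell n j \<in> sets lebesgue"
  by (simp add: cell_def)

lemma borel_measurable_idx: "(\<lambda>x. v (idx n x)) \<in> borel_measurable lebesgue"
proof (rule measurable_completion)
  have "idx n \<in> measurable lborel (count_space UNIV)" unfolding idx_def by measurable
  then show "(\<lambda>x. v (idx n x)) \<in> borel_measurable lborel" by measurable
qed

lemma set_integrable_lebesgue:
  fixes g :: "real \<Rightarrow> 'b::{banach, second_countable_topology}"
  assumes "integrable lebesgue g" "A \<in> sets lebesgue"
  shows "set_integrable lebesgue A g"
  using integrable_mult_indicator[OF assms(2,1)] unfolding set_integrable_def .

lemma cmod_set_integral_le: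
  fixes g :: "real \<Rightarrow> complex" and r :: "real \<Rightarrow> real"
  assumes g: "integrable lebesgue g" and r: "integrable lebesgue r" and le: "\<And>y. cmod (g y) \<le> E * r y"
    and AB: "A \<in> sets lebesgue" "B \<in> sets lebesgue" "A \<subseteq> B"
  shows "cmod (LINT y:A|lebesgue. g y) \<le> E * (LINT y:B|lebesgue. r y)"
proof -
  have "cmod (\<integral>y. indicator A y *\<^sub>R g y \<partial>lebesgue) \<le> (\<integral>y. E * (indicator B y *\<^sub>R r y) \<partial>lebesgue)"
  proof (rule cmod_integral_le)
    show "integrable lebesgue (\<lambda>y. indicator A y *\<^sub>R g y)"
      using set_integrable_lebesgue[OF g AB(1)] unfolding set_integrable_def .
    show "integrable lebesgue (\<lambda>y. E * (indicator B y *\<^sub>R r y))"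
      using set_integrable_lebesgue[OF r AB(2)] unfolding set_integrable_def by simp
    fix y :: real
    have "0 \<le> E * r y" using le[of y] norm_ge_zero order_trans by blast
    then show "cmod (indicator A y *\<^sub>R g y) \<le> E * (indicator B y *\<^sub>R r y)"
      using le[of y] AB(3) by (auto simp: indicator_def)
  qed
  then show ?thesis unfolding set_lebesgue_integral_def by simp
qed

lemma set_integral_Ico_Iio:
  fixes g :: "real \<Rightarrow> 'b::{banach, second_countable_topology}"
  assumes "integrable lebesgue g" "a \<le> b"
  shows "(LINT y:{..<b}|lebesgue. g y) = (LINT y:{..<a}|lebesgue. g y) + (LINT y:{a..<b}|lebesgue. g y)"
proof -
  have eq: "{..<b} = {..<a} \<union> {a..<b}" using assms(2) by auto
  have int: "set_integrable lebesgue {..<a} g" "set_integrable lebesgue {a..<b} g"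
    using assms(1) by (rule set_integrable_lebesgue, simp)+
  show ?thesis unfolding eq by (rule set_integral_Un[OF _ int]) auto
qed

lemma set_integral_Icc_Iic:
  fixes g :: "real \<Rightarrow> 'b::{banach, second_countable_topology}"
  assumes "integrable lebesgue g" "a \<le> b"
  shows "(LINT y:{..b}|lebesgue. g y) = (LINT y:{..<a}|lebesgue. g y) + (LINT y:{a..b}|lebesgue. g y)"
proof -
  have eq: "{..b} = {..<a} \<union> {a..b}" using assms(2) by auto
  have int: "set_integrable lebesgue {..<a} g" "set_integrable lebesgue {a..b} g"
    using assms(1) by (rule set_integrable_lebesgue, simp)+
  show ?thesis unfolding eq by (rule set_integral_Un[OF _ int]) auto
qed

lemma set_integral_le_integral:
  fixes r :: "real \<Rightarrow> real"
  assumes "integrable lebesgue r" "\<And>y. 0 \<le> r y" "A \<in> sets lebesgue"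
  shows "(LINT y:A|lebesgue. r y) \<le> (\<integral>y. r y \<partial>lebesgue)"
  unfolding set_lebesgue_integral_def
  using assms set_integrable_lebesgue[OF assms(1,3)]
  by (intro integral_mono) (auto simp: set_integrable_def indicator_def)

section \<open>From the matrix product to the Volterra equation\<close>

lemma inverse_su11_scale_bound:
  assumes "cmod z \<le> 1 / 2"
  shows "cmod (1 / su11_scale z - 1) \<le> (cmod z)\<^sup>2"
proof -
  define x where "x = (cmod z)\<^sup>2"
  have x: "0 \<le> x" "x \<le> 1 / 4"
    using power_mono[OF assms, of 2] by (auto simp: x_def power2_eq_square)
  define r where "r = sqrt (1 - x)"
  have r2: "r\<^sup>2 = 1 - x" and r: "0 < r" "r \<le> 1" using x by (auto simp: r_def)
  have "1 \<le> ((1 + x) * r)\<^sup>2"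
  proof -
    have "((1 + x) * r)\<^sup>2 = 1 + x * (1 - x - x\<^sup>2)"
      unfolding power_mult_distrib r2 by (simp add: power2_eq_square algebra_simps)
    moreover have "x\<^sup>2 \<le> x * (1/4)" unfolding power2_eq_square using x by (intro mult_left_mono) auto
    then have "0 \<le> x * (1 - x - x\<^sup>2)" using x by (intro mult_nonneg_nonneg) auto
    ultimately show ?thesis by linarith
  qed
  then have "1\<^sup>2 \<le> ((1 + x) * r)\<^sup>2" by simp
  then have "1 \<le> (1 + x) * r" by (rule power2_le_imp_le) (use x r in simp)
  then have "1 / r \<le> 1 + x" using r by (simp add: divide_le_eq)
  moreover have "1 \<le> 1 / r" using r by simp
  moreover have "1 / su11_scale z - 1 = complex_of_real (1 / r - 1)"
    by (simp add: su11_scale_def r_def x_def)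
  then have "cmod (1 / su11_scale z - 1) = \<bar>1 / r - 1\<bar>" by (simp only: norm_of_real)
  ultimately show ?thesis unfolding x_def by simp
qed

text \<open>The recursion is an Euler scheme for the integral equation. Its errors are the mass of
  \<open>q\<close> outside the window, the unfinished cell (\<open>\<delta>\<close>), the phase
  sampling (\<open>\<eta>\<close>), and the normalisation \<open>1 / su11_scale\<close>, which is of
  second order and hence at most \<open>\<delta>\<close> times the cell mass. The last two
  accumulate in proportion to the mass already passed. The same estimate serves both components,
  with the roles of \<open>u\<close> and \<open>v\<close> exchanged.\<close>

lemma approx_Volterra:
  fixes q :: "real \<Rightarrow> complex" and u v Q :: "nat \<Rightarrow> complex"
  assumes q: "integrable lebesgue q"
    and u: "\<And>j. cmod (u j) \<le> E" and v: "\<And>j. cmod (v j) \<le> E"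
    and step: "\<And>j. u (Suc j) = (u j + Q j * v j) / su11_scale (Q j)"
    and Q: "\<And>j. cmod (Q j) \<le> 1 / 2" "\<And>j. cmod (Q j) \<le> (LINT y:cell n j|lebesgue. cmod (q y))"
      "\<And>j. cmod (Q j - (LINT y:cell n j|lebesgue. q y)) \<le> \<eta> * (LINT y:cell n j|lebesgue. cmod (q y))"
    and \<delta>: "\<And>j. (LINT y:cell n j|lebesgue. cmod (q y)) \<le> \<delta>" and \<eta>: "0 \<le> \<eta>"
  shows "cmod (u (idx n x) - u 0 - (LINT y:{..x}|lebesgue. q y * v (idx n y)))
    \<le> E * ((LINT y:{..<node n 0}|lebesgue. cmod (q y)) + (LINT y:{node n (ncell n)..}|lebesgue. cmod (q y))
          + \<delta> + (\<eta> + 2 * \<delta>) * (\<integral>y. cmod (q y) \<partial>lebesgue))"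
proof -
  have E: "0 \<le> E" using u[of 0] norm_ge_zero order_trans by blast
  have qn: "integrable lebesgue (\<lambda>y. cmod (q y))" using q by simp
  have cell0: "0 \<le> (LINT y:cell n j|lebesgue. cmod (q y))" for j
    unfolding set_lebesgue_integral_def by (intro integral_nonneg_AE AE_I2) simp
  have \<delta>0: "0 \<le> \<delta>" using cell0[of 0] \<delta>[of 0] by linarith
  define g where "g y = q y * v (idx n y)" for y
  have gle: "cmod (g y) \<le> E * cmod (q y)" for y
    using mult_left_mono[OF v[of "idx n y"] norm_ge_zero[of "q y"]] by (simp add: g_def norm_mult mult.commute)
  have g: "integrable lebesgue g"
  proof (rule Bochner_Integration.integrable_bound[of _ "\<lambda>y. E * cmod (q y)"])
    show "g \<in> borel_measurable lebesgue"
      unfolding g_def using q borel_measurable_idx[of v n] by (intro borel_measurable_times) auto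
    show "AE y in lebesgue. norm (g y) \<le> norm (E * cmod (q y))"
      using gle E by (intro AE_I2) (simp add: abs_mult)
  qed (use qn in simp)
  note gb = cmod_set_integral_le[OF g qn gle]
  define T0 where "T0 = (LINT y:{..<node n 0}|lebesgue. cmod (q y))"
  define S where "S j = (LINT y:{..<node n j}|lebesgue. cmod (q y))" for j
  have S_Suc: "S (Suc j) = S j + (LINT y:cell n j|lebesgue. cmod (q y))" for j
    unfolding S_def cell_def by (rule set_integral_Ico_Iio[OF qn node_mono]) simp
  have main: "cmod (u j - u 0 - (LINT y:{..<node n j}|lebesgue. g y)) \<le> E * (T0 + (\<eta> + 2 * \<delta>) * (S j - T0))"
    if "j \<le> ncell n" for j
    using that
  proof (induction j)
    case 0
    have "cmod (LINT y:{..<node n 0}|lebesgue. g y) \<le> E * T0" unfolding T0_def by (rule gb) auto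
    then show ?case by (simp add: S_def T0_def)
  next
    case (Suc j)
    define c where "c = (LINT y:cell n j|lebesgue. cmod (q y))"
    have "(LINT y:cell n j|lebesgue. g y) = (LINT y:cell n j|lebesgue. v j * q y)"
      using Suc.prems by (intro set_lebesgue_integral_cong cell_meas) (auto simp: g_def idx_cell)
    then have gc: "(LINT y:cell n j|lebesgue. g y) = v j * (LINT y:cell n j|lebesgue. q y)" by simp
    have gs: "(LINT y:{..<node n (Suc j)}|lebesgue. g y) = (LINT y:{..<node n j}|lebesgue. g y) + v j * (LINT y:cell n j|lebesgue. q y)"
      unfolding gc[symmetric] unfolding cell_def by (rule set_integral_Ico_Iio[OF g node_mono]) simp
    have us: "u (Suc j) = u j + Q j * v j + (1 / su11_scale (Q j) - 1) * (u j + Q j * v j)"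
    proof -
      have "X / s = X + (1 / s - 1) * X" for X s :: complex by (simp add: left_diff_distrib)
      then show ?thesis unfolding step .
    qed
    have uQ: "cmod (u j + Q j * v j) \<le> 2 * E"
    proof -
      have "cmod (Q j * v j) \<le> 1/2 * E" unfolding norm_mult using Q(1) v E by (intro mult_mono) auto
      then show ?thesis using norm_triangle_ineq[of "u j" "Q j * v j"] u[of j] E by linarith
    qed
    have "cmod (u (Suc j) - u 0 - (LINT y:{..<node n (Suc j)}|lebesgue. g y))
      = cmod ((u j - u 0 - (LINT y:{..<node n j}|lebesgue. g y)) + (v j * (Q j - (LINT y:cell n j|lebesgue. q y)) + (1 / su11_scale (Q j) - 1) * (u j + Q j * v j)))"
      unfolding gs us by (simp add: algebra_simps)
    also have "\<dots> \<le> cmod (u j - u 0 - (LINT y:{..<node n j}|lebesgue. g y)) + (cmod (v j * (Q j - (LINT y:cell n j|lebesgue. q y))) + cmod ((1 / su11_scale (Q j) - 1) * (u j + Q j * v j)))"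
      by (intro norm_triangle_le add_left_mono norm_triangle_ineq)
    also have "\<dots> \<le> E * (T0 + (\<eta> + 2 * \<delta>) * (S j - T0)) + (E * (\<eta> * c) + (\<delta> * c) * (2 * E))"
    proof (intro add_mono)
      show "cmod (u j - u 0 - (LINT y:{..<node n j}|lebesgue. g y)) \<le> E * (T0 + (\<eta> + 2 * \<delta>) * (S j - T0))"
        using Suc by simp
      show "cmod (v j * (Q j - (LINT y:cell n j|lebesgue. q y))) \<le> E * (\<eta> * c)"
        unfolding norm_mult c_def using v Q(3) E by (intro mult_mono) auto
      have "(cmod (Q j))\<^sup>2 \<le> \<delta> * c"
        unfolding power2_eq_square c_def using Q(2)[of j] \<delta>[of j] \<delta>0 by (intro mult_mono) auto
      then have "cmod (1 / su11_scale (Q j) - 1) \<le> \<delta> * c" using inverse_su11_scale_bound[OF Q(1)[of j]] by linarith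
      then show "cmod ((1 / su11_scale (Q j) - 1) * (u j + Q j * v j)) \<le> \<delta> * c * (2 * E)"
        unfolding norm_mult using uQ by (intro mult_mono) (auto intro: order_trans[OF norm_ge_zero])
    qed
    also have "\<dots> = E * (T0 + (\<eta> + 2 * \<delta>) * (S (Suc j) - T0))"
      unfolding S_Suc c_def[symmetric] by (simp add: algebra_simps)
    finally show ?case .
  qed
  define I where "I = (\<integral>y. cmod (q y) \<partial>lebesgue)"
  define T1 where "T1 = (LINT y:{node n (ncell n)..}|lebesgue. cmod (q y))"
  have T0: "0 \<le> T0" and T1: "0 \<le> T1" unfolding T0_def T1_def set_lebesgue_integral_def
    by (intro integral_nonneg_AE AE_I2; simp)+
  have I0: "0 \<le> I" unfolding I_def by simp
  have SI: "S j \<le> I" for j unfolding S_def I_def by (rule set_integral_le_integral[OF qn]) auto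
  have main': "cmod (u j - u 0 - (LINT y:{..<node n j}|lebesgue. g y)) \<le> E * (T0 + (\<eta> + 2 * \<delta>) * I)"
    if "j \<le> ncell n" for j
  proof -
    have "(\<eta> + 2 * \<delta>) * (S j - T0) \<le> (\<eta> + 2 * \<delta>) * I"
      using SI[of j] T0 \<eta> \<delta>0 by (intro mult_left_mono) auto
    then have "E * (T0 + (\<eta> + 2 * \<delta>) * (S j - T0)) \<le> E * (T0 + (\<eta> + 2 * \<delta>) * I)"
      using E by (intro mult_left_mono) auto
    then show ?thesis using main[OF that] by linarith
  qed
  have tail: "cmod (u (idx n x) - u 0 - (LINT y:{..x}|lebesgue. g y)) \<le> E * (T0 + (\<eta> + 2 * \<delta>) * I) + E * B"
    if j: "idx n x \<le> ncell n" "node n (idx n x) \<le> x" and B: "cmod (LINT y:{node n (idx n x)..x}|lebesgue. g y) \<le> E * B" for B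
  proof -
    have "u (idx n x) - u 0 - (LINT y:{..x}|lebesgue. g y) = (u (idx n x) - u 0 - (LINT y:{..<node n (idx n x)}|lebesgue. g y)) - (LINT y:{node n (idx n x)..x}|lebesgue. g y)"
      unfolding set_integral_Icc_Iic[OF g j(2)] by simp
    then have "cmod (u (idx n x) - u 0 - (LINT y:{..x}|lebesgue. g y)) \<le> cmod (u (idx n x) - u 0 - (LINT y:{..<node n (idx n x)}|lebesgue. g y)) + cmod (LINT y:{node n (idx n x)..x}|lebesgue. g y)"
      by (simp only: norm_triangle_ineq4)
    then show ?thesis using main'[OF j(1)] B by linarith
  qed
  have R: "0 \<le> (\<eta> + 2 * \<delta>) * I" using \<eta> \<delta>0 I0 by simp
  have "cmod (u (idx n x) - u 0 - (LINT y:{..x}|lebesgue. g y)) \<le> E * (T0 + T1 + \<delta> + (\<eta> + 2 * \<delta>) * I)"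
  proof (cases rule: idx_cases[of x n])
    case 1
    have "cmod (LINT y:{..x}|lebesgue. g y) \<le> E * T0" unfolding T0_def by (rule gb) (use 1 in auto)
    also have "\<dots> \<le> E * (T0 + T1 + \<delta> + (\<eta> + 2 * \<delta>) * I)"
      using E T1 \<delta>0 R by (intro mult_left_mono) auto
    finally show ?thesis using 1 by simp
  next
    case 2
    have "cmod (LINT y:{node n (idx n x)..x}|lebesgue. g y) \<le> E * (LINT y:cell n (idx n x)|lebesgue. cmod (q y))"
      by (rule gb) (use 2 in \<open>auto simp: cell_def\<close>)
    also have "\<dots> \<le> E * \<delta>" using \<delta> E by (intro mult_left_mono)
    finally have "cmod (u (idx n x) - u 0 - (LINT y:{..x}|lebesgue. g y)) \<le> E * (T0 + (\<eta> + 2 * \<delta>) * I) + E * \<delta>"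
      using 2 by (intro tail) (auto simp: cell_def)
    also have "\<dots> \<le> E * (T0 + T1 + \<delta> + (\<eta> + 2 * \<delta>) * I)"
      unfolding distrib_left[symmetric] using E T1 by (intro mult_left_mono) auto
    finally show ?thesis .
  next
    case 3
    have "cmod (LINT y:{node n (idx n x)..x}|lebesgue. g y) \<le> E * T1"
      unfolding T1_def by (rule gb) (use 3 in auto)
    then have "cmod (u (idx n x) - u 0 - (LINT y:{..x}|lebesgue. g y)) \<le> E * (T0 + (\<eta> + 2 * \<delta>) * I) + E * T1"
      using 3 by (intro tail) auto
    also have "\<dots> \<le> E * (T0 + T1 + \<delta> + (\<eta> + 2 * \<delta>) * I)"
      unfolding distrib_left[symmetric] using E \<delta>0 by (intro mult_left_mono) auto
    finally show ?thesis .
  qed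
  then show ?thesis unfolding g_def T0_def T1_def I_def .
qed

text \<open>Absolute continuity of the integral, uniformly over cells: up to
  \<open>\<delta> / 2\<close> in \<open>L^1\<close> the function is bounded by \<open>m\<close>, and
  a cell has length \<open>1 / (n + 1)\<close>.\<close>

lemma cell_mass_tendsto_0:
  fixes \<phi> :: "real \<Rightarrow> real"
  assumes \<phi>: "integrable lebesgue \<phi>" "\<And>x. 0 \<le> \<phi> x" and \<delta>: "\<delta> > 0"
  shows "\<forall>\<^sub>F n in sequentially. \<forall>j. (LINT y:cell n j|lebesgue. \<phi> y) \<le> \<delta>"
proof -
  have "\<exists>m\<ge>1. (\<integral>x. \<phi> x - min (\<phi> x) (real m) * indicator {-real m..real m} x \<partial>lebesgue) \<le> \<delta> / 2"
    by (rule truncation_L1[OF \<phi>(1)], rule \<phi>(2)) (use \<delta> in simp)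
  then obtain m :: nat where m: "m \<ge> 1" "(\<integral>x. \<phi> x - min (\<phi> x) (real m) * indicator {-real m..real m} x \<partial>lebesgue) \<le> \<delta> / 2"
    by blast
  define \<phi>2 where "\<phi>2 x = \<phi> x - min (\<phi> x) (real m) * indicator {-real m..real m} x" for x
  have [measurable]: "\<phi> \<in> borel_measurable lebesgue" using \<phi>(1) by (rule borel_measurable_integrable)
  have [measurable]: "{-real m..real m} \<in> sets lebesgue" by simp
  have \<phi>2: "0 \<le> \<phi>2 x" "\<phi>2 x \<le> \<phi> x" "\<phi> x \<le> \<phi>2 x + real m" for x
    using \<phi>(2)[of x] by (auto simp: \<phi>2_def indicator_def min_def)
  have "\<phi>2 \<in> borel_measurable lebesgue" unfolding \<phi>2_def by measurable
  then have i2: "integrable lebesgue \<phi>2"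
    by (rule Bochner_Integration.integrable_bound[OF \<phi>(1)]) (use \<phi>2 \<phi>(2) in auto)
  obtain N :: nat where N: "real N \<ge> 2 * real m / \<delta>" using real_arch_simple by blast
  show ?thesis
    using eventually_ge_at_top[of N]
  proof eventually_elim
    case (elim n)
    show ?case
    proof
      fix j
      have mc: "emeasure lebesgue (cell n j) = ennreal (1 / real (Suc n))"
        unfolding cell_def node_Suc by simp
      then have cf: "emeasure lebesgue (cell n j) < \<infinity>" by simp
      have ci: "integrable lebesgue (indicat_real (cell n j))" using cf by (simp add: cell_meas)
      have "(LINT y:cell n j|lebesgue. \<phi> y) \<le> (\<integral>y. \<phi>2 y + real m * indicator (cell n j) y \<partial>lebesgue)"
        unfolding set_lebesgue_integral_def
      proof (rule integral_mono)
        show "integrable lebesgue (\<lambda>y. indicat_real (cell n j) y *\<^sub>R \<phi> y)"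
          using set_integrable_lebesgue[OF \<phi>(1) cell_meas] unfolding set_integrable_def .
        show "integrable lebesgue (\<lambda>y. \<phi>2 y + real m * indicator (cell n j) y)" using i2 ci by simp
        show "indicat_real (cell n j) y *\<^sub>R \<phi> y \<le> \<phi>2 y + real m * indicator (cell n j) y" for y
          using \<phi>2[of y] by (auto simp: indicator_def)
      qed
      also have "\<dots> = (\<integral>y. \<phi>2 y \<partial>lebesgue) + real m * (1 / real (Suc n))"
        using i2 ci mc by (simp add: measure_def)
      also have "real m * (1 / real (Suc n)) \<le> \<delta> / 2"
      proof -
        have "2 * real m / \<delta> \<le> real (Suc n)" using N elim by simp
        then show ?thesis using \<delta> by (simp add: field_simps del: of_nat_Suc)
      qed
      finally show "(LINT y:cell n j|lebesgue. \<phi> y) \<le> \<delta>" using m(2) unfolding \<phi>2_def by linarith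
    qed
  qed
qed

lemma cmod_cis_diff_le: "cmod (cis a - cis b) \<le> \<bar>a - b\<bar>"
proof -
  have "cmod (cis a - cis b) = cmod (cis b * (exp (\<i> * complex_of_real (a - b)) - 1))"
    by (simp add: cis_conv_exp right_diff_distrib exp_add[symmetric] algebra_simps)
  also have "\<dots> = 2 * \<bar>sin ((a - b) / 2)\<bar>"
    using dist_exp_i_1[of "a - b"] by (simp add: norm_mult dist_norm)
  also have "\<dots> \<le> \<bar>a - b\<bar>" using abs_sin_x_le_abs_x[of "(a - b) / 2"] by simp
  finally show ?thesis .
qed

section \<open>Existence, uniqueness and limit of the Dirac solution\<close>

context
  fixes f :: "real \<Rightarrow> complex"
  assumes f: "integrable lebesgue f"
begin

lemma integrable_cmod: "integrable lebesgue (\<lambda>y. cmod (f y))"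
  using f by simp

lemma f_meas: "f \<in> borel_measurable lebesgue"
  using f by (rule borel_measurable_integrable)

lemma cis_meas: "(\<lambda>y. cis (c * y * \<xi>)) \<in> borel_measurable lebesgue"
proof (rule measurable_completion)
  have "(\<lambda>y. cis (c * y * \<xi>)) \<in> borel_measurable borel"
    by (intro borel_measurable_continuous_onI continuous_intros)
  then show "(\<lambda>y. cis (c * y * \<xi>)) \<in> borel_measurable lborel" by simp
qed

definition "coeff_b \<xi> y = f y * cis (- (2 * pi * y * \<xi>))"

definition "coeff_a \<xi> y = cnj (f y) * cis (2 * pi * y * \<xi>)"

lemma coeff_a_coeff_b: "coeff_a \<xi> y = cnj (coeff_b \<xi> y)"
  by (simp add: coeff_a_def coeff_b_def cis_cnj)

lemma cmod_q [simp]: "cmod (coeff_a \<xi> y) = cmod (f y)" "cmod (coeff_b \<xi> y) = cmod (f y)"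
  by (simp_all add: coeff_a_def coeff_b_def norm_mult)

lemma q_int: "integrable lebesgue (coeff_a \<xi>)" "integrable lebesgue (coeff_b \<xi>)"
proof -
  show coeff_b: "integrable lebesgue (coeff_b \<xi>)"
  proof (rule Bochner_Integration.integrable_bound[OF f])
    have "(\<lambda>y. cis (- 2 * pi * y * \<xi>)) \<in> borel_measurable lebesgue" by (rule cis_meas)
    then show "coeff_b \<xi> \<in> borel_measurable lebesgue"
      unfolding coeff_b_def using f_meas by (intro borel_measurable_times) auto
  qed simp
  have "integrable lebesgue (\<lambda>y. cnj (coeff_b \<xi> y))" using coeff_b by simp
  then show "integrable lebesgue (coeff_a \<xi>)" by (simp add: coeff_a_coeff_b[abs_def])
qed

lemma sum_cells:
  fixes r :: "real \<Rightarrow> real"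
  assumes r: "integrable lebesgue r" "\<And>y. 0 \<le> r y"
  shows "(\<Sum>j<N. LINT y:cell n j|lebesgue. r y) \<le> (\<integral>y. r y \<partial>lebesgue)"
proof -
  have "(\<Sum>j<N. LINT y:cell n j|lebesgue. r y) = (LINT y:{..<node n N}|lebesgue. r y) - (LINT y:{..<node n 0}|lebesgue. r y)"
  proof (induction N)
    case (Suc N)
    have "(LINT y:{..<node n (Suc N)}|lebesgue. r y) = (LINT y:{..<node n N}|lebesgue. r y) + (LINT y:cell n N|lebesgue. r y)"
      unfolding cell_def by (rule set_integral_Ico_Iio[OF r(1) node_mono]) simp
    then show ?case using Suc by simp
  qed simp
  also have "\<dots> \<le> (LINT y:{..<node n N}|lebesgue. r y)"
  proof -
    have "0 \<le> (LINT y:{..<node n 0}|lebesgue. r y)"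
      unfolding set_lebesgue_integral_def using r(2) by (intro integral_nonneg_AE AE_I2) simp
    then show ?thesis by simp
  qed
  also have "\<dots> \<le> (\<integral>y. r y \<partial>lebesgue)" by (rule set_integral_le_integral[OF r]) simp
  finally show ?thesis .
qed

lemma cmod_cell_int: "cmod (cell_int f n j) \<le> (LINT y:cell n j|lebesgue. cmod (f y))"
  unfolding cell_int_def using cmod_set_integral_le[OF f integrable_cmod, of 1 "cell n j" "cell n j"] cell_meas by simp

lemma cmod_samples: "cmod (samples f n \<xi> j) = cmod (cell_int f n j)"
  by (simp add: samples_def norm_mult)

lemma sum_cmod_samples: "(\<Sum>j<N. cmod (samples f n \<xi> j)) \<le> (\<integral>y. cmod (f y) \<partial>lebesgue)"
proof -
  have "(\<Sum>j<N. cmod (samples f n \<xi> j)) \<le> (\<Sum>j<N. LINT y:cell n j|lebesgue. cmod (f y))"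
    unfolding cmod_samples by (intro sum_mono cmod_cell_int)
  also have "\<dots> \<le> (\<integral>y. cmod (f y) \<partial>lebesgue)" by (rule sum_cells[OF integrable_cmod]) simp
  finally show ?thesis .
qed

lemma eventually_cell_int_small:
  assumes "\<delta> > 0"
  shows "\<forall>\<^sub>F n in sequentially. \<forall>j. cmod (cell_int f n j) \<le> \<delta>"
  using cell_mass_tendsto_0[OF integrable_cmod norm_ge_zero assms]
  by (rule eventually_mono) (use cmod_cell_int order_trans in blast)

definition "growth = exp (2 * (\<integral>y. cmod (f y) \<partial>lebesgue))"

lemma disc_a_disc_b_bound:
  assumes "\<And>j. cmod (cell_int f n j) \<le> 1 / 2"
  shows "cmod (disc_a (samples f n \<xi>) j) \<le> growth" "cmod (disc_b (samples f n \<xi>) j) \<le> growth"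
proof -
  have "cmod (disc_a (samples f n \<xi>) j) + cmod (disc_b (samples f n \<xi>) j) \<le> exp (2 * (\<Sum>i<j. cmod (samples f n \<xi> i)))"
    by (rule cmod_disc_a_disc_b_growth) (simp only: cmod_samples assms)
  also have "\<dots> \<le> growth" unfolding growth_def using sum_cmod_samples by simp
  finally have "cmod (disc_a (samples f n \<xi>) j) + cmod (disc_b (samples f n \<xi>) j) \<le> growth" .
  then show "cmod (disc_a (samples f n \<xi>) j) \<le> growth" "cmod (disc_b (samples f n \<xi>) j) \<le> growth"
    using norm_ge_zero[of "disc_a (samples f n \<xi>) j"] norm_ge_zero[of "disc_b (samples f n \<xi>) j"] by linarith+
qed

text \<open>\<open>cis\<close> is 1-Lipschitz, and within a cell the phase argument moves by at most
  \<open>2 \<pi> |\<xi>| / (n + 1)\<close>. The bound is not uniform in \<open>\<xi>\<close>, so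
  convergence to the solution is obtained for each fixed frequency.\<close>

lemma samples_coeff_b:
  "cmod (samples f n \<xi> j - (LINT y:cell n j|lebesgue. coeff_b \<xi> y)) \<le> (2 * pi * \<bar>\<xi>\<bar> / real (Suc n)) * (LINT y:cell n j|lebesgue. cmod (f y))"
proof -
  define c where "c = cis (- (2 * pi * node n j * \<xi>))"
  define g where "g y = indicator (cell n j) y *\<^sub>R (f y * c - coeff_b \<xi> y)" for y
  have cellint: "set_integrable lebesgue (cell n j) (\<lambda>y. f y * c)" "set_integrable lebesgue (cell n j) (coeff_b \<xi>)"
    using f q_int(2)[of \<xi>] cell_meas by (intro set_integrable_lebesgue; simp)+
  have "samples f n \<xi> j - (LINT y:cell n j|lebesgue. coeff_b \<xi> y) = (LINT y:cell n j|lebesgue. f y * c) - (LINT y:cell n j|lebesgue. coeff_b \<xi> y)"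
    unfolding samples_def phase_node c_def[symmetric] cell_int_def by simp
  also have "\<dots> = (LINT y:cell n j|lebesgue. f y * c - coeff_b \<xi> y)"
    using cellint by (rule set_integral_diff(2)[symmetric])
  also have "\<dots> = (\<integral>y. g y \<partial>lebesgue)" unfolding g_def set_lebesgue_integral_def ..
  finally have eq: "samples f n \<xi> j - (LINT y:cell n j|lebesgue. coeff_b \<xi> y) = (\<integral>y. g y \<partial>lebesgue)" .
  have gi: "integrable lebesgue g"
    using set_integral_diff(1)[OF cellint] unfolding g_def set_integrable_def .
  have ge: "cmod (g y) \<le> (2 * pi * \<bar>\<xi>\<bar> / real (Suc n)) * (indicator (cell n j) y *\<^sub>R cmod (f y))" for y
  proof (cases "y \<in> cell n j")
    case True
    have "cmod (f y * c - coeff_b \<xi> y) = cmod (f y) * cmod (c - cis (- (2 * pi * y * \<xi>)))"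
      unfolding coeff_b_def by (simp add: norm_mult[symmetric] right_diff_distrib)
    also have "\<dots> \<le> cmod (f y) * \<bar>- (2 * pi * node n j * \<xi>) - - (2 * pi * y * \<xi>)\<bar>"
      unfolding c_def by (intro mult_left_mono cmod_cis_diff_le) simp
    also have "- (2 * pi * node n j * \<xi>) - - (2 * pi * y * \<xi>) = 2 * pi * \<xi> * (y - node n j)"
      by (simp add: algebra_simps)
    also have "\<bar>2 * pi * \<xi> * (y - node n j)\<bar> = 2 * pi * \<bar>\<xi>\<bar> * (y - node n j)"
      using True by (simp add: abs_mult cell_def)
    also have "cmod (f y) * (2 * pi * \<bar>\<xi>\<bar> * (y - node n j)) \<le> cmod (f y) * (2 * pi * \<bar>\<xi>\<bar> * (1 / real (Suc n)))"
      using True unfolding cell_def node_Suc by (intro mult_left_mono) auto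
    finally show ?thesis using True by (simp add: g_def mult_ac)
  qed (simp add: g_def)
  have "cmod (\<integral>y. g y \<partial>lebesgue) \<le> (\<integral>y. (2 * pi * \<bar>\<xi>\<bar> / real (Suc n)) * (indicator (cell n j) y *\<^sub>R cmod (f y)) \<partial>lebesgue)"
    using set_integrable_lebesgue[OF integrable_cmod cell_meas]
    by (intro cmod_integral_le[OF gi] ge) (simp only: set_integrable_def integrable_mult_right)
  then show ?thesis unfolding eq by (simp add: set_lebesgue_integral_def)
qed

lemma tails_tendsto_0:
  "(\<lambda>n. (LINT y:{..<node n 0}|lebesgue. cmod (f y)) + (LINT y:{node n (ncell n)..}|lebesgue. cmod (f y))) \<longlonglongrightarrow> 0"
proof -
  have "(\<lambda>n. \<integral>y. indicator {..<node n 0} y *\<^sub>R cmod (f y) \<partial>lebesgue) \<longlonglongrightarrow> (\<integral>y. 0 \<partial>(lebesgue :: real measure))"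
  proof (rule integral_dominated_convergence[where w = "\<lambda>y. cmod (f y)"])
    show "(\<lambda>y. indicator {..<node n 0} y *\<^sub>R cmod (f y)) \<in> borel_measurable lebesgue" for n
      using set_integrable_lebesgue[OF integrable_cmod, of "{..<node n 0}"] unfolding set_integrable_def by auto
    show "AE y in lebesgue. (\<lambda>n. indicator {..<node n 0} y *\<^sub>R cmod (f y)) \<longlonglongrightarrow> 0"
    proof (rule AE_I2, rule tendsto_eventually)
      fix y :: real
      obtain N :: nat where N: "real N \<ge> \<bar>y\<bar>" using real_arch_simple by blast
      show "\<forall>\<^sub>F n in sequentially. indicator {..<node n 0} y *\<^sub>R cmod (f y) = 0"
        using eventually_ge_at_top[of N] by eventually_elim (use N in \<open>auto simp: node_0\<close>)
    qed
  qed (use integrable_cmod in \<open>auto simp: indicator_def\<close>)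
  moreover have "(\<lambda>n. \<integral>y. indicator {node n (ncell n)..} y *\<^sub>R cmod (f y) \<partial>lebesgue) \<longlonglongrightarrow> (\<integral>y. 0 \<partial>(lebesgue :: real measure))"
  proof (rule integral_dominated_convergence[where w = "\<lambda>y. cmod (f y)"])
    show "(\<lambda>y. indicator {node n (ncell n)..} y *\<^sub>R cmod (f y)) \<in> borel_measurable lebesgue" for n
      using set_integrable_lebesgue[OF integrable_cmod, of "{node n (ncell n)..}"] unfolding set_integrable_def by auto
    show "AE y in lebesgue. (\<lambda>n. indicator {node n (ncell n)..} y *\<^sub>R cmod (f y)) \<longlonglongrightarrow> 0"
    proof (rule AE_I2, rule tendsto_eventually)
      fix y :: real
      obtain N :: nat where N: "real N \<ge> \<bar>y\<bar>" using real_arch_simple by blast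
      show "\<forall>\<^sub>F n in sequentially. indicator {node n (ncell n)..} y *\<^sub>R cmod (f y) = 0"
        using eventually_ge_at_top[of N] by eventually_elim (use N in \<open>auto simp: node_ncell\<close>)
    qed
  qed (use integrable_cmod in \<open>auto simp: indicator_def\<close>)
  ultimately show ?thesis unfolding set_lebesgue_integral_def by (auto intro: tendsto_add_zero)
qed

definition "step_a n \<xi> x = disc_a (samples f n \<xi>) (idx n x)"

definition "step_b n \<xi> x = disc_b (samples f n \<xi>) (idx n x)"

lemma approx_solution:
  assumes e: "e > 0"
  shows "\<forall>\<^sub>F n in sequentially. (\<forall>x. cmod (step_a n \<xi> x - 1 - (LINT y:{..x}|lebesgue. coeff_a \<xi> y * step_b n \<xi> y)) \<le> e \<and>
     cmod (step_b n \<xi> x - (LINT y:{..x}|lebesgue. coeff_b \<xi> y * step_a n \<xi> y)) \<le> e) \<and> (\<forall>j. cmod (cell_int f n j) \<le> 1 / 2)"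
proof -
  define I where "I = (\<integral>y. cmod (f y) \<partial>lebesgue)"
  have I0: "0 \<le> I" by (simp add: I_def)
  have E0: "0 < growth" by (simp add: growth_def)
  define e' where "e' = e / growth"
  have e': "e' > 0" using e E0 by (simp add: e'_def)
  \<comment> \<open>The budget \<open>e' = e / growth\<close> is spent in quarters: one for the
    tails, one for the phase sampling, and one for \<open>\<delta> (1 + 2 I)\<close>, the unfinished
    cell and the normalisation.\<close>
  define \<delta> where "\<delta> = min (1 / 2) (e' / (4 * (1 + 2 * I)))"
  have \<delta>: "\<delta> > 0" "\<delta> \<le> 1/2" "\<delta> * (1 + 2 * I) \<le> e' / 4"
  proof -
    show "\<delta> > 0" using e' I0 by (simp add: \<delta>_def)
    show "\<delta> \<le> 1/2" unfolding \<delta>_def by (rule min.cobounded1)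
    have "\<delta> * (1 + 2 * I) \<le> e' / (4 * (1 + 2 * I)) * (1 + 2 * I)" using I0 by (intro mult_right_mono) (auto simp: \<delta>_def)
    moreover have "e' / (4 * J) * J = e' / 4" if "0 < J" for J using that by simp
    then have "e' / (4 * (1 + 2 * I)) * (1 + 2 * I) = e' / 4" using I0 by (metis add_pos_nonneg mult_nonneg_nonneg zero_le_numeral zero_less_one)
    ultimately show "\<delta> * (1 + 2 * I) \<le> e' / 4" by linarith
  qed
  have ev1: "\<forall>\<^sub>F n in sequentially. \<forall>j. (LINT y:cell n j|lebesgue. cmod (f y)) \<le> \<delta>"
    by (rule cell_mass_tendsto_0[OF integrable_cmod norm_ge_zero \<delta>(1)])
  have ev2: "\<forall>\<^sub>F n in sequentially. (LINT y:{..<node n 0}|lebesgue. cmod (f y)) + (LINT y:{node n (ncell n)..}|lebesgue. cmod (f y)) < e' / 4"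
    using tails_tendsto_0 e' by (intro order_tendstoD(2)) auto
  have "(\<lambda>n. (2 * pi * \<bar>\<xi>\<bar> * I) * (1 / real (Suc n))) \<longlonglongrightarrow> (2 * pi * \<bar>\<xi>\<bar> * I) * 0"
    using LIMSEQ_Suc[OF lim_1_over_n] by (intro tendsto_mult tendsto_const) auto
  then have ev3: "\<forall>\<^sub>F n in sequentially. (2 * pi * \<bar>\<xi>\<bar> * I) * (1 / real (Suc n)) < e' / 4"
    using e' by (intro order_tendstoD(2)) auto
  from ev1 ev2 ev3 show ?thesis
  proof eventually_elim
    case (elim n)
    define \<eta> where "\<eta> = 2 * pi * \<bar>\<xi>\<bar> / real (Suc n)"
    have \<eta>: "0 \<le> \<eta>" by (simp add: \<eta>_def)
    define F where "F = samples f n \<xi>"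
    have ci: "cmod (cell_int f n j) \<le> 1 / 2" for j
      using cmod_cell_int[of n j] elim(1) \<delta>(2) order_trans by meson
    have F12: "cmod (F j) \<le> 1 / 2" for j using ci[of j] by (simp add: F_def cmod_samples)
    have Fc: "cmod (F j) \<le> (LINT y:cell n j|lebesgue. cmod (f y))" for j
      using cmod_cell_int[of n j] by (simp add: F_def cmod_samples)
    have snc: "su11_scale (cnj z) = su11_scale z" for z by (rule su11_scale_cong) simp
    have bnd: "growth * ((LINT y:{..<node n 0}|lebesgue. cmod (f y)) + (LINT y:{node n (ncell n)..}|lebesgue. cmod (f y))
          + \<delta> + (\<eta> + 2 * \<delta>) * I) \<le> e"
    proof -
      have "\<eta> * I < e' / 4" using elim(3) by (simp add: \<eta>_def)
      then have "(LINT y:{..<node n 0}|lebesgue. cmod (f y)) + (LINT y:{node n (ncell n)..}|lebesgue. cmod (f y))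
          + \<delta> + (\<eta> + 2 * \<delta>) * I \<le> e'"
        using elim(2) \<delta>(3) e' by (simp add: algebra_simps)
      then have "growth * ((LINT y:{..<node n 0}|lebesgue. cmod (f y)) + (LINT y:{node n (ncell n)..}|lebesgue. cmod (f y))
          + \<delta> + (\<eta> + 2 * \<delta>) * I) \<le> growth * e'" using E0 by (intro mult_left_mono) auto
      then show ?thesis using E0 by (simp add: e'_def)
    qed
    have A: "cmod (step_a n \<xi> x - 1 - (LINT y:{..x}|lebesgue. coeff_a \<xi> y * step_b n \<xi> y)) \<le> e" for x
    proof -
      have "cmod (disc_a F (idx n x) - disc_a F 0 - (LINT y:{..x}|lebesgue. coeff_a \<xi> y * disc_b F (idx n y)))
        \<le> growth * ((LINT y:{..<node n 0}|lebesgue. cmod (coeff_a \<xi> y)) + (LINT y:{node n (ncell n)..}|lebesgue. cmod (coeff_a \<xi> y))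
          + \<delta> + (\<eta> + 2 * \<delta>) * (\<integral>y. cmod (coeff_a \<xi> y) \<partial>lebesgue))"
      proof (rule approx_Volterra[where Q = "\<lambda>j. cnj (F j)"])
        show "cmod (cnj (F j) - (LINT y:cell n j|lebesgue. coeff_a \<xi> y)) \<le> \<eta> * (LINT y:cell n j|lebesgue. cmod (coeff_a \<xi> y))" for j
        proof -
          have "(LINT y:cell n j|lebesgue. coeff_a \<xi> y) = cnj (LINT y:cell n j|lebesgue. coeff_b \<xi> y)"
          proof -
            have "(\<integral>y. indicator (cell n j) y *\<^sub>R coeff_a \<xi> y \<partial>lebesgue) = (\<integral>y. cnj (indicator (cell n j) y *\<^sub>R coeff_b \<xi> y) \<partial>lebesgue)"
              by (intro Bochner_Integration.integral_cong refl) (simp add: coeff_a_coeff_b)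
            also have "\<dots> = cnj (\<integral>y. indicator (cell n j) y *\<^sub>R coeff_b \<xi> y \<partial>lebesgue)" by (rule Bochner_Integration.integral_cnj)
            finally show ?thesis unfolding set_lebesgue_integral_def .
          qed
          then have "cmod (cnj (F j) - (LINT y:cell n j|lebesgue. coeff_a \<xi> y)) = cmod (F j - (LINT y:cell n j|lebesgue. coeff_b \<xi> y))"
            by (simp only: complex_cnj_diff[symmetric] complex_mod_cnj)
          then show ?thesis using samples_coeff_b[of n \<xi> j] by (simp add: F_def \<eta>_def)
        qed
        show "disc_a F (Suc j) = (disc_a F j + cnj (F j) * disc_b F j) / su11_scale (cnj (F j))" for j
          unfolding snc by (rule disc_a_Suc)
      qed (use q_int disc_a_disc_b_bound[OF ci] F12 Fc elim(1) \<eta> in \<open>simp_all add: F_def\<close>)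
      then show ?thesis using bnd by (simp add: step_a_def step_b_def F_def I_def)
    qed
    have B: "cmod (step_b n \<xi> x - (LINT y:{..x}|lebesgue. coeff_b \<xi> y * step_a n \<xi> y)) \<le> e" for x
    proof -
      have "cmod (disc_b F (idx n x) - disc_b F 0 - (LINT y:{..x}|lebesgue. coeff_b \<xi> y * disc_a F (idx n y)))
        \<le> growth * ((LINT y:{..<node n 0}|lebesgue. cmod (coeff_b \<xi> y)) + (LINT y:{node n (ncell n)..}|lebesgue. cmod (coeff_b \<xi> y))
          + \<delta> + (\<eta> + 2 * \<delta>) * (\<integral>y. cmod (coeff_b \<xi> y) \<partial>lebesgue))"
      proof (rule approx_Volterra[where Q = F])
        show "cmod (F j - (LINT y:cell n j|lebesgue. coeff_b \<xi> y)) \<le> \<eta> * (LINT y:cell n j|lebesgue. cmod (coeff_b \<xi> y))" for j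
          using samples_coeff_b[of n \<xi> j] by (simp add: F_def \<eta>_def)
        show "disc_b F (Suc j) = (disc_b F j + F j * disc_a F j) / su11_scale (F j)" for j by (rule disc_b_Suc)
      qed (use q_int disc_a_disc_b_bound[OF ci] F12 Fc elim(1) \<eta> in \<open>simp_all add: F_def\<close>)
      then show ?thesis using bnd by (simp add: step_a_def step_b_def F_def I_def)
    qed
    show ?case using A B ci by blast
  qed
qed

lemma step_a_step_b_meas: "step_a n \<xi> \<in> borel_measurable lebesgue" "step_b n \<xi> \<in> borel_measurable lebesgue"
  using borel_measurable_idx[of "disc_a (samples f n \<xi>)" n] borel_measurable_idx[of "disc_b (samples f n \<xi>)" n]
  by (simp_all add: step_a_def[abs_def] step_b_def[abs_def])

lemma q_mult_int:
  assumes "g \<in> borel_measurable lebesgue" "\<And>y. cmod (g y) \<le> B"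
  shows "integrable lebesgue (\<lambda>y. coeff_a \<xi> y * g y)" "integrable lebesgue (\<lambda>y. coeff_b \<xi> y * g y)"
proof -
  have B: "0 \<le> B" using assms(2)[of 0] norm_ge_zero order_trans by blast
  have le: "cmod (q * g y) \<le> cmod (B * q)" for q :: complex and y
    using mult_left_mono[OF assms(2)[of y] norm_ge_zero[of q]] B by (simp add: norm_mult mult.commute)
  show "integrable lebesgue (\<lambda>y. coeff_a \<xi> y * g y)"
  proof (rule Bochner_Integration.integrable_bound[of _ "\<lambda>y. B * coeff_a \<xi> y"])
    show "(\<lambda>y. coeff_a \<xi> y * g y) \<in> borel_measurable lebesgue"
      using assms(1) q_int(1)[of \<xi>] by (intro borel_measurable_times) auto
  qed (use le q_int in auto)
  show "integrable lebesgue (\<lambda>y. coeff_b \<xi> y * g y)"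
  proof (rule Bochner_Integration.integrable_bound[of _ "\<lambda>y. B * coeff_b \<xi> y"])
    show "(\<lambda>y. coeff_b \<xi> y * g y) \<in> borel_measurable lebesgue"
      using assms(1) q_int(2)[of \<xi>] by (intro borel_measurable_times) auto
  qed (use le q_int in auto)
qed

lemma set_integral_diff_mult_le:
  assumes q: "\<And>y. cmod (q y) = cmod (f y)"
    and g: "set_integrable lebesgue {..x} (\<lambda>y. q y * g y)" "set_integrable lebesgue {..x} (\<lambda>y. q y * h y)"
  shows "cmod ((LINT y:{..x}|lebesgue. q y * g y) - (LINT y:{..x}|lebesgue. q y * h y))
      \<le> (LINT y:{..x}|lebesgue. cmod (f y) * cmod (g y - h y))"
    and "set_integrable lebesgue {..x} (\<lambda>y. cmod (f y) * cmod (g y - h y))"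
proof -
  have eq: "cmod (q y * g y - q y * h y) = cmod (f y) * cmod (g y - h y)" for y
    by (simp add: q[symmetric] norm_mult[symmetric] right_diff_distrib)
  have i: "set_integrable lebesgue {..x} (\<lambda>y. q y * g y - q y * h y)" by (rule set_integral_diff(1)[OF g])
  have "(LINT y:{..x}|lebesgue. q y * g y) - (LINT y:{..x}|lebesgue. q y * h y) = (LINT y:{..x}|lebesgue. q y * g y - q y * h y)"
    by (rule set_integral_diff(2)[OF g, symmetric])
  moreover have "cmod (LINT y:{..x}|lebesgue. q y * g y - q y * h y) \<le> (LINT y:{..x}|lebesgue. cmod (q y * g y - q y * h y))"
    by (rule set_integral_norm_bound[OF i])
  ultimately show "cmod ((LINT y:{..x}|lebesgue. q y * g y) - (LINT y:{..x}|lebesgue. q y * h y))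
      \<le> (LINT y:{..x}|lebesgue. cmod (f y) * cmod (g y - h y))" by (simp only: eq)
  show "set_integrable lebesgue {..x} (\<lambda>y. cmod (f y) * cmod (g y - h y))"
    using set_integrable_norm[OF i] by (simp only: eq)
qed

lemma dirac_solution_iff:
  "dirac_solution f \<xi> a b \<longleftrightarrow>
     (\<forall>x. set_integrable lebesgue {..x} (\<lambda>y. coeff_a \<xi> y * b y) \<and>
          set_integrable lebesgue {..x} (\<lambda>y. coeff_b \<xi> y * a y) \<and>
          a x = 1 + (LINT y:{..x}|lebesgue. coeff_a \<xi> y * b y) \<and>
          b x = (LINT y:{..x}|lebesgue. coeff_b \<xi> y * a y))"
  unfolding dirac_solution_def coeff_a_def coeff_b_def by (rule refl)

lemma gronwall_f:
  "\<exists>C\<ge>0. \<forall>d e. 0 \<le> e \<and> (\<forall>x. 0 \<le> d x) \<and> bdd_above (range d) \<and>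
     (\<forall>x. set_integrable lebesgue {..x} (\<lambda>y. cmod (f y) * d y)) \<and>
     (\<forall>x. d x \<le> e + (LINT y:{..x}|lebesgue. cmod (f y) * d y)) \<longrightarrow> (\<forall>x. d x \<le> C * e)"
  by (rule gronwall_L1[OF integrable_cmod]) (rule norm_ge_zero)

lemma dirac_solution_unique:
  assumes 1: "dirac_solution f \<xi> a b" and 2: "dirac_solution f \<xi> a' b'"
  shows "a = a'" "b = b'"
proof -
  obtain C where C: "C \<ge> 0" "\<forall>d e. 0 \<le> e \<and> (\<forall>x. 0 \<le> d x) \<and> bdd_above (range d) \<and>
     (\<forall>x. set_integrable lebesgue {..x} (\<lambda>y. cmod (f y) * d y)) \<and>
     (\<forall>x. d x \<le> e + (LINT y:{..x}|lebesgue. cmod (f y) * d y)) \<longrightarrow> (\<forall>x. d x \<le> C * e)"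
    using gronwall_f by (elim exE conjE) (rule that)
  note s1 = 1[unfolded dirac_solution_iff, rule_format] and s2 = 2[unfolded dirac_solution_iff, rule_format]
  define D where "D y = cmod (a y - a' y) + cmod (b y - b' y)" for y
  have Di: "set_integrable lebesgue {..x} (\<lambda>y. cmod (f y) * D y)"
    and Dle: "D x \<le> (LINT y:{..x}|lebesgue. cmod (f y) * D y)" for x
  proof -
    have i: "set_integrable lebesgue {..x} (\<lambda>y. coeff_a \<xi> y * b y)" "set_integrable lebesgue {..x} (\<lambda>y. coeff_a \<xi> y * b' y)"
      "set_integrable lebesgue {..x} (\<lambda>y. coeff_b \<xi> y * a y)" "set_integrable lebesgue {..x} (\<lambda>y. coeff_b \<xi> y * a' y)"
      using s1[of x] s2[of x] by blast+
    have e: "a x = 1 + (LINT y:{..x}|lebesgue. coeff_a \<xi> y * b y)" "a' x = 1 + (LINT y:{..x}|lebesgue. coeff_a \<xi> y * b' y)"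
      "b x = (LINT y:{..x}|lebesgue. coeff_b \<xi> y * a y)" "b' x = (LINT y:{..x}|lebesgue. coeff_b \<xi> y * a' y)"
      using s1[of x] s2[of x] by blast+
    note A = set_integral_diff_mult_le[where q = "coeff_a \<xi>", OF cmod_q(1) i(1,2)]
    note B = set_integral_diff_mult_le[where q = "coeff_b \<xi>", OF cmod_q(2) i(3,4)]
    have eq: "cmod (f y) * D y = cmod (f y) * cmod (b y - b' y) + cmod (f y) * cmod (a y - a' y)" for y
      by (simp add: D_def algebra_simps)
    show "set_integrable lebesgue {..x} (\<lambda>y. cmod (f y) * D y)"
      unfolding eq by (rule set_integral_add(1)[OF A(2) B(2)])
    have "cmod (a x - a' x) \<le> (LINT y:{..x}|lebesgue. cmod (f y) * cmod (b y - b' y))"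
      using A(1) unfolding e(1,2) add_diff_cancel_left .
    moreover have "cmod (b x - b' x) \<le> (LINT y:{..x}|lebesgue. cmod (f y) * cmod (a y - a' y))"
      using B(1) unfolding e(3,4) .
    ultimately show "D x \<le> (LINT y:{..x}|lebesgue. cmod (f y) * D y)"
      unfolding eq set_integral_add(2)[OF A(2) B(2)] by (simp add: D_def)
  qed
  have D0: "D X = 0" for X
  proof -
    \<comment> \<open>Gronwall's lemma wants a bounded function, which the definition of a solution
      does not provide. Cut off at \<open>X\<close>, the difference is bounded by the finite
      integral of \<open>|f| D\<close> over \<open>{..X}\<close>, and \<open>X\<close> is
      arbitrary.\<close>
    define d where "d y = indicator {..X} y * D y" for y
    have fd: "cmod (f y) * d y = indicator {..X} y *\<^sub>R (cmod (f y) * D y)" for y by (simp add: d_def)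
    have fdi: "integrable lebesgue (\<lambda>y. cmod (f y) * d y)"
      using Di[of X] unfolding set_integrable_def fd .
    have Dpos: "0 \<le> D y" for y by (simp add: D_def)
    have le: "d x \<le> 0 + (LINT y:{..x}|lebesgue. cmod (f y) * d y)" for x
    proof (cases "x \<le> X")
      case True
      then have "(LINT y:{..x}|lebesgue. cmod (f y) * d y) = (LINT y:{..x}|lebesgue. cmod (f y) * D y)"
        by (intro set_lebesgue_integral_cong) (auto simp: d_def)
      then show ?thesis using Dle[of x] True by (simp add: d_def)
    next
      case False
      have "0 \<le> (LINT y:{..x}|lebesgue. cmod (f y) * d y)"
        unfolding set_lebesgue_integral_def using Dpos by (intro integral_nonneg_AE AE_I2) (simp add: d_def)
      then show ?thesis using False by (simp add: d_def)
    qed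
    have "d x \<le> (LINT y:{..X}|lebesgue. cmod (f y) * D y)" for x
    proof -
      have "d x \<le> (LINT y:{..x}|lebesgue. cmod (f y) * d y)" using le[of x] by simp
      also have "\<dots> \<le> (\<integral>y. cmod (f y) * d y \<partial>lebesgue)"
        by (rule set_integral_le_integral[OF fdi]) (auto simp: d_def Dpos)
      also have "\<dots> = (LINT y:{..X}|lebesgue. cmod (f y) * D y)"
        unfolding set_lebesgue_integral_def fd ..
      finally show ?thesis .
    qed
    then have bd: "bdd_above (range d)" by (auto simp: bdd_above_def)
    have fds: "set_integrable lebesgue {..x} (\<lambda>y. cmod (f y) * d y)" for x
      by (rule set_integrable_lebesgue[OF fdi]) simp
    have dpos: "0 \<le> d x" for x by (simp add: d_def Dpos)
    have "d X \<le> C * 0"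
      by (rule C(2)[THEN spec, of d, THEN spec, of 0, THEN mp, THEN spec, of X]) (use bd le dpos fds in blast)
    then have "d X \<le> 0" by simp
    then show ?thesis using Dpos[of X] by (simp add: d_def)
  qed
  have "cmod (a y - a' y) = 0 \<and> cmod (b y - b' y) = 0" for y
    using D0[of y] norm_ge_zero[of "a y - a' y"] norm_ge_zero[of "b y - b' y"] unfolding D_def by linarith
  then show "a = a'" "b = b'" by auto
qed

text \<open>Two discretisations solve the integral equation up to small errors, so Gronwall's lemma
  bounds their difference uniformly in \<open>x\<close>. Existence of the solution follows from the
  same estimate, without a fixed-point argument.\<close>

lemma step_a_step_b_uniformly_Cauchy:
  "uniformly_Cauchy_on UNIV (\<lambda>n. step_a n \<xi>)" "uniformly_Cauchy_on UNIV (\<lambda>n. step_b n \<xi>)"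
proof -
  obtain C where C: "C \<ge> 0" "\<forall>d e. 0 \<le> e \<and> (\<forall>x. 0 \<le> d x) \<and> bdd_above (range d) \<and>
     (\<forall>x. set_integrable lebesgue {..x} (\<lambda>y. cmod (f y) * d y)) \<and>
     (\<forall>x. d x \<le> e + (LINT y:{..x}|lebesgue. cmod (f y) * d y)) \<longrightarrow> (\<forall>x. d x \<le> C * e)"
    using gronwall_f by (elim exE conjE) (rule that)
  have main: "\<exists>N. \<forall>m\<ge>N. \<forall>n\<ge>N. \<forall>x. cmod (step_a m \<xi> x - step_a n \<xi> x) + cmod (step_b m \<xi> x - step_b n \<xi> x) < \<epsilon>" if \<epsilon>: "\<epsilon> > 0" for \<epsilon>
  proof -
    \<comment> \<open>Two approximate solutions with two components each leave a total defect of
      \<open>4 e\<close>, which Gronwall's lemma multiplies by \<open>C\<close>.\<close>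
    define e where "e = \<epsilon> / (8 * (C + 1))"
    have e: "e > 0" using \<epsilon> C(1) by (simp add: e_def)
    have Ce: "C * (4 * e) < \<epsilon>"
    proof -
      have J: "J * (8 * (\<epsilon> / (8 * J))) = \<epsilon>" if "J \<noteq> 0" for J using that by simp
      have "(C + 1) * (8 * e) = \<epsilon>" unfolding e_def by (rule J) (use C(1) in linarith)
      moreover have "C * (4 * e) \<le> (C + 1) * (4 * e)" using e by (intro mult_right_mono) auto
      moreover have "0 < (C + 1) * (4 * e)" using e C(1) by simp
      ultimately show ?thesis by linarith
    qed
    obtain N where N: "\<And>n. n \<ge> N \<Longrightarrow> (\<forall>x. cmod (step_a n \<xi> x - 1 - (LINT y:{..x}|lebesgue. coeff_a \<xi> y * step_b n \<xi> y)) \<le> e \<and>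
     cmod (step_b n \<xi> x - (LINT y:{..x}|lebesgue. coeff_b \<xi> y * step_a n \<xi> y)) \<le> e) \<and> (\<forall>j. cmod (cell_int f n j) \<le> 1 / 2)"
      using approx_solution[OF e, of \<xi>] unfolding eventually_sequentially by blast
    have "cmod (step_a m \<xi> x - step_a n \<xi> x) + cmod (step_b m \<xi> x - step_b n \<xi> x) < \<epsilon>" if mn: "m \<ge> N" "n \<ge> N" for m n x
    proof -
      define d where "d x = cmod (step_a m \<xi> x - step_a n \<xi> x) + cmod (step_b m \<xi> x - step_b n \<xi> x)" for x
      have bnd: "cmod (step_a k \<xi> x) \<le> growth" "cmod (step_b k \<xi> x) \<le> growth" if "k \<ge> N" for k x
        using disc_a_disc_b_bound[of k] N[OF that] by (simp_all add: step_a_def step_b_def)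
      have sia: "set_integrable lebesgue {..x} (\<lambda>y. coeff_b \<xi> y * step_a k \<xi> y)"
        and sib: "set_integrable lebesgue {..x} (\<lambda>y. coeff_a \<xi> y * step_b k \<xi> y)" if "k \<ge> N" for k x
        using q_mult_int(2)[OF step_a_step_b_meas(1) bnd(1)[OF that], of \<xi>] q_mult_int(1)[OF step_a_step_b_meas(2) bnd(2)[OF that], of \<xi>]
        by (auto intro!: set_integrable_lebesgue)
      have eq: "cmod (f y) * d y = cmod (f y) * cmod (step_b m \<xi> y - step_b n \<xi> y) + cmod (f y) * cmod (step_a m \<xi> y - step_a n \<xi> y)" for y
        by (simp add: d_def algebra_simps)
      have di: "set_integrable lebesgue {..x} (\<lambda>y. cmod (f y) * d y)"
        and dle: "d x \<le> 4 * e + (LINT y:{..x}|lebesgue. cmod (f y) * d y)" for x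
      proof -
        note A = set_integral_diff_mult_le[where q = "coeff_a \<xi>", OF cmod_q(1) sib[OF mn(1), of x] sib[OF mn(2), of x]]
        note B = set_integral_diff_mult_le[where q = "coeff_b \<xi>", OF cmod_q(2) sia[OF mn(1), of x] sia[OF mn(2), of x]]
        show "set_integrable lebesgue {..x} (\<lambda>y. cmod (f y) * d y)"
          unfolding eq by (rule set_integral_add(1)[OF A(2) B(2)])
        have tri: "cmod (p - p') \<le> 2 * e + cmod (r - r')" if "cmod (p - s - r) \<le> e" "cmod (p' - s - r') \<le> e" for p p' r r' s
        proof -
          have "cmod (p - p') = cmod ((p - s - r) - (p' - s - r') + (r - r'))" by simp
          then have "cmod (p - p') \<le> cmod (p - s - r) + cmod (p' - s - r') + cmod (r - r')"
            using norm_triangle_ineq[of "(p - s - r) - (p' - s - r')" "r - r'"] norm_triangle_ineq4[of "p - s - r" "p' - s - r'"] by linarith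
          then show ?thesis using that by linarith
        qed
        have 1: "cmod (step_a m \<xi> x - step_a n \<xi> x) \<le> 2 * e + (LINT y:{..x}|lebesgue. cmod (f y) * cmod (step_b m \<xi> y - step_b n \<xi> y))"
        proof -
          have "cmod (step_a k \<xi> x - 1 - (LINT y:{..x}|lebesgue. coeff_a \<xi> y * step_b k \<xi> y)) \<le> e" if "k \<ge> N" for k
            using N[OF that] by blast
          from tri[OF this[OF mn(1)] this[OF mn(2)]] show ?thesis using A(1) by linarith
        qed
        have 2: "cmod (step_b m \<xi> x - step_b n \<xi> x) \<le> 2 * e + (LINT y:{..x}|lebesgue. cmod (f y) * cmod (step_a m \<xi> y - step_a n \<xi> y))"
        proof -
          have "cmod (step_b k \<xi> x - 0 - (LINT y:{..x}|lebesgue. coeff_b \<xi> y * step_a k \<xi> y)) \<le> e" if "k \<ge> N" for k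
            using N[OF that] by simp
          from tri[OF this[OF mn(1)] this[OF mn(2)]] show ?thesis using B(1) by linarith
        qed
        show "d x \<le> 4 * e + (LINT y:{..x}|lebesgue. cmod (f y) * d y)"
          unfolding eq set_integral_add(2)[OF A(2) B(2)] using 1 2 by (simp add: d_def)
      qed
      have "d x \<le> 4 * growth" for x
      proof -
        have "d x \<le> (cmod (step_a m \<xi> x) + cmod (step_a n \<xi> x)) + (cmod (step_b m \<xi> x) + cmod (step_b n \<xi> x))"
          unfolding d_def by (intro add_mono norm_triangle_ineq4)
        then show ?thesis using bnd(1)[OF mn(1), of x] bnd(1)[OF mn(2), of x] bnd(2)[OF mn(1), of x] bnd(2)[OF mn(2), of x] by linarith
      qed
      then have "bdd_above (range d)" by (auto simp: bdd_above_def)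
      moreover have "0 \<le> 4 * e" "\<forall>x. 0 \<le> d x" using e by (auto simp: d_def)
      ultimately have "d x \<le> C * (4 * e)"
        using di dle by (intro C(2)[THEN spec, of d, THEN spec, of "4 * e", THEN mp, THEN spec, of x]) blast
      then show ?thesis using Ce unfolding d_def by (rule le_less_trans)
    qed
    then show ?thesis by blast
  qed
  show "uniformly_Cauchy_on UNIV (\<lambda>n. step_a n \<xi>)"
    unfolding uniformly_Cauchy_on_def dist_norm
  proof (intro allI impI)
    fix \<epsilon> :: real assume "\<epsilon> > 0"
    from main[OF this] obtain N where N: "\<And>m n x. m \<ge> N \<Longrightarrow> n \<ge> N \<Longrightarrow> cmod (step_a m \<xi> x - step_a n \<xi> x) + cmod (step_b m \<xi> x - step_b n \<xi> x) < \<epsilon>" by blast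
    have "cmod (step_a m \<xi> x - step_a n \<xi> x) < \<epsilon>" if "m \<ge> N" "n \<ge> N" for m n x
      using N[OF that, of x] norm_ge_zero[of "step_b m \<xi> x - step_b n \<xi> x"] by linarith
    then show "\<exists>M. \<forall>x\<in>UNIV. \<forall>m\<ge>M. \<forall>n\<ge>M. cmod (step_a m \<xi> x - step_a n \<xi> x) < \<epsilon>" by blast
  qed
  show "uniformly_Cauchy_on UNIV (\<lambda>n. step_b n \<xi>)"
    unfolding uniformly_Cauchy_on_def dist_norm
  proof (intro allI impI)
    fix \<epsilon> :: real assume "\<epsilon> > 0"
    from main[OF this] obtain N where N: "\<And>m n x. m \<ge> N \<Longrightarrow> n \<ge> N \<Longrightarrow> cmod (step_a m \<xi> x - step_a n \<xi> x) + cmod (step_b m \<xi> x - step_b n \<xi> x) < \<epsilon>" by blast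
    have "cmod (step_b m \<xi> x - step_b n \<xi> x) < \<epsilon>" if "m \<ge> N" "n \<ge> N" for m n x
      using N[OF that, of x] norm_ge_zero[of "step_a m \<xi> x - step_a n \<xi> x"] by linarith
    then show "\<exists>M. \<forall>x\<in>UNIV. \<forall>m\<ge>M. \<forall>n\<ge>M. cmod (step_b m \<xi> x - step_b n \<xi> x) < \<epsilon>" by blast
  qed
qed

text \<open>The uniform limit of the step functions is a solution, and uniqueness lets the
  description in \<open>dirac_sol\<close> be evaluated. Right of the window a step function equals
  its last grid value, so uniform convergence permits exchanging the limits \<open>x\<close> to
  infinity and \<open>n\<close> to infinity.\<close>

lemma scat_a_limit: "(\<lambda>n. disc_a (samples f n \<xi>) (ncell n)) \<longlonglongrightarrow> scat_a f \<xi>"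
proof -
  obtain a where a: "uniform_limit UNIV (\<lambda>n. step_a n \<xi>) a sequentially"
    using Cauchy_uniformly_convergent[OF step_a_step_b_uniformly_Cauchy(1)] unfolding uniformly_convergent_on_def by blast
  obtain b where b: "uniform_limit UNIV (\<lambda>n. step_b n \<xi>) b sequentially"
    using Cauchy_uniformly_convergent[OF step_a_step_b_uniformly_Cauchy(2)] unfolding uniformly_convergent_on_def by blast
  have al: "(\<lambda>n. step_a n \<xi> x) \<longlonglongrightarrow> a x" and bl: "(\<lambda>n. step_b n \<xi> x) \<longlonglongrightarrow> b x" for x
    using tendsto_uniform_limitI[OF a, of x] tendsto_uniform_limitI[OF b, of x] by auto
  have am: "a \<in> borel_measurable lebesgue"
    by (rule borel_measurable_LIMSEQ_metric[OF step_a_step_b_meas(1) al])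
  have bm: "b \<in> borel_measurable lebesgue"
    by (rule borel_measurable_LIMSEQ_metric[OF step_a_step_b_meas(2) bl])
  have "\<forall>\<^sub>F n in sequentially. \<forall>j. cmod (cell_int f n j) \<le> 1 / 2"
    using eventually_cell_int_small[of "1/2"] by simp
  then have ev: "\<forall>\<^sub>F n in sequentially. \<forall>x. cmod (step_a n \<xi> x) \<le> growth \<and> cmod (step_b n \<xi> x) \<le> growth"
    by (rule eventually_mono) (auto simp: step_a_def step_b_def intro!: disc_a_disc_b_bound)
  have aE: "cmod (a x) \<le> growth" and bE: "cmod (b x) \<le> growth" for x
    using ev by (auto intro!: Lim_norm_ubound[OF sequentially_bot al] Lim_norm_ubound[OF sequentially_bot bl] elim: eventually_mono)
  have lim: "(\<lambda>n. LINT y:{..x}|lebesgue. q y * v n y) \<longlonglongrightarrow> (LINT y:{..x}|lebesgue. q y * w y)"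
    if q: "integrable lebesgue q" and m: "\<And>n. v n \<in> borel_measurable lebesgue" "w \<in> borel_measurable lebesgue"
      and l: "\<And>y. (\<lambda>n. v n y) \<longlonglongrightarrow> w y" and e: "\<forall>\<^sub>F n in sequentially. \<forall>x. cmod (v n x) \<le> growth"
    for q :: "real \<Rightarrow> complex" and v w x
  proof -
    \<comment> \<open>The bound by \<open>growth\<close> holds only for large \<open>n\<close>, so
      dominated convergence is applied to the shifted sequence.\<close>
    obtain N where N: "\<And>n x. n \<ge> N \<Longrightarrow> cmod (v n x) \<le> growth" using e unfolding eventually_sequentially by blast
    have "(\<lambda>n. LINT y:{..x}|lebesgue. q y * v (n + N) y) \<longlonglongrightarrow> (LINT y:{..x}|lebesgue. q y * w y)"
      unfolding set_lebesgue_integral_def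
    proof (rule integral_dominated_convergence[where w = "\<lambda>y. growth * cmod (q y)"])
      have [measurable]: "q \<in> borel_measurable lebesgue" using q by auto
      note m [measurable]
      have [measurable]: "{..x} \<in> sets lebesgue" by simp
      show "(\<lambda>y. indicat_real {..x} y *\<^sub>R (q y * w y)) \<in> borel_measurable lebesgue" by measurable
      show "(\<lambda>y. indicat_real {..x} y *\<^sub>R (q y * v (n + N) y)) \<in> borel_measurable lebesgue" for n by measurable
      show "AE y in lebesgue. (\<lambda>n. indicat_real {..x} y *\<^sub>R (q y * v (n + N) y)) \<longlonglongrightarrow> indicat_real {..x} y *\<^sub>R (q y * w y)"
        by (intro AE_I2 tendsto_intros LIMSEQ_ignore_initial_segment l)
      show "AE y in lebesgue. norm (indicat_real {..x} y *\<^sub>R (q y * v (n + N) y)) \<le> growth * cmod (q y)" for n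
      proof (rule AE_I2)
        fix y
        have "cmod (q y) * cmod (v (n + N) y) \<le> cmod (q y) * growth" by (intro mult_left_mono N) auto
        moreover have "0 \<le> growth * cmod (q y)" by (simp add: growth_def)
        ultimately show "norm (indicat_real {..x} y *\<^sub>R (q y * v (n + N) y)) \<le> growth * cmod (q y)"
          by (simp add: norm_mult indicator_def mult.commute)
      qed
    qed (use q in simp)
    then show ?thesis by (rule LIMSEQ_offset)
  qed
  have err: "(\<lambda>n. step_a n \<xi> x - 1 - (LINT y:{..x}|lebesgue. coeff_a \<xi> y * step_b n \<xi> y)) \<longlonglongrightarrow> 0"
    "(\<lambda>n. step_b n \<xi> x - (LINT y:{..x}|lebesgue. coeff_b \<xi> y * step_a n \<xi> y)) \<longlonglongrightarrow> 0" for x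
  proof -
    have ev': "\<forall>\<^sub>F n in sequentially. cmod (step_a n \<xi> x - 1 - (LINT y:{..x}|lebesgue. coeff_a \<xi> y * step_b n \<xi> y)) < e \<and> cmod (step_b n \<xi> x - (LINT y:{..x}|lebesgue. coeff_b \<xi> y * step_a n \<xi> y)) < e"
      if "e > 0" for e
    proof -
      have "e / 2 > 0" using that by simp
      from approx_solution[OF this, of \<xi>] show ?thesis
      proof eventually_elim
        case (elim n)
        then have "cmod (step_a n \<xi> x - 1 - (LINT y:{..x}|lebesgue. coeff_a \<xi> y * step_b n \<xi> y)) \<le> e / 2"
          "cmod (step_b n \<xi> x - (LINT y:{..x}|lebesgue. coeff_b \<xi> y * step_a n \<xi> y)) \<le> e / 2" by blast+
        then show ?case using that by linarith
      qed
    qed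
    show "(\<lambda>n. step_a n \<xi> x - 1 - (LINT y:{..x}|lebesgue. coeff_a \<xi> y * step_b n \<xi> y)) \<longlonglongrightarrow> 0"
    proof (rule tendstoI)
      fix e :: real assume "0 < e"
      from ev'[OF this] show "\<forall>\<^sub>F n in sequentially. dist (step_a n \<xi> x - 1 - (LINT y:{..x}|lebesgue. coeff_a \<xi> y * step_b n \<xi> y)) 0 < e"
        unfolding dist_norm diff_0_right by (rule eventually_mono) blast
    qed
    show "(\<lambda>n. step_b n \<xi> x - (LINT y:{..x}|lebesgue. coeff_b \<xi> y * step_a n \<xi> y)) \<longlonglongrightarrow> 0"
    proof (rule tendstoI)
      fix e :: real assume "0 < e"
      from ev'[OF this] show "\<forall>\<^sub>F n in sequentially. dist (step_b n \<xi> x - (LINT y:{..x}|lebesgue. coeff_b \<xi> y * step_a n \<xi> y)) 0 < e"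
        unfolding dist_norm diff_0_right by (rule eventually_mono) blast
    qed
  qed
  have "dirac_solution f \<xi> a b"
    unfolding dirac_solution_iff
  proof (intro allI conjI)
    fix x
    show "set_integrable lebesgue {..x} (\<lambda>y. coeff_a \<xi> y * b y)"
      by (rule set_integrable_lebesgue[OF q_mult_int(1)[OF bm bE]]) simp
    show "set_integrable lebesgue {..x} (\<lambda>y. coeff_b \<xi> y * a y)"
      by (rule set_integrable_lebesgue[OF q_mult_int(2)[OF am aE]]) simp
    have "(\<lambda>n. step_a n \<xi> x - 1 - (LINT y:{..x}|lebesgue. coeff_a \<xi> y * step_b n \<xi> y)) \<longlonglongrightarrow> a x - 1 - (LINT y:{..x}|lebesgue. coeff_a \<xi> y * b y)"
      by (intro tendsto_diff al tendsto_const lim[OF q_int(1) step_a_step_b_meas(2) bm bl] eventually_mono[OF ev]; blast)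
    from LIMSEQ_unique[OF this err(1)] show "a x = 1 + (LINT y:{..x}|lebesgue. coeff_a \<xi> y * b y)" by (simp add: algebra_simps)
    have "(\<lambda>n. step_b n \<xi> x - (LINT y:{..x}|lebesgue. coeff_b \<xi> y * step_a n \<xi> y)) \<longlonglongrightarrow> b x - (LINT y:{..x}|lebesgue. coeff_b \<xi> y * a y)"
      by (intro tendsto_diff bl lim[OF q_int(2) step_a_step_b_meas(1) am al] eventually_mono[OF ev]; blast)
    from LIMSEQ_unique[OF this err(2)] show "b x = (LINT y:{..x}|lebesgue. coeff_b \<xi> y * a y)" by simp
  qed
  note sol = this
  have "dirac_sol f \<xi> = (a, b)"
    unfolding dirac_sol_def
  proof (rule the_equality)
    show "dirac_solution f \<xi> (fst (a, b)) (snd (a, b))" using sol by simp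
    fix ab assume "dirac_solution f \<xi> (fst ab) (snd ab)"
    from dirac_solution_unique[OF this sol] show "ab = (a, b)" by (rule prod_eqI[where q = "(a, b)", unfolded fst_conv snd_conv])
  qed
  then have sa: "scat_a f \<xi> = Lim at_top a" by (simp add: scat_a_def)
  have vN: "step_a n \<xi> x = disc_a (samples f n \<xi>) (ncell n)" if "x \<ge> real (Suc n)" for n x
  proof -
    have "real (ncell n) \<le> (x + real (Suc n)) * real (Suc n)"
      using that unfolding node_le_iff[symmetric] node_ncell .
    then have "int (ncell n) \<le> \<lfloor>(x + real (Suc n)) * real (Suc n)\<rfloor>" by (simp only: le_floor_iff of_int_of_nat_eq)
    then have "idx n x = ncell n" unfolding idx_def by simp
    then show ?thesis by (simp add: step_a_def)
  qed
  define \<alpha> where "\<alpha> n = disc_a (samples f n \<xi>) (ncell n)" for n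
  have "Cauchy \<alpha>"
    unfolding Cauchy_def
  proof (intro allI impI)
    fix \<epsilon> :: real assume "\<epsilon> > 0"
    then obtain M where M: "\<And>x m n. m \<ge> M \<Longrightarrow> n \<ge> M \<Longrightarrow> dist (step_a m \<xi> x) (step_a n \<xi> x) < \<epsilon>"
      using step_a_step_b_uniformly_Cauchy(1)[of \<xi>] unfolding uniformly_Cauchy_on_def by blast
    have "dist (\<alpha> m) (\<alpha> n) < \<epsilon>" if "m \<ge> M" "n \<ge> M" for m n
      using M[OF that, of "max (real (Suc m)) (real (Suc n))"] vN by (simp add: \<alpha>_def)
    then show "\<exists>M. \<forall>m\<ge>M. \<forall>n\<ge>M. dist (\<alpha> m) (\<alpha> n) < \<epsilon>" by blast
  qed
  then obtain l where l: "\<alpha> \<longlonglongrightarrow> l" using Cauchy_convergent convergent_def by blast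
  have "(a \<longlongrightarrow> l) at_top"
  proof (rule tendstoI)
    fix \<epsilon> :: real assume "\<epsilon> > 0"
    then have e2: "\<epsilon> / 2 > 0" by simp
    have "\<forall>\<^sub>F n in sequentially. (\<forall>x\<in>UNIV. dist (step_a n \<xi> x) (a x) < \<epsilon> / 2) \<and> dist (\<alpha> n) l < \<epsilon> / 2"
      using uniform_limitD[OF a e2] tendstoD[OF l e2] by (rule eventually_conj)
    then obtain n where n: "\<And>x. dist (step_a n \<xi> x) (a x) < \<epsilon> / 2" "dist (\<alpha> n) l < \<epsilon> / 2"
      unfolding eventually_sequentially by auto
    show "\<forall>\<^sub>F x in at_top. dist (a x) l < \<epsilon>"
      using eventually_ge_at_top[of "real (Suc n)"]
    proof eventually_elim
      case (elim x)
      have "dist (a x) (\<alpha> n) < \<epsilon> / 2" using n(1)[of x] vN[OF elim] by (simp add: \<alpha>_def dist_commute)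
      then show ?case using n(2) dist_triangle[of "a x" l "\<alpha> n"] by linarith
    qed
  qed
  then have "Lim at_top a = l" by (intro tendsto_Lim) auto
  then show ?thesis using l sa unfolding \<alpha>_def by simp
qed

end

section \<open>The inequality\<close>

lemma emeasure_cell: "emeasure lebesgue (cell n j) = ennreal (1 / real (Suc n))"
  unfolding cell_def node_Suc by simp

lemma integrable_indicator_cell: "integrable lebesgue (indicat_real (cell n j))"
  by (rule integrable_real_indicator[OF cell_meas]) (simp add: emeasure_cell)

lemma set_integral_const_cell: "(LINT y:cell n j|lebesgue. (c::real)) = c / real (Suc n)"
  unfolding set_lebesgue_integral_def using integrable_indicator_cell[of n j]
  by (simp add: measure_def emeasure_cell)

text \<open>The tangent line of the convex power function at \<open>M\<close>, obtained from Young's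
  inequality.\<close>

lemma powr_tangent:
  fixes a M p :: real
  assumes "1 < p" "0 \<le> a" "0 \<le> M"
  shows "p * (M powr (p - 1) * a) \<le> a powr p + (p - 1) * M powr p"
proof -
  have "1 < p / (p - 1)" "1 / p + 1 / (p / (p - 1)) = 1" using assms by (auto simp: field_simps)
  then have "a * M powr (p - 1) \<le> a powr p / p + (M powr (p - 1)) powr (p / (p - 1)) / (p / (p - 1))"
    using assms by (intro Youngs_inequality) auto
  also have "(M powr (p - 1)) powr (p / (p - 1)) = M powr p"
    unfolding powr_powr using assms by simp
  finally have "p * (a * M powr (p - 1)) \<le> p * (a powr p / p + M powr p / (p / (p - 1)))"
    using assms by (intro mult_left_mono) auto
  also have "\<dots> = a powr p + (p - 1) * M powr p" using assms by (simp add: distrib_left)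
  finally show ?thesis by (simp add: mult_ac)
qed

text \<open>The tangent inequality at the cell mean \<open>M\<close> of \<open>|f|\<close>,
  integrated over the cell. The cell has length \<open>1 / (n + 1)\<close>, whence the factor with
  exponent \<open>p - 1\<close>.\<close>

lemma cell_Jensen:
  fixes f :: "real \<Rightarrow> complex"
  assumes f: "integrable lebesgue f" and fp: "integrable lebesgue (\<lambda>y. cmod (f y) powr p)" and p: "1 < p"
  shows "real (Suc n) powr (p - 1) * cmod (cell_int f n j) powr p \<le> (LINT y:cell n j|lebesgue. cmod (f y) powr p)"
proof -
  define m where "m = real (Suc n)"
  have m: "m > 0" by (simp add: m_def)
  define A where "A = (LINT y:cell n j|lebesgue. cmod (f y))"
  have A: "0 \<le> A" "cmod (cell_int f n j) \<le> A"
    using cmod_cell_int[OF f, of n j] norm_ge_zero order_trans unfolding A_def by blast+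
  define M where "M = m * A"
  have M: "0 \<le> M" using A m by (simp add: M_def)
  have integrable_cmod: "integrable lebesgue (\<lambda>y. cmod (f y))" using f by simp
  have "(LINT y:cell n j|lebesgue. p * M powr (p - 1) * cmod (f y)) \<le> (LINT y:cell n j|lebesgue. cmod (f y) powr p + (p - 1) * M powr p)"
  proof (rule set_integral_mono)
    show "set_integrable lebesgue (cell n j) (\<lambda>y. p * M powr (p - 1) * cmod (f y))"
      using integrable_cmod by (intro set_integrable_lebesgue cell_meas) simp
    show "set_integrable lebesgue (cell n j) (\<lambda>y. cmod (f y) powr p + (p - 1) * M powr p)"
      using set_integrable_lebesgue[OF fp cell_meas] integrable_indicator_cell
      by (intro set_integral_add) (simp_all add: set_integrable_def)
    show "p * M powr (p - 1) * cmod (f y) \<le> cmod (f y) powr p + (p - 1) * M powr p" for y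
      using powr_tangent[OF p norm_ge_zero M, of "f y"] by (simp add: mult_ac)
  qed
  also have "\<dots> = (LINT y:cell n j|lebesgue. cmod (f y) powr p) + (LINT y:cell n j|lebesgue. (p - 1) * M powr p)"
    using set_integrable_lebesgue[OF fp cell_meas] integrable_indicator_cell
    by (intro set_integral_add(2)) (simp_all add: set_integrable_def)
  also have "(LINT y:cell n j|lebesgue. (p - 1) * M powr p) = (p - 1) * M powr p / m"
    unfolding m_def by (rule set_integral_const_cell)
  also have "(LINT y:cell n j|lebesgue. p * M powr (p - 1) * cmod (f y)) = p * M powr (p - 1) * A"
    unfolding A_def by (rule set_integral_mult_right)
  also have "p * M powr (p - 1) * A = p * M powr p / m"
  proof (cases "M = 0")
    case True then show ?thesis using m by (simp add: M_def)
  next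
    case False
    then have "M powr p = M powr (p - 1) * M" using M powr_add[of M "p - 1" 1] by simp
    then show ?thesis using m by (simp add: M_def)
  qed
  finally have "p * M powr p / m \<le> (LINT y:cell n j|lebesgue. cmod (f y) powr p) + (p - 1) * M powr p / m" .
  then have "M powr p / m \<le> (LINT y:cell n j|lebesgue. cmod (f y) powr p)"
    by (simp add: left_diff_distrib diff_divide_distrib)
  moreover have "M powr p / m = m powr (p - 1) * A powr p"
  proof -
    have "m powr p = m powr (p - 1) * m" using m powr_add[of m "p - 1" 1] by simp
    then show ?thesis using m A by (simp add: M_def powr_mult)
  qed
  moreover have "m powr (p - 1) * cmod (cell_int f n j) powr p \<le> m powr (p - 1) * A powr p"
    using A p by (intro mult_left_mono powr_mono2) auto
  ultimately show ?thesis unfolding m_def by linarith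
qed

lemma sum_cell_Jensen:
  fixes f :: "real \<Rightarrow> complex"
  assumes f: "integrable lebesgue f" and fp: "integrable lebesgue (\<lambda>y. cmod (f y) powr p)" and p: "1 < p"
  shows "real (Suc n) powr (p - 1) * (\<Sum>j<N. cmod (cell_int f n j) powr p) \<le> (\<integral>y. cmod (f y) powr p \<partial>lebesgue)"
proof -
  have "real (Suc n) powr (p - 1) * (\<Sum>j<N. cmod (cell_int f n j) powr p) \<le> (\<Sum>j<N. LINT y:cell n j|lebesgue. cmod (f y) powr p)"
    unfolding sum_distrib_left by (intro sum_mono cell_Jensen assms)
  also have "\<dots> \<le> (\<integral>y. cmod (f y) powr p \<partial>lebesgue)" by (rule sum_cells[OF f fp]) simp
  finally show ?thesis .
qed

lemma nn_integral_period_scale: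
  fixes g :: "real \<Rightarrow> ennreal"
  assumes g: "g \<in> borel_measurable borel" and m: "m > 0"
  shows "(\<integral>\<^sup>+\<xi>. g (\<xi> / m) * indicator {- m / 2..m / 2} \<xi> \<partial>lebesgue) = ennreal m * (\<integral>\<^sup>+t. g t \<partial>period)"
proof -
  note g [measurable]
  have "(\<integral>\<^sup>+\<xi>. g (\<xi> / m) * indicator {- m / 2..m / 2} \<xi> \<partial>lebesgue) = (\<integral>\<^sup>+\<xi>. g (\<xi> / m) * indicator {- m / 2..m / 2} \<xi> \<partial>lborel)"
    by (rule nn_integral_completion)
  also have "\<dots> = \<bar>m\<bar> * (\<integral>\<^sup>+t. g ((0 + m * t) / m) * indicator {- m / 2..m / 2} (0 + m * t) \<partial>lborel)"
    using m by (intro nn_integral_real_affine) auto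
  also have "(\<integral>\<^sup>+t. g ((0 + m * t) / m) * indicator {- m / 2..m / 2} (0 + m * t) \<partial>lborel) = (\<integral>\<^sup>+t. g t * indicator {-1/2..1/2} t \<partial>lborel)"
  proof (intro nn_integral_cong)
    fix t
    have "m * t \<in> {- m / 2..m / 2} \<longleftrightarrow> t \<in> {-1/2..1/2}"
    proof -
      have "- m / 2 \<le> m * t \<longleftrightarrow> m * (-1/2) \<le> m * t" "m * t \<le> m / 2 \<longleftrightarrow> m * t \<le> m * (1/2)" by simp_all
      then show ?thesis using m by (simp only: atLeastAtMost_iff mult_le_cancel_left_pos)
    qed
    then show "g ((0 + m * t) / m) * indicator {- m / 2..m / 2} (0 + m * t) = g t * indicator {-1/2..1/2} t"
      using m by (simp add: indicator_def)
  qed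
  also have "\<dots> = (\<integral>\<^sup>+t. g t \<partial>period)" unfolding period_def by (subst nn_integral_restrict_space) simp_all
  finally show ?thesis using m by simp
qed

context
  fixes f :: "real \<Rightarrow> complex"
  assumes f: "integrable lebesgue f"
begin

definition "mass = (\<integral>y. cmod (f y) \<partial>lebesgue)"

lemma mass_nonneg: "0 \<le> mass" by (simp add: mass_def)

definition "grid_log n \<xi> = disc_log (samples f n \<xi>) (ncell n)"

text \<open>The kernel is built from \<open>f\<close> while \<open>h\<close> is free, so the
  operator is linear in \<open>h\<close>. At \<open>h = cell_int f n\<close> its modulus bounds
  \<open>sqrt (grid_log n \<xi>)\<close> up to a vanishing error.\<close>

definition "line_op n h \<xi> = (\<Sum>j<ncell n. h j * (phase ((Suc n)\<^sup>2) j (\<xi> / real (Suc n)) * disc_ker (samples f n \<xi>) (ncell n) j))"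

definition "sq_sum n = (\<Sum>j<ncell n. (cmod (cell_int f n j))\<^sup>2)"

lemma sq_sum_le: "(\<forall>j. cmod (cell_int f n j) \<le> \<delta>) \<Longrightarrow> sq_sum n \<le> \<delta> * mass"
proof -
  assume d: "\<forall>j. cmod (cell_int f n j) \<le> \<delta>"
  have "sq_sum n \<le> (\<Sum>j<ncell n. \<delta> * cmod (cell_int f n j))"
    unfolding sq_sum_def power2_eq_square using d by (intro sum_mono mult_right_mono) auto
  also have "\<dots> = \<delta> * (\<Sum>j<ncell n. cmod (samples f n 0 j))"
    by (simp add: sum_distrib_left cmod_samples[OF f])
  also have "\<dots> \<le> \<delta> * mass"
    unfolding mass_def using sum_cmod_samples[OF f] d norm_ge_zero order_trans by (intro mult_left_mono) blast+
  finally show ?thesis .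
qed

lemma grid_log_bounds:
  assumes "\<And>j. cmod (cell_int f n j) \<le> 1 / 2"
  shows "0 \<le> grid_log n \<xi>" "grid_log n \<xi> \<le> 4 * mass"
proof -
  have F: "cmod (samples f n \<xi> j) < 1" for j using assms[of j] by (simp add: cmod_samples[OF f])
  show "0 \<le> grid_log n \<xi>" unfolding grid_log_def by (rule disc_log_nonneg[OF F])
  have "cmod (disc_a (samples f n \<xi>) (ncell n)) \<le> exp (2 * mass)"
    using disc_a_disc_b_bound(1)[OF f assms, of \<xi> "ncell n"] unfolding growth_def[OF f] mass_def .
  moreover have "0 < cmod (disc_a (samples f n \<xi>) (ncell n))" using disc_a_nz[OF F] by simp
  ultimately have "ln (cmod (disc_a (samples f n \<xi>) (ncell n))) \<le> 2 * mass" by (metis exp_gt_zero ln_exp ln_le_cancel_iff)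
  then show "grid_log n \<xi> \<le> 4 * mass"
    using disc_a_nz[OF F] by (simp add: grid_log_def disc_log_def ln_realpow)
qed

lemma line_op_samples: "line_op n (cell_int f n) \<xi> = (\<Sum>j<ncell n. samples f n \<xi> j * disc_ker (samples f n \<xi>) (ncell n) j)"
  by (simp add: line_op_def samples_def mult.assoc)

text \<open>The factor \<open>2 + 20 U\<close> of \<open>sqrt_disc_log_le\<close> at the uniform
  bound \<open>grid_log n \<xi> \<le> 4 mass\<close>.\<close>

definition "err_const = 2 + 20 * sqrt (4 * mass)"

lemma sqrt_grid_log_le:
  "\<forall>\<^sub>F n in sequentially. (\<forall>j. cmod (cell_int f n j) \<le> 1 / 2) \<and> (\<forall>\<xi>. sqrt (grid_log n \<xi>) \<le> cmod (line_op n (cell_int f n) \<xi>) + sq_sum n * err_const)"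
proof -
  define s where "s = sqrt (4 * mass)"
  have s0: "0 \<le> s" using mass_nonneg by (simp add: s_def)
  \<comment> \<open>The cap \<open>1 / (10 (1 + s))\<close> secures the hypothesis
    \<open>|F j| U \<le> 1/10\<close> of \<open>sqrt_disc_log_le\<close>, because
    \<open>U \<le> s\<close>.\<close>
  define \<delta> where "\<delta> = min (1 / 2) (1 / (10 * (1 + s)))"
  have d1: "0 < 1 / (10 * (1 + s))" using s0 by (intro divide_pos_pos mult_pos_pos add_pos_nonneg) simp_all
  have \<delta>: "\<delta> > 0"
    unfolding \<delta>_def by (rule min_less_iff_conj[THEN iffD2, OF conjI, OF _ d1]) simp
  have \<delta>1: "\<delta> \<le> 1 / 2" unfolding \<delta>_def by (rule min.cobounded1)
  have \<delta>2: "\<delta> * s \<le> 1 / 10"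
  proof -
    have "\<delta> * s \<le> \<delta> * (1 + s)" using \<delta> by (intro mult_left_mono) auto
    also have "\<dots> \<le> 1 / (10 * (1 + s)) * (1 + s)"
      using s0 unfolding \<delta>_def by (intro mult_right_mono min.cobounded2) linarith
    also have "\<dots> = 1 / 10"
    proof -
      have "1 / (10 * J) * J = 1 / 10" if "J \<noteq> 0" for J :: real using that by simp
      from this[of "1 + s"] show ?thesis using s0 by linarith
    qed
    finally show ?thesis .
  qed
  from eventually_cell_int_small[OF f \<delta>] show ?thesis
  proof eventually_elim
    case (elim n)
    have c: "cmod (cell_int f n j) \<le> 1 / 2" for j using elim \<delta>1 order_trans by blast
    have "sqrt (grid_log n \<xi>) \<le> cmod (line_op n (cell_int f n) \<xi>) + sq_sum n * err_const" for \<xi>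
    proof -
      have us: "sqrt (grid_log n \<xi>) \<le> s" unfolding s_def using grid_log_bounds(2)[OF c] by simp
      have "sqrt (disc_log (samples f n \<xi>) (ncell n)) \<le> Re (\<Sum>j<ncell n. samples f n \<xi> j * disc_ker (samples f n \<xi>) (ncell n) j)
         + (\<Sum>j<ncell n. (cmod (samples f n \<xi> j))\<^sup>2) * (2 + 20 * sqrt (disc_log (samples f n \<xi>) (ncell n)))"
      proof (rule sqrt_disc_log_le)
        show "cmod (samples f n \<xi> j) \<le> 1 / 2" for j using c by (simp only: cmod_samples[OF f])
        have "cmod (samples f n \<xi> j) * sqrt (disc_log (samples f n \<xi>) (ncell n)) \<le> \<delta> * s" for j
          unfolding cmod_samples[OF f] using elim us \<delta> grid_log_bounds(1)[OF c] unfolding grid_log_def by (intro mult_mono) auto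
        then show "cmod (samples f n \<xi> j) * sqrt (disc_log (samples f n \<xi>) (ncell n)) \<le> 1 / 10" for j
          using \<delta>2 order_trans by blast
      qed
      then have "sqrt (grid_log n \<xi>) \<le> Re (line_op n (cell_int f n) \<xi>) + sq_sum n * (2 + 20 * sqrt (grid_log n \<xi>))"
        unfolding line_op_samples grid_log_def sq_sum_def cmod_samples[OF f] .
      also have "\<dots> \<le> cmod (line_op n (cell_int f n) \<xi>) + sq_sum n * err_const"
        unfolding err_const_def s_def[symmetric] using us by (intro add_mono complex_Re_le_cmod mult_left_mono) (auto simp: sq_sum_def sum_nonneg)
      finally show ?thesis .
    qed
    then show ?case using c by blast
  qed
qed

text \<open>The sum of squares is at most the largest cell integral times the \<open>L^1\<close>
  norm, and the largest cell integral tends to \<open>0\<close>.\<close>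

lemma sq_sum_tendsto_0: "(\<lambda>n. sq_sum n * err_const) \<longlonglongrightarrow> 0"
proof (rule tendsto_mult_left_zero, rule tendstoI)
  fix e :: real assume e: "e > 0"
  have "e / (2 * (1 + mass)) > 0" using e mass_nonneg by simp
  from eventually_cell_int_small[OF f this] show "\<forall>\<^sub>F n in sequentially. dist (sq_sum n) 0 < e"
  proof eventually_elim
    case (elim n)
    have "sq_sum n \<le> e / (2 * (1 + mass)) * mass" using elim by (rule sq_sum_le)
    also have "\<dots> \<le> e / (2 * (1 + mass)) * (1 + mass)" using e mass_nonneg by (intro mult_left_mono) auto
    also have "\<dots> < e"
    proof -
      have "e / (2 * J) * J < e" if "J > 0" for J using that e by simp
      from this[of "1 + mass"] show ?thesis using mass_nonneg by linarith
    qed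
    finally show ?case by (simp add: sq_sum_def sum_nonneg)
  qed
qed

lemma sqrt_grid_log_tendsto:
  "(\<lambda>n. sqrt (grid_log n \<xi>)) \<longlonglongrightarrow> sqrt (ln ((cmod (scat_a f \<xi>))\<^sup>2))" and scat_a_ge_1: "cmod (scat_a f \<xi>) \<ge> 1"
proof -
  have l: "(\<lambda>n. cmod (disc_a (samples f n \<xi>) (ncell n))) \<longlonglongrightarrow> cmod (scat_a f \<xi>)"
    by (intro tendsto_norm scat_a_limit[OF f])
  have "\<forall>\<^sub>F n in sequentially. \<forall>j. cmod (cell_int f n j) \<le> 1 / 2"
    using eventually_cell_int_small[OF f, of "1/2"] by simp
  then have "\<forall>\<^sub>F n in sequentially. 1 \<le> cmod (disc_a (samples f n \<xi>) (ncell n))"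
  proof eventually_elim
    case (elim n)
    show ?case
    proof (rule cmod_disc_a_ge1)
      show "cmod (samples f n \<xi> j) < 1" for j using elim[rule_format, of j] by (simp add: cmod_samples[OF f])
    qed
  qed
  then show 1: "cmod (scat_a f \<xi>) \<ge> 1" by (intro tendsto_lowerbound[OF l]) auto
  then have "(cmod (scat_a f \<xi>))\<^sup>2 \<noteq> 0" by auto
  then show "(\<lambda>n. sqrt (grid_log n \<xi>)) \<longlonglongrightarrow> sqrt (ln ((cmod (scat_a f \<xi>))\<^sup>2))"
    unfolding grid_log_def disc_log_def by (intro tendsto_intros l)
qed

lemma samples_phase: "samples f n \<xi> = (\<lambda>i. cell_int f n i * phase ((Suc n)\<^sup>2) i (\<xi> / real (Suc n)))"
  by (rule ext) (simp add: samples_def)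

lemma grid_log_meas: 
  assumes "\<And>j. cmod (cell_int f n j) \<le> 1 / 2"
  shows "(\<lambda>t. disc_log (\<lambda>i. cell_int f n i * phase ((Suc n)\<^sup>2) i t) (ncell n)) \<in> borel_measurable borel"
    "grid_log n \<in> borel_measurable borel"
proof -
  have c: "cmod (cell_int f n j) < 1" for j using assms[of j] by simp
  show 1: "(\<lambda>t. disc_log (\<lambda>i. cell_int f n i * phase ((Suc n)\<^sup>2) i t) (ncell n)) \<in> borel_measurable borel"
    by (rule borel_measurable_disc_ker(2)[OF c])
  have "(\<lambda>\<xi>. (\<lambda>t. disc_log (\<lambda>i. cell_int f n i * phase ((Suc n)\<^sup>2) i t) (ncell n)) (\<xi> / real (Suc n))) \<in> borel_measurable borel"
    by (rule measurable_compose[OF _ 1]) simp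
  then show "grid_log n \<in> borel_measurable borel"
    unfolding grid_log_def samples_phase by simp
qed

definition "period_op n h t = (\<Sum>j<ncell n. h j * (phase ((Suc n)\<^sup>2) j t * disc_ker (\<lambda>i. cell_int f n i * phase ((Suc n)\<^sup>2) i t) (ncell n) j))"

lemma line_op_period_op: "line_op n h \<xi> = period_op n h (\<xi> / real (Suc n))"
  unfolding line_op_def period_op_def samples_phase ..

lemma period_op_meas:
  assumes "\<And>j. cmod (cell_int f n j) \<le> 1 / 2"
  shows "period_op n h \<in> borel_measurable borel"
proof -
  have c: "cmod (cell_int f n j) < 1" for j using assms[of j] by simp
  note borel_measurable_disc_ker(1)[OF c, measurable]
  show ?thesis unfolding period_op_def by measurable
qed

lemma kernel_le_1:
  assumes "\<And>j. cmod (cell_int f n j) \<le> 1 / 2"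
  shows "cmod (phase ((Suc n)\<^sup>2) j t * disc_ker (\<lambda>i. cell_int f n i * phase ((Suc n)\<^sup>2) i t) (ncell n) j) \<le> 1"
proof -
  have "cmod (cell_int f n j * phase ((Suc n)\<^sup>2) j t) < 1" for j using assms[of j] by (simp add: norm_mult)
  then show ?thesis using cmod_disc_ker_le_1[of "\<lambda>i. cell_int f n i * phase ((Suc n)\<^sup>2) i t"] by (simp add: norm_mult)
qed

lemma line_op_sup_bound:
  assumes "\<And>j. cmod (cell_int f n j) \<le> 1 / 2"
  shows "cmod (line_op n (cell_int f n) \<xi>) \<le> mass"
proof -
  have "cmod (line_op n (cell_int f n) \<xi>) \<le> (\<Sum>j<ncell n. cmod (samples f n \<xi> j))"
    unfolding line_op_period_op period_op_def
  proof (intro order_trans[OF norm_sum] sum_mono)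
    fix j
    show "cmod (cell_int f n j * (phase ((Suc n)\<^sup>2) j (\<xi> / real (Suc n)) * disc_ker (\<lambda>i. cell_int f n i * phase ((Suc n)\<^sup>2) i (\<xi> / real (Suc n))) (ncell n) j))
      \<le> cmod (samples f n \<xi> j)"
      unfolding norm_mult[of "cell_int f n j"] cmod_samples[OF f]
      by (rule mult_left_le[OF kernel_le_1[OF assms]]) simp
  qed
  then show ?thesis unfolding mass_def using sum_cmod_samples[OF f] order_trans by blast
qed

text \<open>The endpoint \<open>p = 1\<close>, pointwise in \<open>\<xi>\<close>, directly from the
  kernel bound by \<open>1\<close>.\<close>

lemma sqrt_log_a_le_mass: "sqrt (ln ((cmod (scat_a f \<xi>))\<^sup>2)) \<le> mass"
proof (rule LIMSEQ_le)
  show "(\<lambda>n. sqrt (grid_log n \<xi>)) \<longlonglongrightarrow> sqrt (ln ((cmod (scat_a f \<xi>))\<^sup>2))" by (rule sqrt_grid_log_tendsto)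
  have "(\<lambda>n. mass + sq_sum n * err_const) \<longlonglongrightarrow> mass + 0" by (intro tendsto_add tendsto_const sq_sum_tendsto_0)
  then show "(\<lambda>n. mass + sq_sum n * err_const) \<longlonglongrightarrow> mass" by simp
  have "\<forall>\<^sub>F n in sequentially. sqrt (grid_log n \<xi>) \<le> mass + sq_sum n * err_const"
    using sqrt_grid_log_le
  proof eventually_elim
    case (elim n)
    then have "cmod (line_op n (cell_int f n) \<xi>) \<le> mass" by (intro line_op_sup_bound) blast
    then show ?case using elim[THEN conjunct2, rule_format, of \<xi>] by linarith
  qed
  then show "\<exists>N. \<forall>n\<ge>N. sqrt (grid_log n \<xi>) \<le> mass + sq_sum n * err_const" unfolding eventually_sequentially .
qed

lemma scat_log_meas: "(\<lambda>\<xi>. sqrt (ln ((cmod (scat_a f \<xi>))\<^sup>2))) \<in> borel_measurable borel"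
proof -
  obtain N where N: "\<And>n j. n \<ge> N \<Longrightarrow> cmod (cell_int f n j) \<le> 1 / 2"
    using eventually_cell_int_small[OF f, of "1/2"] unfolding eventually_sequentially by auto
  have "(\<lambda>n. sqrt (grid_log (n + N) \<xi>)) \<longlonglongrightarrow> sqrt (ln ((cmod (scat_a f \<xi>))\<^sup>2))" for \<xi>
    by (rule LIMSEQ_ignore_initial_segment[OF sqrt_grid_log_tendsto])
  moreover have "(\<lambda>\<xi>. sqrt (grid_log (n + N) \<xi>)) \<in> borel_measurable borel" for n
    using grid_log_meas(2)[OF N[of "n + N"]] by measurable
  ultimately show ?thesis by (rule borel_measurable_LIMSEQ_metric[rotated])
qed

text \<open>The window is one period of the grid, so \<open>\<xi> = (n + 1) t\<close> carries the
  integral to the circle, where interpolation applies.\<close>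

lemma line_op_Lp_sum:
  assumes c: "\<And>j. cmod (cell_int f n j) \<le> 1 / 2" and p: "1 < p" "p \<le> 2"
  shows "(\<integral>\<^sup>+\<xi>. ennreal (cmod (line_op n h \<xi>) powr (p / (p - 1))) * indicator {- real (Suc n) / 2..real (Suc n) / 2} \<xi> \<partial>lebesgue)
     \<le> ennreal (real (Suc n) * (\<Sum>j<ncell n. cmod (h j) powr p) powr (1 / (p - 1)))"
proof -
  define m where "m = real (Suc n)"
  have m: "m > 0" by (simp add: m_def)
  have c1: "cmod (cell_int f n j) < 1" for j using c[of j] by simp
  have lm: "period_op n h \<in> borel_measurable borel" by (rule period_op_meas[OF c])
  have "(\<integral>\<^sup>+\<xi>. ennreal (cmod (line_op n h \<xi>) powr (p / (p - 1))) * indicator {- m / 2..m / 2} \<xi> \<partial>lebesgue)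
      = ennreal m * (\<integral>\<^sup>+t. ennreal (cmod (period_op n h t) powr (p / (p - 1))) \<partial>period)"
    unfolding line_op_period_op m_def[symmetric] using lm m by (intro nn_integral_period_scale) measurable
  also have "(\<integral>\<^sup>+t. ennreal (cmod (period_op n h t) powr (p / (p - 1))) \<partial>period) \<le> ennreal ((\<Sum>j<ncell n. cmod (h j) powr p) powr (1 / (p - 1)))"
    unfolding period_op_def
  proof (rule kernel_interpolation)
    show "(\<lambda>t. phase ((Suc n)\<^sup>2) j t * disc_ker (\<lambda>i. cell_int f n i * phase ((Suc n)\<^sup>2) i t) (ncell n) j) \<in> borel_measurable period" for j
      by (intro borel_measurable_period borel_measurable_times borel_measurable_phase borel_measurable_disc_ker(1)[OF c1])
    show "(\<integral>t. (cmod (\<Sum>j<ncell n. h j * (phase ((Suc n)\<^sup>2) j t * disc_ker (\<lambda>i. cell_int f n i * phase ((Suc n)\<^sup>2) i t) (ncell n) j)))\<^sup>2 \<partial>period) \<le> (\<Sum>j<ncell n. (cmod (h j))\<^sup>2)" for h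
      by (rule kernel_L2_contraction[OF c1])
  qed (use finite_measure_period kernel_le_1[OF c] p in auto)
  also have "ennreal m * ennreal ((\<Sum>j<ncell n. cmod (h j) powr p) powr (1 / (p - 1))) = ennreal (m * (\<Sum>j<ncell n. cmod (h j) powr p) powr (1 / (p - 1)))"
    using m by (simp add: ennreal_mult)
  finally show ?thesis unfolding m_def by (simp add: mult_left_mono)
qed

text \<open>The Jacobian \<open>n + 1\<close> is the power \<open>1 / (p - 1)\<close> of
  \<open>(n + 1)^(p - 1)\<close>, exactly the factor in \<open>cell_Jensen\<close>. So no constant
  is lost between the \<open>l^p\<close> sum of cell integrals and the \<open>L^p\<close> norm of
  \<open>f\<close>.\<close>

lemma line_op_Lp_bound:
  assumes c: "\<And>j. cmod (cell_int f n j) \<le> 1 / 2" and p: "1 < p" "p \<le> 2"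
    and fp: "integrable lebesgue (\<lambda>y. cmod (f y) powr p)"
  shows "(\<integral>\<^sup>+\<xi>. ennreal (cmod (line_op n (cell_int f n) \<xi>) powr (p / (p - 1))) * indicator {- real (Suc n) / 2..real (Suc n) / 2} \<xi> \<partial>lebesgue)
     \<le> ennreal ((\<integral>y. cmod (f y) powr p \<partial>lebesgue) powr (1 / (p - 1)))"
proof (rule order_trans[OF line_op_Lp_sum[OF c p] ennreal_leI])
  define m where "m = real (Suc n)"
  have m: "m > 0" by (simp add: m_def)
  define S where "S = (\<Sum>j<ncell n. cmod (cell_int f n j) powr p)"
  have S0: "0 \<le> S" by (simp add: S_def sum_nonneg)
  have "m * S powr (1 / (p - 1)) = (m powr (p - 1) * S) powr (1 / (p - 1))"
    using m S0 p by (simp add: powr_mult powr_powr)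
  also have "(m powr (p - 1) * S) powr (1 / (p - 1)) \<le> (\<integral>y. cmod (f y) powr p \<partial>lebesgue) powr (1 / (p - 1))"
    using sum_cell_Jensen[OF f fp p(1), of n "ncell n"] p m S0 unfolding S_def[symmetric] m_def[symmetric]
    by (intro powr_mono2) auto
  finally show "real (Suc n) * (\<Sum>j<ncell n. cmod (cell_int f n j) powr p) powr (1 / (p - 1)) \<le> (\<integral>y. cmod (f y) powr p \<partial>lebesgue) powr (1 / (p - 1))"
    unfolding m_def S_def .
qed

end

section \<open>The energy identity\<close>

definition clip :: "nat \<Rightarrow> complex \<Rightarrow> complex" where
  "clip n z = z / of_real (max 1 (inverse (real n) * cmod z))"

text \<open>For \<open>n \<ge> 1\<close> it is \<open>1\<close> on \<open>[-(n - 1), n - 1]\<close>,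
  vanishes outside \<open>[-n, n]\<close>, and is linear with slope of modulus one in
  between.\<close>

definition tent :: "nat \<Rightarrow> real \<Rightarrow> real" where
  "tent n y = max 0 (min 1 (real n - \<bar>y\<bar>))"

lemma continuous_clip: "continuous_on UNIV (clip n)"
proof -
  have nz: "max 1 r \<noteq> 0" for r :: real by (simp add: max_def)
  show ?thesis unfolding clip_def by (intro continuous_intros) (rule ballI, simp only: of_real_eq_0_iff nz not_False_eq_True)
qed

lemma cmod_clip_le: "n \<ge> 1 \<Longrightarrow> cmod (clip n z) \<le> real n"
  by (auto simp: clip_def norm_divide norm_mult max_def field_simps)

text \<open>The case \<open>n = 0\<close> is covered too: \<open>inverse 0 = 0\<close> makes
  \<open>clip 0\<close> the identity.\<close>

lemma clip_eq: "cmod z \<le> real n \<Longrightarrow> clip n z = z"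
  by (cases "n = 0") (auto simp: clip_def max_def field_simps)

lemma tent_bounds: "0 \<le> tent n y" "tent n y \<le> 1" "\<bar>tent n y - tent n z\<bar> \<le> \<bar>y - z\<bar>"
  by (auto simp: tent_def max_def min_def)

lemma tent_outside: "y \<notin> {- real n..real n} \<Longrightarrow> tent n y = 0"
  by (auto simp: tent_def)

lemma cmod_clip_le_cmod: "cmod (clip n z) \<le> cmod z"
proof -
  define M where "M = max 1 (inverse (real n) * cmod z)"
  have "1 \<le> M" by (simp add: M_def)
  then have "cmod z / M \<le> cmod z / 1" by (intro divide_left_mono) auto
  then show ?thesis using \<open>1 \<le> M\<close> by (simp add: clip_def M_def[symmetric] norm_divide)
qed

lemma tent_meas [measurable]: "tent n \<in> borel_measurable lebesgue"
proof -
  have "tent n \<in> borel_measurable lborel" unfolding tent_def by measurable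
  then show ?thesis by (rule measurable_completion)
qed

lemma of_real_tent_meas [measurable]: "(\<lambda>y. complex_of_real (tent n y)) \<in> borel_measurable lebesgue"
proof -
  have "(\<lambda>y. complex_of_real (tent n y)) \<in> borel_measurable borel"
    unfolding tent_def by (intro borel_measurable_continuous_onI continuous_intros)
  then have "(\<lambda>y. complex_of_real (tent n y)) \<in> borel_measurable lborel" by simp
  then show ?thesis by (rule measurable_completion)
qed

lemma clip_meas [measurable]: "clip n \<in> borel_measurable borel"
  by (intro borel_measurable_continuous_onI continuous_clip)

lemma clip_tent_approx:
  fixes f :: "real \<Rightarrow> complex"
  assumes fm [measurable]: "f \<in> borel_measurable lebesgue" and f2: "integrable lebesgue (\<lambda>y. (cmod (f y))\<^sup>2)" and \<delta>: "\<delta> > 0"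
  shows "\<exists>n\<ge>1. (\<integral>y. (cmod (f y - clip n (f y) * tent n y))\<^sup>2 \<partial>lebesgue) < \<delta>"
proof -
  have "(\<lambda>n. \<integral>y. (cmod (f y - clip n (f y) * tent n y))\<^sup>2 \<partial>lebesgue) \<longlonglongrightarrow> (\<integral>y. 0 \<partial>(lebesgue :: real measure))"
  proof (rule integral_dominated_convergence[where w = "\<lambda>y. 4 * (cmod (f y))\<^sup>2"])
    show "(\<lambda>y. (cmod (f y - clip n (f y) * tent n y))\<^sup>2) \<in> borel_measurable lebesgue" for n
      by measurable
    show "AE y in lebesgue. (\<lambda>n. (cmod (f y - clip n (f y) * tent n y))\<^sup>2) \<longlonglongrightarrow> 0"
    proof (rule AE_I2, rule tendsto_eventually)
      fix y :: real
      obtain N :: nat where N: "real N \<ge> max (cmod (f y)) (\<bar>y\<bar> + 1)" using real_arch_simple by blast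
      show "\<forall>\<^sub>F n in sequentially. (cmod (f y - clip n (f y) * tent n y))\<^sup>2 = 0"
        using eventually_ge_at_top[of N]
      proof eventually_elim
        case (elim n)
        then have "real n \<ge> max (cmod (f y)) (\<bar>y\<bar> + 1)" using N by linarith
        then have "clip n (f y) = f y" "tent n y = 1" by (auto simp: clip_eq tent_def)
        then show ?case by simp
      qed
    qed
    show "AE y in lebesgue. norm ((cmod (f y - clip n (f y) * tent n y))\<^sup>2) \<le> 4 * (cmod (f y))\<^sup>2" for n
    proof (rule AE_I2)
      fix y
      have "cmod (clip n (f y) * tent n y) \<le> cmod (f y) * 1"
        unfolding norm_mult using tent_bounds[of n y] by (intro mult_mono cmod_clip_le_cmod) auto
      then have "cmod (f y - clip n (f y) * tent n y) \<le> 2 * cmod (f y)"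
        using norm_triangle_ineq4[of "f y" "clip n (f y) * tent n y"] by linarith
      then have "(cmod (f y - clip n (f y) * tent n y))\<^sup>2 \<le> (2 * cmod (f y))\<^sup>2" by (intro power_mono) auto
      then show "norm ((cmod (f y - clip n (f y) * tent n y))\<^sup>2) \<le> 4 * (cmod (f y))\<^sup>2"
        by (simp add: power_mult_distrib)
    qed
  qed (use f2 in simp_all)
  then have "\<forall>\<^sub>F n in sequentially. (\<integral>y. (cmod (f y - clip n (f y) * tent n y))\<^sup>2 \<partial>lebesgue) < \<delta>"
    using \<delta> by (intro order_tendstoD(2)) auto
  then have "\<forall>\<^sub>F n in sequentially. 1 \<le> n \<and> (\<integral>y. (cmod (f y - clip n (f y) * tent n y))\<^sup>2 \<partial>lebesgue) < \<delta>"
    using eventually_ge_at_top[of 1] by eventually_elim auto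
  then obtain N where "\<forall>n\<ge>N. 1 \<le> n \<and> (\<integral>y. (cmod (f y - clip n (f y) * tent n y))\<^sup>2 \<partial>lebesgue) < \<delta>"
    unfolding eventually_sequentially by blast
  then show ?thesis by blast
qed

text \<open>Lebesgue measurable functions are almost everywhere limits of continuous ones. Clipping
  and the tent give the differences a common bound on \<open>[-n, n]\<close>, so this convergence
  passes to \<open>L^2\<close>.\<close>

lemma clip_continuous_approx:
  fixes f :: "real \<Rightarrow> complex"
  assumes fm [measurable]: "f \<in> borel_measurable lebesgue" and n: "n \<ge> 1" and \<delta>: "\<delta> > 0"
  shows "\<exists>h. continuous_on UNIV h \<and> (\<integral>y. (cmod (clip n (f y) * tent n y - clip n (h y) * tent n y))\<^sup>2 \<partial>lebesgue) < \<delta>"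
proof -
  have "f measurable_on UNIV" using fm by (simp add: measurable_on_iff_borel_measurable lebesgue_on_UNIV_eq)
  then obtain N g where N: "negligible N" and g: "\<And>k. continuous_on UNIV (g k)"
    and l: "\<And>y. y \<notin> N \<Longrightarrow> (\<lambda>k. g k y) \<longlonglongrightarrow> f y"
    unfolding measurable_on_def by auto
  have gm: "g k \<in> borel_measurable lebesgue" for k
  proof (rule measurable_completion)
    show "g k \<in> borel_measurable lborel" using borel_measurable_continuous_onI[OF g] by simp
  qed
  note gm [measurable]
  have AE: "AE y in lebesgue. y \<notin> N"
    using N by (simp add: negligible_iff_null_sets AE_not_in)
  have ind: "integrable lebesgue (indicat_real {- real n..real n})"
    by (rule integrable_real_indicator) auto
  have "(\<lambda>k. \<integral>y. (cmod (clip n (f y) * tent n y - clip n (g k y) * tent n y))\<^sup>2 \<partial>lebesgue) \<longlonglongrightarrow> (\<integral>y. 0 \<partial>(lebesgue :: real measure))"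
  proof (rule integral_dominated_convergence[where w = "\<lambda>y. (2 * real n)\<^sup>2 * indicator {- real n..real n} y"])
    show "(\<lambda>y. (cmod (clip n (f y) * tent n y - clip n (g k y) * tent n y))\<^sup>2) \<in> borel_measurable lebesgue" for k
      by measurable
    show "AE y in lebesgue. (\<lambda>k. (cmod (clip n (f y) * tent n y - clip n (g k y) * tent n y))\<^sup>2) \<longlonglongrightarrow> 0"
      using AE
    proof eventually_elim
      case (elim y)
      have "(\<lambda>k. clip n (g k y)) \<longlonglongrightarrow> clip n (f y)"
        by (rule continuous_on_tendsto_compose[OF continuous_clip l[OF elim]]) auto
      then have "(\<lambda>k. (cmod (clip n (f y) * tent n y - clip n (g k y) * tent n y))\<^sup>2) \<longlonglongrightarrow> (cmod (clip n (f y) * tent n y - clip n (f y) * tent n y))\<^sup>2"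
        by (intro tendsto_intros)
      then show ?case by simp
    qed
    show "AE y in lebesgue. norm ((cmod (clip n (f y) * tent n y - clip n (g k y) * tent n y))\<^sup>2) \<le> (2 * real n)\<^sup>2 * indicator {- real n..real n} y" for k
    proof (rule AE_I2)
      fix y
      show "norm ((cmod (clip n (f y) * tent n y - clip n (g k y) * tent n y))\<^sup>2) \<le> (2 * real n)\<^sup>2 * indicator {- real n..real n} y"
      proof (cases "y \<in> {- real n..real n}")
        case True
        have b: "cmod (clip n z * tent n y) \<le> real n * 1" for z
          unfolding norm_mult using tent_bounds[of n y] cmod_clip_le[OF n] by (intro mult_mono) auto
        have "cmod (clip n (f y) * tent n y - clip n (g k y) * tent n y) \<le> 2 * real n"
          using norm_triangle_ineq4[of "clip n (f y) * tent n y" "clip n (g k y) * tent n y"] b[of "f y"] b[of "g k y"] by linarith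
        then have "(cmod (clip n (f y) * tent n y - clip n (g k y) * tent n y))\<^sup>2 \<le> (2 * real n)\<^sup>2" by (intro power_mono) auto
        then show ?thesis using True by simp
      qed (simp add: tent_outside)
    qed
    show "integrable lebesgue (\<lambda>y. (2 * real n)\<^sup>2 * indicator {- real n..real n} y)" using ind by simp
  qed simp
  then have "\<forall>\<^sub>F k in sequentially. (\<integral>y. (cmod (clip n (f y) * tent n y - clip n (g k y) * tent n y))\<^sup>2 \<partial>lebesgue) < \<delta>"
    using \<delta> by (intro order_tendstoD(2)) auto
  then obtain k where "(\<integral>y. (cmod (clip n (f y) * tent n y - clip n (g k y) * tent n y))\<^sup>2 \<partial>lebesgue) < \<delta>"
    unfolding eventually_sequentially by blast
  then show ?thesis using g by blast
qed

text \<open>Truncation, then a continuous approximant, then a polynomial, which is Lipschitz on the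
  compact interval; the tent restores compact support. Lipschitz continuity is the regularity wanted
  later, since it makes neighbouring cell integrals differ by only \<open>O(1/m^2)\<close>.\<close>

lemma Lipschitz_dense_L2:
  fixes f :: "real \<Rightarrow> complex"
  assumes fm [measurable]: "f \<in> borel_measurable lebesgue" and f2: "integrable lebesgue (\<lambda>y. (cmod (f y))\<^sup>2)" and \<delta>: "\<delta> > 0"
  obtains g :: "real \<Rightarrow> complex" and L B :: real and n :: nat
  where "L \<ge> 0" "B \<ge> 0" "\<And>y z. cmod (g y - g z) \<le> L * \<bar>y - z\<bar>" "\<And>y. cmod (g y) \<le> B"
    "\<And>y. y \<notin> {- real n..real n} \<Longrightarrow> g y = 0" "integrable lebesgue (\<lambda>y. (cmod (f y - g y))\<^sup>2)"
    "(\<integral>y. (cmod (f y - g y))\<^sup>2 \<partial>lebesgue) \<le> \<delta>"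
proof -
  \<comment> \<open>Squaring a sum of three errors costs a factor \<open>3\<close>, and each of the
    three squared errors receives \<open>\<delta> / 9\<close>.\<close>
  have \<delta>9: "\<delta> / 9 > 0" using \<delta> by simp
  obtain n where n: "n \<ge> 1" and 1: "(\<integral>y. (cmod (f y - clip n (f y) * tent n y))\<^sup>2 \<partial>lebesgue) < \<delta> / 9"
    using clip_tent_approx[OF fm f2 \<delta>9] by blast
  obtain h where h: "continuous_on UNIV h" and 2: "(\<integral>y. (cmod (clip n (f y) * tent n y - clip n (h y) * tent n y))\<^sup>2 \<partial>lebesgue) < \<delta> / 9"
    using clip_continuous_approx[OF fm n \<delta>9] by blast
  \<comment> \<open>A uniform error \<open>\<epsilon>\<close> on an interval of length
    \<open>2 n\<close> costs \<open>2 n \<epsilon>^2 = \<delta> / 9\<close>.\<close>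
  define \<epsilon> where "\<epsilon> = sqrt (\<delta> / (18 * real n))"
  have \<epsilon>: "\<epsilon> > 0" "\<epsilon>\<^sup>2 * (2 * real n) = \<delta> / 9" using \<delta> n by (auto simp: \<epsilon>_def)
  have "continuous_on {- real n..real n} (\<lambda>y. clip n (h y))"
    by (rule continuous_on_compose2[OF continuous_clip continuous_on_subset[OF h]]) auto
  then obtain P where P: "polynomial_function P" "\<And>y. y \<in> {- real n..real n} \<Longrightarrow> cmod (clip n (h y) - P y) < \<epsilon>"
    using Stone_Weierstrass_polynomial_function[of "{- real n..real n}" "\<lambda>y. clip n (h y)" \<epsilon>] \<epsilon>(1) by auto
  obtain P' where P': "polynomial_function P'" "\<And>y. (P has_vector_derivative P' y) (at y)"
    using has_vector_derivative_polynomial_function[OF P(1)] by blast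
  have cP: "continuous_on {- real n..real n} P" "continuous_on {- real n..real n} P'"
    using P(1) P'(1) by (auto intro: continuous_on_polymonial_function)
  have "bounded (P ` {- real n..real n})" "bounded (P' ` {- real n..real n})"
    using cP by (auto intro!: compact_imp_bounded compact_continuous_image)
  then obtain B L where B: "B > 0" "\<And>y. y \<in> {- real n..real n} \<Longrightarrow> cmod (P y) \<le> B"
    and L: "L > 0" "\<And>y. y \<in> {- real n..real n} \<Longrightarrow> cmod (P' y) \<le> L"
    unfolding bounded_pos by auto
  have PL: "cmod (P y - P z) \<le> L * \<bar>y - z\<bar>" if "y \<in> {- real n..real n}" "z \<in> {- real n..real n}" for y z
  proof -
    have "norm (P y - P z) \<le> L * norm (y - z)"
    proof (rule differentiable_bound[of "{- real n..real n}" P "\<lambda>x t. t *\<^sub>R P' x"])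
      show "(P has_derivative (\<lambda>t. t *\<^sub>R P' x)) (at x within {- real n..real n})" for x
        using P'(2)[of x] unfolding has_vector_derivative_def by (rule has_derivative_at_withinI)
      show "onorm (\<lambda>t. t *\<^sub>R P' x) \<le> L" if "x \<in> {- real n..real n}" for x
      proof (rule onorm_le)
        fix t :: real
        have "\<bar>t\<bar> * cmod (P' x) \<le> \<bar>t\<bar> * L" by (intro mult_left_mono L(2) that) simp
        then show "norm (t *\<^sub>R P' x) \<le> L * norm t" by (simp only: norm_scaleR real_norm_def mult.commute)
      qed
    qed (use that in auto)
    then show ?thesis by simp
  qed
  \<comment> \<open>Clamping the argument keeps the polynomial on \<open>[-n, n]\<close>, where it
    is bounded and Lipschitz.\<close>
  define cl where "cl y = max (- real n) (min (real n) y)" for y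
  have cl: "cl y \<in> {- real n..real n}" "\<bar>cl y - cl z\<bar> \<le> \<bar>y - z\<bar>" for y z
    by (auto simp: cl_def max_def min_def)
  define g where "g y = P (cl y) * tent n y" for y
  have gb: "cmod (g y) \<le> B" for y
  proof -
    have "cmod (g y) \<le> B * 1" unfolding g_def norm_mult using B cl(1)[of y] tent_bounds[of n y] by (intro mult_mono) auto
    then show ?thesis by simp
  qed
  have gL: "cmod (g y - g z) \<le> (B + L) * \<bar>y - z\<bar>" for y z
  proof -
    have "g y - g z = P (cl y) * (tent n y - tent n z) + (P (cl y) - P (cl z)) * tent n z"
      by (simp add: g_def algebra_simps)
    then have "cmod (g y - g z) \<le> cmod (P (cl y) * (tent n y - tent n z)) + cmod ((P (cl y) - P (cl z)) * tent n z)"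
      by (simp only: norm_triangle_ineq)
    also have "\<dots> = cmod (P (cl y)) * \<bar>tent n y - tent n z\<bar> + cmod (P (cl y) - P (cl z)) * \<bar>tent n z\<bar>"
      by (simp only: norm_mult norm_of_real of_real_diff[symmetric])
    also have "\<dots> \<le> B * \<bar>y - z\<bar> + (L * \<bar>y - z\<bar>) * 1"
    proof (intro add_mono mult_mono)
      show "cmod (P (cl y)) \<le> B" using B(2) cl(1) by blast
      have "cmod (P (cl y) - P (cl z)) \<le> L * \<bar>cl y - cl z\<bar>" using PL cl(1) by blast
      also have "\<dots> \<le> L * \<bar>y - z\<bar>" using cl(2) L(1) by (intro mult_left_mono) auto
      finally show "cmod (P (cl y) - P (cl z)) \<le> L * \<bar>y - z\<bar>" .
    qed (use tent_bounds B L in auto)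
    finally show ?thesis by (simp add: algebra_simps)
  qed
  have gout: "g y = 0" if "y \<notin> {- real n..real n}" for y
    using tent_outside[OF that] by (simp add: g_def)
  have gc: "continuous_on UNIV g"
  proof -
    have "lipschitz_on (B + L) UNIV g" using gL B L by (intro lipschitz_onI) (auto simp: dist_norm)
    then show ?thesis by (rule lipschitz_on_continuous_on)
  qed
  have gm [measurable]: "g \<in> borel_measurable lebesgue"
  proof (rule measurable_completion)
    show "g \<in> borel_measurable lborel" using borel_measurable_continuous_onI[OF gc] by simp
  qed
  have hm [measurable]: "h \<in> borel_measurable lebesgue"
  proof (rule measurable_completion)
    show "h \<in> borel_measurable lborel" using borel_measurable_continuous_onI[OF h] by simp
  qed
  have ind: "integrable lebesgue (indicat_real {- real n..real n})"
    by (rule integrable_real_indicator) auto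
  define d1 where "d1 y = (cmod (f y - clip n (f y) * tent n y))\<^sup>2" for y
  define d2 where "d2 y = (cmod (clip n (f y) * tent n y - clip n (h y) * tent n y))\<^sup>2" for y
  define d3 where "d3 y = \<epsilon>\<^sup>2 * indicator {- real n..real n} y" for y
  have i1: "integrable lebesgue d1"
  proof (rule Bochner_Integration.integrable_bound[of _ "\<lambda>y. 4 * (cmod (f y))\<^sup>2"])
    show "d1 \<in> borel_measurable lebesgue" unfolding d1_def by measurable
    show "AE y in lebesgue. norm (d1 y) \<le> norm (4 * (cmod (f y))\<^sup>2)"
    proof (rule AE_I2)
      fix y
      have "cmod (clip n (f y) * tent n y) \<le> cmod (f y) * 1"
        unfolding norm_mult using tent_bounds[of n y] by (intro mult_mono cmod_clip_le_cmod) auto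
      then have "cmod (f y - clip n (f y) * tent n y) \<le> 2 * cmod (f y)"
        using norm_triangle_ineq4[of "f y" "clip n (f y) * tent n y"] by linarith
      then have "(cmod (f y - clip n (f y) * tent n y))\<^sup>2 \<le> (2 * cmod (f y))\<^sup>2" by (intro power_mono) auto
      then show "norm (d1 y) \<le> norm (4 * (cmod (f y))\<^sup>2)" by (simp add: d1_def power_mult_distrib)
    qed
  qed (use f2 in simp)
  have i2: "integrable lebesgue d2"
  proof (rule Bochner_Integration.integrable_bound[of _ "\<lambda>y. (2 * real n)\<^sup>2 * indicator {- real n..real n} y"])
    show "d2 \<in> borel_measurable lebesgue" unfolding d2_def by measurable
    show "AE y in lebesgue. norm (d2 y) \<le> norm ((2 * real n)\<^sup>2 * indicator {- real n..real n} y)"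
    proof (rule AE_I2)
      fix y
      show "norm (d2 y) \<le> norm ((2 * real n)\<^sup>2 * indicator {- real n..real n} y)"
      proof (cases "y \<in> {- real n..real n}")
        case True
        have b: "cmod (clip n z * tent n y) \<le> real n * 1" for z
          unfolding norm_mult using tent_bounds[of n y] cmod_clip_le[OF n] by (intro mult_mono) auto
        have "cmod (clip n (f y) * tent n y - clip n (h y) * tent n y) \<le> 2 * real n"
          using norm_triangle_ineq4[of "clip n (f y) * tent n y" "clip n (h y) * tent n y"] b[of "f y"] b[of "h y"] by linarith
        then have "(cmod (clip n (f y) * tent n y - clip n (h y) * tent n y))\<^sup>2 \<le> (2 * real n)\<^sup>2" by (intro power_mono) auto
        then show ?thesis using True by (simp add: d2_def)
      qed (simp add: d2_def tent_outside)
    qed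
  qed (use ind in simp)
  have i3: "integrable lebesgue d3" unfolding d3_def using ind by simp
  have le: "(cmod (f y - g y))\<^sup>2 \<le> 3 * (d1 y + d2 y + d3 y)" for y
  proof -
    define A where "A = cmod (f y - clip n (f y) * tent n y)"
    define A2 where "A2 = cmod (clip n (f y) * tent n y - clip n (h y) * tent n y)"
    define A3 where "A3 = cmod (clip n (h y) * tent n y - g y)"
    have "cmod (f y - g y) \<le> A + A2 + A3"
      unfolding A_def A2_def A3_def
      using norm_triangle_ineq[of "f y - clip n (f y) * tent n y" "clip n (f y) * tent n y - g y"]
        norm_triangle_ineq[of "clip n (f y) * tent n y - clip n (h y) * tent n y" "clip n (h y) * tent n y - g y"] by simp
    then have "(cmod (f y - g y))\<^sup>2 \<le> (A + A2 + A3)\<^sup>2" by (intro power_mono) auto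
    also have "\<dots> \<le> 3 * (A\<^sup>2 + A2\<^sup>2 + A3\<^sup>2)"
    proof -
      have "0 \<le> (A - A2)\<^sup>2 + (A - A3)\<^sup>2 + (A2 - A3)\<^sup>2" by simp
      then show ?thesis by (simp add: power2_eq_square algebra_simps)
    qed
    also have "A3\<^sup>2 \<le> d3 y"
    proof (cases "y \<in> {- real n..real n}")
      case True
      then have "cl y = y" by (auto simp: cl_def)
      then have "A3 = cmod (clip n (h y) - P y) * tent n y"
        unfolding A3_def g_def using tent_bounds(1)[of n y] by (simp add: left_diff_distrib[symmetric] norm_mult)
      also have "\<dots> \<le> \<epsilon> * 1" using P(2)[OF True] tent_bounds[of n y] \<epsilon> by (intro mult_mono) auto
      finally have "A3\<^sup>2 \<le> \<epsilon>\<^sup>2" by (intro power_mono) (auto simp: A3_def)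
      then show ?thesis using True by (simp add: d3_def)
    next
      case False
      then show ?thesis by (simp add: A3_def d3_def gout tent_outside)
    qed
    finally show ?thesis by (simp add: A_def A2_def d1_def d2_def)
  qed
  have i: "integrable lebesgue (\<lambda>y. (cmod (f y - g y))\<^sup>2)"
  proof (rule Bochner_Integration.integrable_bound[of _ "\<lambda>y. 3 * (d1 y + d2 y + d3 y)"])
    show "integrable lebesgue (\<lambda>y. 3 * (d1 y + d2 y + d3 y))" using i1 i2 i3 by simp
    show "AE y in lebesgue. norm ((cmod (f y - g y))\<^sup>2) \<le> norm (3 * (d1 y + d2 y + d3 y))"
    proof (rule AE_I2)
      fix y
      have "norm ((cmod (f y - g y))\<^sup>2) \<le> 3 * (d1 y + d2 y + d3 y)" using le[of y] by simp
      also have "\<dots> \<le> norm (3 * (d1 y + d2 y + d3 y))" unfolding real_norm_def by (rule abs_ge_self)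
      finally show "norm ((cmod (f y - g y))\<^sup>2) \<le> norm (3 * (d1 y + d2 y + d3 y))" .
    qed
  qed measurable
  have "(\<integral>y. (cmod (f y - g y))\<^sup>2 \<partial>lebesgue) \<le> (\<integral>y. 3 * (d1 y + d2 y + d3 y) \<partial>lebesgue)"
    using i i1 i2 i3 le by (intro integral_mono) auto
  also have "\<dots> = 3 * ((\<integral>y. d1 y \<partial>lebesgue) + (\<integral>y. d2 y \<partial>lebesgue) + (\<integral>y. d3 y \<partial>lebesgue))"
    using i1 i2 i3 by simp
  also have "(\<integral>y. d3 y \<partial>lebesgue) = \<epsilon>\<^sup>2 * (2 * real n)"
    unfolding d3_def by simp
  finally have "(\<integral>y. (cmod (f y - g y))\<^sup>2 \<partial>lebesgue) \<le> \<delta>"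
  proof -
    have "x \<le> \<delta>" if "x \<le> 3 * (a + b + c)" "a < \<delta> / 9" "b < \<delta> / 9" "c = \<delta> / 9" for x a b c :: real
      using that by simp
    then show "(\<integral>y. (cmod (f y - g y))\<^sup>2 \<partial>lebesgue) \<le> 3 * ((\<integral>y. d1 y \<partial>lebesgue) + (\<integral>y. d2 y \<partial>lebesgue) + \<epsilon>\<^sup>2 * (2 * real n)) \<Longrightarrow> ?thesis"
      using 1 2 \<epsilon>(2) unfolding d1_def d2_def by blast
  qed
  then show thesis
    by (intro that[OF _ _ gL gb gout i]) (use B L in auto)
qed

lemma Abel_sum_bound:
  fixes d :: "nat \<Rightarrow> complex"
  assumes v: "cmod v = 1"
  shows "cmod (1 - v) * cmod (\<Sum>j<N. d j * v ^ j) \<le> cmod (d 0) + cmod (d N) + (\<Sum>j<N. cmod (d (Suc j) - d j))"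
proof -
  \<comment> \<open>Summation by parts: the factor \<open>1 - v\<close> turns the sum into boundary
    terms plus first differences.\<close>
  have eq: "(1 - v) * (\<Sum>j<N. d j * v ^ j) = d 0 - d N * v ^ N + (\<Sum>j<N. (d (Suc j) - d j) * v ^ Suc j)"
  proof (induction N)
    case (Suc N)
    have e: "(1 - v) * (\<Sum>j<Suc N. d j * v ^ j) = (1 - v) * (\<Sum>j<N. d j * v ^ j) + (1 - v) * (d N * v ^ N)"
      by (simp add: distrib_left)
    show ?case unfolding e Suc.IH by (simp add: algebra_simps)
  qed simp
  have "cmod (1 - v) * cmod (\<Sum>j<N. d j * v ^ j) \<le> cmod (d 0 - d N * v ^ N) + cmod (\<Sum>j<N. (d (Suc j) - d j) * v ^ Suc j)"
    unfolding norm_mult[symmetric] eq by (rule norm_triangle_ineq)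
  also have "\<dots> \<le> (cmod (d 0) + cmod (d N * v ^ N)) + (\<Sum>j<N. cmod ((d (Suc j) - d j) * v ^ Suc j))"
    by (intro add_mono norm_triangle_ineq4 norm_sum)
  also have "\<dots> = cmod (d 0) + cmod (d N) + (\<Sum>j<N. cmod (d (Suc j) - d j))"
    unfolding norm_mult norm_power v by simp
  finally show ?thesis .
qed

lemma half_le_sin:
  fixes x :: real
  assumes "0 \<le> x" "x \<le> pi / 2"
  shows "x / 2 \<le> sin x"
proof -
  have "\<bar>sin x - (\<Sum>m<3. sin_coeff m * x ^ m)\<bar> \<le> inverse (fact 3) * \<bar>x\<bar> ^ 3"
    by (rule Maclaurin_sin_bound)
  moreover have "(\<Sum>m<3. sin_coeff m * x ^ m) = x"
    by (simp add: sin_coeff_def numeral_eq_Suc)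
  moreover have "inverse (fact 3) * \<bar>x\<bar> ^ 3 = x * x\<^sup>2 / 6"
    using assms by (simp add: fact_numeral power3_eq_cube power2_eq_square)
  moreover have "x * x\<^sup>2 / 6 \<le> x / 2"
  proof -
    have "x \<le> 1.6" using assms pi_less_4 pi_approx by simp
    then have "x\<^sup>2 \<le> 1.6\<^sup>2" using assms by (intro power_mono) auto
    then have "x * x\<^sup>2 \<le> x * 3" using assms by (intro mult_left_mono) (auto simp: power2_eq_square)
    then show ?thesis by simp
  qed
  ultimately show ?thesis by linarith
qed

lemma cmod_one_minus_cis_ge:
  assumes "\<bar>t\<bar> \<le> 1 / 2"
  shows "2 * \<bar>t\<bar> \<le> cmod (1 - cnj (cis (2 * pi * t)))"
proof -
  have "cmod (1 - cnj (cis (2 * pi * t))) = cmod (cnj (1 - cis (2 * pi * t)))" by simp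
  also have "\<dots> = dist (exp (\<i> * complex_of_real (2 * pi * t))) 1"
    unfolding complex_mod_cnj cis_conv_exp dist_norm by (rule norm_minus_commute)
  also have "\<dots> = 2 * \<bar>sin (pi * t)\<bar>" using dist_exp_i_1[of "2 * pi * t"] unfolding dist_norm by simp
  finally have eq: "cmod (1 - cnj (cis (2 * pi * t))) = 2 * \<bar>sin (pi * t)\<bar>" .
  have "pi * \<bar>t\<bar> / 2 \<le> sin (pi * \<bar>t\<bar>)" using assms by (intro half_le_sin) auto
  also have "\<dots> \<le> \<bar>sin (pi * t)\<bar>" by (cases "t \<ge> 0") auto
  finally have "pi * \<bar>t\<bar> / 2 \<le> \<bar>sin (pi * t)\<bar>" .
  moreover have "2 * \<bar>t\<bar> \<le> pi * \<bar>t\<bar>" using pi_ge_two by (intro mult_right_mono) auto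
  ultimately show ?thesis unfolding eq by linarith
qed

context
  fixes F :: "nat \<Rightarrow> complex" and C :: real and N :: nat
  assumes F: "\<And>j. cmod (F j) \<le> 1 / 2" and ab: "\<And>j. cmod (disc_a F j) \<le> C" "\<And>j. cmod (disc_b F j) \<le> C"
begin

lemma cmod_coeff_less_1: "cmod (F j) < 1"
  using F[of j] by simp

lemma disc_a_disc_b_step: "cmod (disc_a F (Suc j) - disc_a F j) \<le> 2 * C * cmod (F j)" "cmod (disc_b F (Suc j) - disc_b F j) \<le> 2 * C * cmod (F j)"
proof -
  have C0: "0 \<le> C" using ab(1)[of 0] norm_ge_zero order_trans by blast
  have main: "cmod ((a + s * b) / su11_scale (F j) - a) \<le> 2 * C * cmod (F j)"
    if a: "cmod a \<le> C" and b: "cmod b \<le> C" and s: "cmod s = cmod (F j)" for a b s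
  proof -
    define r where "r = 1 / su11_scale (F j)"
    have r1: "cmod (r - 1) \<le> (cmod (F j))\<^sup>2" unfolding r_def by (rule inverse_su11_scale_bound[OF F])
    also have "\<dots> \<le> 1 / 2 * cmod (F j)" unfolding power2_eq_square by (intro mult_right_mono F) simp
    finally have r1: "cmod (r - 1) \<le> 1 / 2 * cmod (F j)" .
    have "cmod r \<le> cmod (r - 1) + cmod (1::complex)" using norm_triangle_ineq[of "r - 1" 1] by simp
    then have r2: "cmod r \<le> 5 / 4" using r1 F[of j] by simp
    have "(a + s * b) / su11_scale (F j) - a = a * (r - 1) + s * b * r" by (simp add: r_def add_divide_distrib algebra_simps)
    then have "cmod ((a + s * b) / su11_scale (F j) - a) \<le> cmod (a * (r - 1)) + cmod (s * b * r)"
      by (simp only: norm_triangle_ineq)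
    also have "\<dots> = cmod a * cmod (r - 1) + cmod (F j) * cmod b * cmod r" by (simp only: norm_mult s)
    also have "\<dots> \<le> C * (1 / 2 * cmod (F j)) + cmod (F j) * C * (5 / 4)"
      using r1 r2 a b C0 by (intro add_mono mult_mono mult_nonneg_nonneg) auto
    also have "\<dots> \<le> 2 * C * cmod (F j)"
    proof -
      have "0 \<le> C * cmod (F j)" using C0 by simp
      then show ?thesis by (simp add: mult_ac)
    qed
    finally show ?thesis .
  qed
  show "cmod (disc_a F (Suc j) - disc_a F j) \<le> 2 * C * cmod (F j)" unfolding disc_a_Suc by (rule main) (use ab in auto)
  show "cmod (disc_b F (Suc j) - disc_b F j) \<le> 2 * C * cmod (F j)" unfolding disc_b_Suc by (rule main) (use ab in auto)
qed

text \<open>\<open>disc_ker\<close> without the factor common to all \<open>j\<close>. Its slow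
  variation in \<open>j\<close> is what summation by parts exploits.\<close>

definition "ker_amp j = 1 / (cnj (disc_a F j) * disc_D F j N)"

lemma cmod_ker_amp_le_1: "cmod (ker_amp j) \<le> 1"
proof -
  have "1 * 1 \<le> cmod (disc_a F j) * cmod (disc_D F j N)"
    using cmod_disc_a_ge1[of F j, OF cmod_coeff_less_1] cmod_disc_D_ge1[of F j N, OF cmod_coeff_less_1] by (intro mult_mono) auto
  then show ?thesis by (simp add: ker_amp_def norm_divide norm_mult divide_le_eq_1)
qed

text \<open>The denominator \<open>Y\<close> has modulus at least \<open>1\<close>, so the
  reciprocal varies no more than \<open>Y\<close> itself, whose step is governed by
  \<open>|F j|\<close>. The total variation is thus controlled by the sum of the
  \<open>|F j|\<close>, whatever the grid.\<close>

lemma ker_amp_step: "cmod (ker_amp (Suc j) - ker_amp j) \<le> 8 * C ^ 3 * cmod (F j)"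
proof -
  have C0: "0 \<le> C" using ab(1)[of 0] norm_ge_zero order_trans by blast
  define Y where "Y i = cnj (disc_a F i) * disc_D F i N" for i
  have Y1: "1 \<le> cmod (Y i)" for i
  proof -
    have "1 * 1 \<le> cmod (disc_a F i) * cmod (disc_D F i N)"
      using cmod_disc_a_ge1[of F i, OF cmod_coeff_less_1] cmod_disc_D_ge1[of F i N, OF cmod_coeff_less_1] by (intro mult_mono) auto
    then show ?thesis by (simp add: Y_def norm_mult)
  qed
  have Y0: "Y i \<noteq> 0" for i using Y1[of i] by auto
  have D: "cmod (disc_D F i N) \<le> 2 * C\<^sup>2" for i
  proof -
    have "cmod (disc_D F i N) \<le> cmod (disc_a F i) * cmod (disc_a F N) + cmod (disc_b F i) * cmod (disc_b F N)"
      unfolding disc_D_def using norm_triangle_ineq4[of "cnj (disc_a F i) * disc_a F N" "disc_b F i * cnj (disc_b F N)"] by (simp add: norm_mult)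
    also have "\<dots> \<le> C * C + C * C" using ab C0 by (intro add_mono mult_mono) auto
    finally show ?thesis by (simp add: power2_eq_square)
  qed
  have dD: "cmod (disc_D F (Suc j) N - disc_D F j N) \<le> 4 * C\<^sup>2 * cmod (F j)"
  proof -
    have "disc_D F (Suc j) N - disc_D F j N = cnj (disc_a F (Suc j) - disc_a F j) * disc_a F N - (disc_b F (Suc j) - disc_b F j) * cnj (disc_b F N)"
      by (simp add: disc_D_def algebra_simps)
    then have "cmod (disc_D F (Suc j) N - disc_D F j N) \<le> cmod (cnj (disc_a F (Suc j) - disc_a F j) * disc_a F N) + cmod ((disc_b F (Suc j) - disc_b F j) * cnj (disc_b F N))"
      by (simp only: norm_triangle_ineq4)
    also have "\<dots> = cmod (disc_a F (Suc j) - disc_a F j) * cmod (disc_a F N) + cmod (disc_b F (Suc j) - disc_b F j) * cmod (disc_b F N)"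
      by (simp only: norm_mult complex_mod_cnj)
    also have "\<dots> \<le> (2 * C * cmod (F j)) * C + (2 * C * cmod (F j)) * C"
      using ab C0 disc_a_disc_b_step by (intro add_mono mult_mono) auto
    finally show ?thesis by (simp add: power2_eq_square mult_ac)
  qed
  have "Y (Suc j) - Y j = cnj (disc_a F (Suc j) - disc_a F j) * disc_D F (Suc j) N + cnj (disc_a F j) * (disc_D F (Suc j) N - disc_D F j N)"
    by (simp add: Y_def algebra_simps)
  then have "cmod (Y (Suc j) - Y j) \<le> cmod (cnj (disc_a F (Suc j) - disc_a F j) * disc_D F (Suc j) N) + cmod (cnj (disc_a F j) * (disc_D F (Suc j) N - disc_D F j N))"
    by (simp only: norm_triangle_ineq)
  also have "\<dots> = cmod (disc_a F (Suc j) - disc_a F j) * cmod (disc_D F (Suc j) N) + cmod (disc_a F j) * cmod (disc_D F (Suc j) N - disc_D F j N)"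
    by (simp only: norm_mult complex_mod_cnj)
  also have "\<dots> \<le> (2 * C * cmod (F j)) * (2 * C\<^sup>2) + C * (4 * C\<^sup>2 * cmod (F j))"
    using ab(1) C0 disc_a_disc_b_step(1) D dD by (intro add_mono mult_mono) auto
  also have "\<dots> = 8 * C ^ 3 * cmod (F j)" by (simp add: power2_eq_square power3_eq_cube mult_ac)
  finally have dY: "cmod (Y (Suc j) - Y j) \<le> 8 * C ^ 3 * cmod (F j)" .
  have "ker_amp (Suc j) - ker_amp j = (Y j - Y (Suc j)) / (Y (Suc j) * Y j)"
    unfolding ker_amp_def Y_def[symmetric] using Y0 by (simp add: field_simps)
  then have "cmod (ker_amp (Suc j) - ker_amp j) = cmod (Y (Suc j) - Y j) / (cmod (Y (Suc j)) * cmod (Y j))"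
    by (simp add: norm_divide norm_mult norm_minus_commute)
  also have "\<dots> \<le> cmod (Y (Suc j) - Y j) / 1"
    using mult_mono[OF Y1 Y1, of "Suc j" j] by (intro divide_left_mono) auto
  finally show ?thesis using dY by simp
qed

text \<open>From \<open>1 - 1 / x \<le> ln x\<close> at \<open>x = |a|^2\<close>, since
  \<open>|b|^2 = x - 1\<close>. It keeps the factor \<open>b / sqrt (log |a|^2)\<close> of the
  kernel bounded even where the logarithm is close to zero.\<close>

lemma cmod_disc_b_le: "cmod (disc_b F N) \<le> C * sqrt (disc_log F N)"
proof -
  have C0: "0 \<le> C" using ab(1)[of 0] norm_ge_zero order_trans by blast
  define x where "x = (cmod (disc_a F N))\<^sup>2"
  have x: "1 \<le> x" unfolding x_def using cmod_disc_a_ge1[of F N, OF cmod_coeff_less_1] by (simp add: one_le_power)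
  have "ln (1 / x) \<le> 1 / x - 1" using x by (intro ln_le_minus_one) auto
  then have "1 - 1 / x \<le> ln x" using x by (simp add: ln_div)
  then have "x * (1 - 1 / x) \<le> x * ln x" using x by (intro mult_left_mono) auto
  then have "x - 1 \<le> x * ln x" using x by (simp add: right_diff_distrib)
  also have "\<dots> \<le> C\<^sup>2 * ln x" unfolding x_def using ab(1) x by (intro mult_right_mono power_mono) (auto simp: x_def[symmetric])
  finally have "(cmod (disc_b F N))\<^sup>2 \<le> C\<^sup>2 * disc_log F N"
    using cmod_disc_a_disc_b[of F N, OF cmod_coeff_less_1] by (simp add: x_def disc_log_def)
  then have "sqrt ((cmod (disc_b F N))\<^sup>2) \<le> sqrt (C\<^sup>2 * disc_log F N)" by (rule real_sqrt_le_mono)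
  then show ?thesis using C0 by (simp add: real_sqrt_mult)
qed

text \<open>The sum is an exponential sum in \<open>v = exp (-2 \<pi> i t)\<close> whose amplitudes
  have bounded variation, so summation by parts gains \<open>1 / |1 - v|\<close>, which is at most
  \<open>1 / (2 |t|)\<close>. The factor common to all \<open>j\<close>, including the phase
  \<open>w^K\<close>, is pulled out as \<open>k\<close>.\<close>

lemma kernel_sum_decay:
  assumes t: "t \<noteq> 0" "\<bar>t\<bar> \<le> 1 / 2" and h: "\<And>j. cmod (h j) \<le> B" and V: "(\<Sum>j<N. cmod (h (Suc j) - h j)) \<le> V"
    and M: "(\<Sum>j<N. cmod (F j)) \<le> M"
  shows "cmod (\<Sum>j<N. h j * (phase K j t * disc_ker F N j)) \<le> C * (2 * B + V + 8 * C ^ 3 * B * M) / \<bar>t\<bar>"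
proof -
  have C0: "0 \<le> C" using ab(1)[of 0] norm_ge_zero order_trans by blast
  have B0: "0 \<le> B" using h[of 0] norm_ge_zero order_trans by blast
  define v where "v = cnj (cis (2 * pi * t))"
  have v: "cmod v = 1" by (simp add: v_def)
  define d where "d j = h j * ker_amp j" for j
  define k where "k = cnj (disc_b F N) / complex_of_real (sqrt (disc_log F N)) * cis (2 * pi * t) ^ K"
  have k: "cmod k \<le> C"
  proof (cases "disc_log F N = 0")
    case False
    then have p: "0 < sqrt (disc_log F N)" using disc_log_nonneg[of F N, OF cmod_coeff_less_1] by simp
    have "cmod k = cmod (disc_b F N) / sqrt (disc_log F N)"
      unfolding k_def norm_mult norm_power norm_divide using disc_log_nonneg[of F N, OF cmod_coeff_less_1] by simp
    also have "\<dots> \<le> C" using cmod_disc_b_le p by (simp add: pos_divide_le_eq)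
    finally show ?thesis .
  qed (simp add: k_def C0)
  have "(\<Sum>j<N. h j * (phase K j t * disc_ker F N j)) = k * (\<Sum>j<N. d j * v ^ j)"
    unfolding sum_distrib_left by (intro sum.cong refl) (simp add: d_def k_def v_def phase_def disc_ker_def ker_amp_def mult_ac)
  then have 1: "cmod (\<Sum>j<N. h j * (phase K j t * disc_ker F N j)) = cmod k * cmod (\<Sum>j<N. d j * v ^ j)"
    by (simp only: norm_mult)
  have d: "cmod (d j) \<le> B" for j
    unfolding d_def norm_mult using mult_mono[OF h cmod_ker_amp_le_1, of j j] B0 by simp
  have "(\<Sum>j<N. cmod (d (Suc j) - d j)) \<le> (\<Sum>j<N. cmod (h (Suc j) - h j) + B * (8 * C ^ 3) * cmod (F j))"
  proof (rule sum_mono)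
    fix j
    have "d (Suc j) - d j = (h (Suc j) - h j) * ker_amp (Suc j) + h j * (ker_amp (Suc j) - ker_amp j)"
      by (simp add: d_def algebra_simps)
    then have "cmod (d (Suc j) - d j) \<le> cmod ((h (Suc j) - h j) * ker_amp (Suc j)) + cmod (h j * (ker_amp (Suc j) - ker_amp j))"
      by (simp only: norm_triangle_ineq)
    also have "\<dots> = cmod (h (Suc j) - h j) * cmod (ker_amp (Suc j)) + cmod (h j) * cmod (ker_amp (Suc j) - ker_amp j)"
      by (simp only: norm_mult)
    also have "\<dots> \<le> cmod (h (Suc j) - h j) * 1 + B * (8 * C ^ 3 * cmod (F j))"
      using h B0 ker_amp_step cmod_ker_amp_le_1 by (intro add_mono mult_mono) auto
    finally show "cmod (d (Suc j) - d j) \<le> cmod (h (Suc j) - h j) + B * (8 * C ^ 3) * cmod (F j)" by (simp add: mult.assoc)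
  qed
  also have "\<dots> = (\<Sum>j<N. cmod (h (Suc j) - h j)) + B * (8 * C ^ 3) * (\<Sum>j<N. cmod (F j))"
    by (simp only: sum.distrib sum_distrib_left)
  also have "\<dots> \<le> V + B * (8 * C ^ 3) * M"
    using V M B0 C0 by (intro add_mono mult_left_mono) auto
  finally have "cmod (1 - v) * cmod (\<Sum>j<N. d j * v ^ j) \<le> B + B + (V + B * (8 * C ^ 3) * M)"
    using Abel_sum_bound[OF v, of d N] d[of 0] d[of N] by linarith
  also have "\<dots> = 2 * B + V + 8 * C ^ 3 * B * M" by (simp add: mult_ac)
  finally have A: "cmod (1 - v) * cmod (\<Sum>j<N. d j * v ^ j) \<le> 2 * B + V + 8 * C ^ 3 * B * M" .
  have "\<bar>t\<bar> * cmod (\<Sum>j<N. d j * v ^ j) \<le> cmod (1 - v) * cmod (\<Sum>j<N. d j * v ^ j)"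
    using cmod_one_minus_cis_ge[OF t(2)] unfolding v_def by (intro mult_right_mono) auto
  then have "C * (\<bar>t\<bar> * cmod (\<Sum>j<N. d j * v ^ j)) \<le> C * (2 * B + V + 8 * C ^ 3 * B * M)"
    using A C0 by (intro mult_left_mono) auto
  moreover have "\<bar>t\<bar> * (cmod k * cmod (\<Sum>j<N. d j * v ^ j)) \<le> C * (\<bar>t\<bar> * cmod (\<Sum>j<N. d j * v ^ j))"
    using mult_right_mono[OF k, of "\<bar>t\<bar> * cmod (\<Sum>j<N. d j * v ^ j)"] by (simp add: mult_ac)
  ultimately have "\<bar>t\<bar> * (cmod k * cmod (\<Sum>j<N. d j * v ^ j)) \<le> C * (2 * B + V + 8 * C ^ 3 * B * M)" by linarith
  then show ?thesis unfolding 1 using t(1) by (simp add: pos_le_divide_eq mult.commute)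
qed

end

section \<open>Cell integrals of Lipschitz functions\<close>

lemma sum_cells_eq:
  fixes r :: "real \<Rightarrow> real"
  assumes r: "integrable lebesgue r" and out: "\<And>y. y \<notin> {- real (Suc n)..<real (Suc n)} \<Longrightarrow> r y = 0"
  shows "(\<integral>y. r y \<partial>lebesgue) = (\<Sum>j<ncell n. LINT y:cell n j|lebesgue. r y)"
proof -
  have "(\<Sum>j<N. LINT y:cell n j|lebesgue. r y) = (LINT y:{..<node n N}|lebesgue. r y) - (LINT y:{..<node n 0}|lebesgue. r y)" for N
  proof (induction N)
    case (Suc N)
    have "(LINT y:{..<node n (Suc N)}|lebesgue. r y) = (LINT y:{..<node n N}|lebesgue. r y) + (LINT y:cell n N|lebesgue. r y)"
      unfolding cell_def by (rule set_integral_Ico_Iio[OF r node_mono]) simp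
    then show ?case using Suc by simp
  qed simp
  from this[of "ncell n"] have eq: "(\<Sum>j<ncell n. LINT y:cell n j|lebesgue. r y)
      = (LINT y:{..<real (Suc n)}|lebesgue. r y) - (LINT y:{..<- real (Suc n)}|lebesgue. r y)"
    unfolding node_0 node_ncell .
  have "(LINT y:{..<real (Suc n)}|lebesgue. r y) = (\<integral>y. r y \<partial>lebesgue)"
    unfolding set_lebesgue_integral_def
  proof (rule Bochner_Integration.integral_cong[OF refl])
    fix y show "indicat_real {..<real (Suc n)} y *\<^sub>R r y = r y"
      using out[of y] by (cases "y < real (Suc n)") (auto simp: indicator_def)
  qed
  moreover have "(LINT y:{..<- real (Suc n)}|lebesgue. r y) = (\<integral>(y::real). 0 \<partial>lebesgue)"
    unfolding set_lebesgue_integral_def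
  proof (rule Bochner_Integration.integral_cong[OF refl])
    fix y show "indicat_real {..<- real (Suc n)} y *\<^sub>R r y = 0"
      using out[of y] by (cases "y < - real (Suc n)") (auto simp: indicator_def)
  qed
  ultimately show ?thesis using eq by simp
qed

lemma continuous_bounded_support_integrable:
  fixes g :: "real \<Rightarrow> complex"
  assumes g: "continuous_on UNIV g" and B: "\<And>y. cmod (g y) \<le> B" and out: "\<And>y. y \<notin> {- R..R} \<Longrightarrow> g y = 0"
  shows "g \<in> borel_measurable lebesgue" "integrable lebesgue g" "integrable lebesgue (\<lambda>y. (cmod (g y))\<^sup>2)"
proof -
  show gm [measurable]: "g \<in> borel_measurable lebesgue"
  proof (rule measurable_completion)
    show "g \<in> borel_measurable lborel" using borel_measurable_continuous_onI[OF g] by simp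
  qed
  have ind: "integrable lebesgue (indicat_real {- R..R})"
    by (rule integrable_real_indicator) (auto simp: emeasure_lborel_Icc_eq)
  show "integrable lebesgue g"
  proof (rule Bochner_Integration.integrable_bound)
    show "integrable lebesgue (\<lambda>y. B * indicat_real {- R..R} y)" using ind by simp
    show "AE y in lebesgue. norm (g y) \<le> norm (B * indicat_real {- R..R} y)"
    proof (rule AE_I2)
      fix y show "norm (g y) \<le> norm (B * indicat_real {- R..R} y)"
        using B[of y] out[of y] by (cases "y \<in> {- R..R}") auto
    qed
  qed simp
  show "integrable lebesgue (\<lambda>y. (cmod (g y))\<^sup>2)"
  proof (rule Bochner_Integration.integrable_bound)
    show "integrable lebesgue (\<lambda>y. B\<^sup>2 * indicat_real {- R..R} y)" using ind by simp
    show "AE y in lebesgue. norm ((cmod (g y))\<^sup>2) \<le> norm (B\<^sup>2 * indicat_real {- R..R} y)"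
    proof (rule AE_I2)
      fix y show "norm ((cmod (g y))\<^sup>2) \<le> norm (B\<^sup>2 * indicat_real {- R..R} y)"
        using power_mono[OF B, of y 2] out[of y] by (cases "y \<in> {- R..R}") auto
    qed
  qed simp
qed

context
  fixes g :: "real \<Rightarrow> complex" and L B R :: real and n :: nat and m :: real
  assumes L: "0 \<le> L" "\<And>y z. cmod (g y - g z) \<le> L * \<bar>y - z\<bar>" and B: "0 \<le> B" "\<And>y. cmod (g y) \<le> B"
    and R: "0 \<le> R" and out: "\<And>y. y \<notin> {- R..R} \<Longrightarrow> g y = 0" and m: "m = real (Suc n)"
begin

lemma Lipschitz_continuous: "continuous_on UNIV g"
proof -
  have "lipschitz_on L UNIV g" using L by (intro lipschitz_onI) (auto simp: dist_norm)
  then show ?thesis by (rule lipschitz_on_continuous_on)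
qed

lemmas Lipschitz_support_integrable = continuous_bounded_support_integrable[OF Lipschitz_continuous B(2) out]

lemma scale_ge_1: "1 \<le> m" using m by simp

lemma cmod_cell_int_le: "cmod (cell_int g n j) \<le> B / m"
proof -
  have "cmod (cell_int g n j) \<le> (LINT y:cell n j|lebesgue. cmod (g y))" by (rule cmod_cell_int[OF Lipschitz_support_integrable(2)])
  also have "\<dots> \<le> (LINT y:cell n j|lebesgue. B)"
  proof (rule set_integral_mono)
    show "set_integrable lebesgue (cell n j) (\<lambda>y. cmod (g y))"
      using Lipschitz_support_integrable(2) by (intro set_integrable_lebesgue cell_meas) simp
    show "set_integrable lebesgue (cell n j) (\<lambda>y. B)"
      using integrable_indicator_cell[of n j] by (simp add: set_integrable_def)
  qed (rule B(2))
  also have "\<dots> = B / m" unfolding m by (rule set_integral_const_cell)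
  finally show ?thesis .
qed

lemma cell_int_near:
  assumes z: "node n j \<le> z" "z \<le> node n (Suc j)"
  shows "cmod (cell_int g n j - g z / complex_of_real m) \<le> L / m\<^sup>2"
proof -
  have i: "set_integrable lebesgue (cell n j) g" by (intro set_integrable_lebesgue Lipschitz_support_integrable(2) cell_meas)
  have ic: "set_integrable lebesgue (cell n j) (\<lambda>y. c)" for c :: "'b::{banach, second_countable_topology}"
    using integrable_indicator_cell[of n j] by (simp add: set_integrable_def)
  have "(LINT y:cell n j|lebesgue. g z) = g z / complex_of_real m"
    unfolding set_lebesgue_integral_def m using integrable_indicator_cell[of n j]
    by (simp add: measure_def emeasure_cell scaleR_conv_of_real divide_inverse mult.commute)
  then have "cell_int g n j - g z / complex_of_real m = (LINT y:cell n j|lebesgue. g y - g z)"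
    unfolding cell_int_def using set_integral_diff(2)[OF i ic, of "g z"] by simp
  also have "cmod \<dots> \<le> (LINT y:cell n j|lebesgue. cmod (g y - g z))"
    by (rule set_integral_norm_bound[OF set_integral_diff(1)[OF i ic]])
  also have "\<dots> \<le> (LINT y:cell n j|lebesgue. L / m)"
  proof (rule set_integral_mono)
    show "set_integrable lebesgue (cell n j) (\<lambda>y. cmod (g y - g z))"
      using set_integrable_norm[OF set_integral_diff(1)[OF i ic]] .
    fix y assume "y \<in> cell n j"
    then have "\<bar>y - z\<bar> \<le> 1 / m" using z unfolding cell_def m node_Suc by auto
    then have "L * \<bar>y - z\<bar> \<le> L * (1 / m)" using L(1) by (rule mult_left_mono)
    then show "cmod (g y - g z) \<le> L / m" using L(2)[of y z] by simp
  qed (rule ic)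
  also have "\<dots> = L / m\<^sup>2"
  proof -
    have "(LINT y:cell n j|lebesgue. L / m) = L / m / m" unfolding m by (rule set_integral_const_cell)
    then show ?thesis by (simp add: power2_eq_square)
  qed
  finally show ?thesis .
qed

lemma cell_int_eq_0:
  assumes "\<And>y. y \<in> cell n j \<Longrightarrow> y \<notin> {- R..R}"
  shows "cell_int g n j = 0"
proof -
  have "(LINT y:cell n j|lebesgue. g y) = (\<integral>(y::real). 0 \<partial>lebesgue)"
    unfolding set_lebesgue_integral_def
  proof (rule Bochner_Integration.integral_cong[OF refl])
    fix y show "indicat_real (cell n j) y *\<^sub>R g y = 0"
      using out[of y] assms[of y] by (cases "y \<in> cell n j") (auto simp: indicator_def)
  qed
  then show ?thesis by (simp add: cell_int_def)
qed

text \<open>Neighbouring cell integrals are both compared with \<open>g / m\<close> at their common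
  node, so they differ by at most \<open>2 L / m^2\<close>. Only about \<open>m (2 R + 4)\<close>
  cells matter; they are counted by integrating an indicator.\<close>

lemma cell_int_variation: "(\<Sum>j<N. cmod (cell_int g n (Suc j) - cell_int g n j)) \<le> 2 * L * (2 * R + 4) / m"
proof -
  \<comment> \<open>Two neighbouring cells have total length at most \<open>2\<close>: if the first
    leaves \<open>[-(R + 2), R + 2]\<close>, both miss the support of \<open>g\<close>.\<close>
  define r where "r = indicat_real {- (R + 2)..R + 2}"
  have r: "integrable lebesgue r" unfolding r_def by (rule integrable_real_indicator) (auto simp: emeasure_lborel_Icc_eq)
  have m1: "1 / m \<le> 1" using scale_ge_1 by simp
  have "(\<Sum>j<N. cmod (cell_int g n (Suc j) - cell_int g n j)) \<le> (\<Sum>j<N. 2 * L / m * (LINT y:cell n j|lebesgue. r y))"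
  proof (rule sum_mono)
    fix j
    show "cmod (cell_int g n (Suc j) - cell_int g n j) \<le> 2 * L / m * (LINT y:cell n j|lebesgue. r y)"
    proof (cases "cell n j \<subseteq> {- (R + 2)..R + 2}")
      case True
      have "cmod (cell_int g n (Suc j) - cell_int g n j)
         \<le> cmod (cell_int g n (Suc j) - g (node n (Suc j)) / complex_of_real m) + cmod (cell_int g n j - g (node n (Suc j)) / complex_of_real m)"
        using norm_triangle_ineq4[of "cell_int g n (Suc j) - g (node n (Suc j)) / complex_of_real m" "cell_int g n j - g (node n (Suc j)) / complex_of_real m"] by simp
      also have "\<dots> \<le> L / m\<^sup>2 + L / m\<^sup>2" by (intro add_mono cell_int_near node_mono) auto
      also have "\<dots> = 2 * L / m * (1 / m)" by (simp add: power2_eq_square)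
      also have "1 / m = (LINT y:cell n j|lebesgue. r y)"
      proof -
        have "(LINT y:cell n j|lebesgue. r y) = (LINT y:cell n j|lebesgue. 1)"
          unfolding set_lebesgue_integral_def using True
          by (intro Bochner_Integration.integral_cong refl) (auto simp: r_def indicator_def)
        also have "\<dots> = 1 / m" unfolding m by (rule set_integral_const_cell)
        finally show ?thesis ..
      qed
      finally show ?thesis .
    next
      case False
      then obtain y where y: "y \<in> cell n j" "y \<notin> {- (R + 2)..R + 2}" by blast
      have s: "node n (Suc i) = node n i + 1 / m" for i using node_Suc[of n i] by (simp only: m)
      have c: "cell_int g n i = 0" if "i = j \<or> i = Suc j" for i
      proof (rule cell_int_eq_0)
        fix z assume z: "z \<in> cell n i"
        have "\<bar>y - z\<bar> \<le> 2"
          using that y(1) z m1 unfolding cell_def by (auto simp: s)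
        then show "z \<notin> {- R..R}" using y(2) by auto
      qed
      have "0 \<le> (LINT y:cell n j|lebesgue. r y)"
        unfolding set_lebesgue_integral_def by (rule integral_nonneg_AE) (simp add: r_def)
      then have "0 \<le> 2 * L / m * (LINT y:cell n j|lebesgue. r y)" using L(1) scale_ge_1 by simp
      then show ?thesis using c by simp
    qed
  qed
  also have "\<dots> = 2 * L / m * (\<Sum>j<N. LINT y:cell n j|lebesgue. r y)" by (rule sum_distrib_left[symmetric])
  also have "\<dots> \<le> 2 * L / m * (\<integral>y. r y \<partial>lebesgue)"
    using L(1) scale_ge_1 by (intro mult_left_mono sum_cells r) (auto simp: r_def)
  also have "(\<integral>y. r y \<partial>lebesgue) = 2 * R + 4" using R by (simp add: r_def)
  finally show ?thesis by simp
qed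

text \<open>A converse to Bessel's inequality with error \<open>O(1/m)\<close>: on each cell
  \<open>g\<close> differs from its average by at most \<open>L / m\<close>.\<close>

lemma L2_le_cell_sum:
  assumes mR: "R < m"
  shows "(\<integral>y. (cmod (g y))\<^sup>2 \<partial>lebesgue) \<le> m * (\<Sum>j<ncell n. (cmod (cell_int g n j))\<^sup>2) + (2 * B * L + L\<^sup>2) * (2 * R) / m"
proof -
  \<comment> \<open>The cross term and the square in the expansion of \<open>(x + L / m)^2\<close>
    for \<open>x \<le> B\<close>.\<close>
  define c where "c = 2 * B * L / m + L\<^sup>2 / m\<^sup>2"
  have m0: "0 < m" using scale_ge_1 by linarith
  have c0: "0 \<le> c" using B L m0 by (simp add: c_def)
  define r where "r = indicat_real {- R..R}"
  have r: "integrable lebesgue r" unfolding r_def by (rule integrable_real_indicator) (auto simp: emeasure_lborel_Icc_eq)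
  have ic: "set_integrable lebesgue (cell n j) (\<lambda>y. c)" for c :: real and j
    using integrable_indicator_cell[of n j] by (simp add: set_integrable_def)
  have rc: "set_integrable lebesgue (cell n j) (\<lambda>y. c * r y)" for j
    using r by (intro set_integrable_lebesgue cell_meas) simp
  have "(\<integral>y. (cmod (g y))\<^sup>2 \<partial>lebesgue) = (\<Sum>j<ncell n. LINT y:cell n j|lebesgue. (cmod (g y))\<^sup>2)"
    using out mR by (intro sum_cells_eq Lipschitz_support_integrable(3)) (auto simp: m)
  also have "\<dots> \<le> (\<Sum>j<ncell n. m * (cmod (cell_int g n j))\<^sup>2 + c * (LINT y:cell n j|lebesgue. r y))"
  proof (rule sum_mono)
    fix j
    have "(LINT y:cell n j|lebesgue. (cmod (g y))\<^sup>2) \<le> (LINT y:cell n j|lebesgue. (m * cmod (cell_int g n j))\<^sup>2 + c * r y)"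
    proof (rule set_integral_mono)
      show "set_integrable lebesgue (cell n j) (\<lambda>y. (cmod (g y))\<^sup>2)" by (intro set_integrable_lebesgue Lipschitz_support_integrable(3) cell_meas)
      show "set_integrable lebesgue (cell n j) (\<lambda>y. (m * cmod (cell_int g n j))\<^sup>2 + c * r y)"
        by (rule set_integral_add(1)[OF ic rc])
      fix y assume y: "y \<in> cell n j"
      show "(cmod (g y))\<^sup>2 \<le> (m * cmod (cell_int g n j))\<^sup>2 + c * r y"
      proof (cases "y \<in> {- R..R}")
        case True
        define x where "x = m * cmod (cell_int g n j)"
        have x: "0 \<le> x" "x \<le> B" using cmod_cell_int_le[of j] m0 by (auto simp: x_def pos_le_divide_eq mult.commute)
        have "cmod (g y / complex_of_real m) \<le> cmod (cell_int g n j) + cmod (cell_int g n j - g y / complex_of_real m)"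
          using norm_triangle_ineq4[of "cell_int g n j" "cell_int g n j - g y / complex_of_real m"] by simp
        also have "\<dots> \<le> cmod (cell_int g n j) + L / m\<^sup>2"
          using y by (intro add_left_mono cell_int_near) (auto simp: cell_def)
        finally have "m * (cmod (g y) / m) \<le> m * (cmod (cell_int g n j) + L / m\<^sup>2)"
          using m0 by (intro mult_left_mono) (auto simp: norm_divide)
        then have "cmod (g y) \<le> x + L / m" using m0 by (simp add: x_def distrib_left power2_eq_square)
        then have "(cmod (g y))\<^sup>2 \<le> (x + L / m)\<^sup>2" by (intro power_mono) auto
        also have "\<dots> = x\<^sup>2 + (2 * x * L / m + L\<^sup>2 / m\<^sup>2)" by (simp add: power2_sum power_divide)
        also have "\<dots> \<le> x\<^sup>2 + c"
          unfolding c_def using x L(1) m0 by (intro add_mono order_refl divide_right_mono mult_right_mono) auto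
        finally show ?thesis using True by (simp add: r_def x_def)
      next
        case False
        then show ?thesis using out[of y] by (simp add: r_def)
      qed
    qed
    also have "\<dots> = (LINT y:cell n j|lebesgue. (m * cmod (cell_int g n j))\<^sup>2) + (LINT y:cell n j|lebesgue. c * r y)"
      by (rule set_integral_add(2)[OF ic rc])
    also have "(LINT y:cell n j|lebesgue. (m * cmod (cell_int g n j))\<^sup>2) = (m * cmod (cell_int g n j))\<^sup>2 / m"
      unfolding m by (rule set_integral_const_cell)
    also have "\<dots> = m * (cmod (cell_int g n j))\<^sup>2" using m0 by (simp add: power2_eq_square)
    also have "(LINT y:cell n j|lebesgue. c * r y) = c * (LINT y:cell n j|lebesgue. r y)"
      by (rule set_integral_mult_right)
    finally show "(LINT y:cell n j|lebesgue. (cmod (g y))\<^sup>2) \<le> m * (cmod (cell_int g n j))\<^sup>2 + c * (LINT y:cell n j|lebesgue. r y)" .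
  qed
  also have "\<dots> = m * (\<Sum>j<ncell n. (cmod (cell_int g n j))\<^sup>2) + c * (\<Sum>j<ncell n. LINT y:cell n j|lebesgue. r y)"
    by (simp only: sum.distrib sum_distrib_left)
  also have "\<dots> \<le> m * (\<Sum>j<ncell n. (cmod (cell_int g n j))\<^sup>2) + c * (\<integral>y. r y \<partial>lebesgue)"
    using c0 by (intro add_left_mono mult_left_mono sum_cells r) (auto simp: r_def)
  also have "(\<integral>y. r y \<partial>lebesgue) = 2 * R" using R by (simp add: r_def)
  also have "c * (2 * R) \<le> (2 * B * L + L\<^sup>2) / m * (2 * R)"
  proof (rule mult_right_mono)
    have "L\<^sup>2 / m\<^sup>2 \<le> L\<^sup>2 / m" using scale_ge_1 by (intro divide_left_mono) (auto simp: power2_eq_square)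
    then show "c \<le> (2 * B * L + L\<^sup>2) / m" by (simp add: c_def add_divide_distrib)
  qed (use R in simp)
  finally show ?thesis by simp
qed

end

lemma borel_imp_lebesgue_measurable: "g \<in> borel_measurable borel \<Longrightarrow> g \<in> borel_measurable (lebesgue :: real measure)"
  by (rule measurable_completion) simp

lemma inverse_square_tail:
  fixes K R :: real
  assumes K: "0 \<le> K" and R: "0 < R"
  shows "(\<integral>\<^sup>+\<xi>. ennreal (K / \<xi>\<^sup>2) * indicator (- {- R..R}) \<xi> \<partial>lebesgue) \<le> ennreal (2 * K / R)"
proof -
  have pos: "(\<integral>\<^sup>+\<xi>. ennreal (K / \<xi>\<^sup>2) * indicator {R..} \<xi> \<partial>lborel) = ennreal (0 - (- (K / R)))"
  proof (rule nn_integral_FTC_atLeast)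
    show "DERIV (\<lambda>x. - (K / x)) x :> K / x\<^sup>2" if "R \<le> x" for x
      using that R by (auto intro!: derivative_eq_intros simp: power2_eq_square)
    show "((\<lambda>x. - (K / x)) \<longlongrightarrow> 0) at_top"
      using tendsto_minus[OF tendsto_divide_0[OF tendsto_const filterlim_at_top_imp_at_infinity[OF filterlim_ident], of K]] by simp
  qed (use K in auto)
  have neg: "(\<integral>\<^sup>+\<xi>. ennreal (K / \<xi>\<^sup>2) * indicator {..- R} \<xi> \<partial>lborel) = (\<integral>\<^sup>+\<xi>. ennreal (K / \<xi>\<^sup>2) * indicator {R..} \<xi> \<partial>lborel)"
  proof -
    have "(\<integral>\<^sup>+\<xi>. ennreal (K / \<xi>\<^sup>2) * indicator {..- R} \<xi> \<partial>lborel) = ennreal \<bar>- 1\<bar> * (\<integral>\<^sup>+\<xi>. ennreal (K / (0 + - 1 * \<xi>)\<^sup>2) * indicator {..- R} (0 + - 1 * \<xi>) \<partial>lborel)"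
      by (rule nn_integral_real_affine) auto
    also have "\<dots> = (\<integral>\<^sup>+\<xi>. ennreal (K / \<xi>\<^sup>2) * indicator {R..} \<xi> \<partial>lborel)"
      by (simp add: indicator_def)
    finally show ?thesis .
  qed
  have "(\<integral>\<^sup>+\<xi>. ennreal (K / \<xi>\<^sup>2) * indicator (- {- R..R}) \<xi> \<partial>lebesgue) = (\<integral>\<^sup>+\<xi>. ennreal (K / \<xi>\<^sup>2) * indicator (- {- R..R}) \<xi> \<partial>lborel)"
    by (rule nn_integral_completion)
  also have "\<dots> \<le> (\<integral>\<^sup>+\<xi>. ennreal (K / \<xi>\<^sup>2) * indicator {R..} \<xi> + ennreal (K / \<xi>\<^sup>2) * indicator {..- R} \<xi> \<partial>lborel)"
    by (intro nn_integral_mono) (auto simp: indicator_def)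
  also have "\<dots> = (\<integral>\<^sup>+\<xi>. ennreal (K / \<xi>\<^sup>2) * indicator {R..} \<xi> \<partial>lborel) + (\<integral>\<^sup>+\<xi>. ennreal (K / \<xi>\<^sup>2) * indicator {..- R} \<xi> \<partial>lborel)"
    by (rule nn_integral_add) auto
  also have "\<dots> = ennreal (2 * K / R)"
    unfolding neg pos using K R by (simp flip: ennreal_plus)
  finally show ?thesis .
qed

section \<open>Passage to the limit in frequency space\<close>

context
  fixes f :: "real \<Rightarrow> complex"
  assumes f: "integrable lebesgue f"
begin

text \<open>Fatou's lemma over windows that exhaust the line. The linearisation error is subtracted
  inside a positive part, so each \<open>W n\<close> is dominated by the operator alone and no
  additive error has to be integrated over the growing window.\<close>

lemma scat_Lp_bound:
  assumes p: "1 < p" "p \<le> 2" and fp: "integrable lebesgue (\<lambda>y. cmod (f y) powr p)"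
  shows "(\<integral>\<^sup>+\<xi>. ennreal (sqrt (ln ((cmod (scat_a f \<xi>))\<^sup>2)) powr (p / (p - 1))) \<partial>lebesgue)
     \<le> ennreal ((\<integral>y. cmod (f y) powr p \<partial>lebesgue) powr (1 / (p - 1)))" (is "_ \<le> ?B")
proof -
  define q where "q = p / (p - 1)"
  have q: "0 < q" using p by (simp add: q_def)
  obtain N where N: "\<And>n j. n \<ge> N \<Longrightarrow> cmod (cell_int f n j) \<le> 1 / 2"
    "\<And>n \<xi>. n \<ge> N \<Longrightarrow> sqrt (grid_log f n \<xi>) \<le> cmod (line_op f n (cell_int f n) \<xi>) + sq_sum f n * err_const f"
    using sqrt_grid_log_le[OF f] unfolding eventually_sequentially by auto
  define W where "W n \<xi> = ennreal (max 0 (sqrt (grid_log f n \<xi>) - sq_sum f n * err_const f) powr q) * indicator {- real (Suc n) / 2..real (Suc n) / 2} \<xi>" for n \<xi>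
  have lim: "(\<lambda>n. W (n + N) \<xi>) \<longlonglongrightarrow> ennreal (sqrt (ln ((cmod (scat_a f \<xi>))\<^sup>2)) powr q)" for \<xi>
  proof (rule LIMSEQ_ignore_initial_segment)
    have s0: "0 \<le> sqrt (ln ((cmod (scat_a f \<xi>))\<^sup>2))" using scat_a_ge_1[OF f, of \<xi>] by (simp add: one_le_power)
    have "(\<lambda>n. max 0 (sqrt (grid_log f n \<xi>) - sq_sum f n * err_const f)) \<longlonglongrightarrow> max 0 (sqrt (ln ((cmod (scat_a f \<xi>))\<^sup>2)) - 0)"
      by (intro tendsto_max tendsto_const tendsto_diff sqrt_grid_log_tendsto[OF f] sq_sum_tendsto_0[OF f])
    then have "(\<lambda>n. max 0 (sqrt (grid_log f n \<xi>) - sq_sum f n * err_const f)) \<longlonglongrightarrow> sqrt (ln ((cmod (scat_a f \<xi>))\<^sup>2))"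
      using s0 by (simp add: max_def)
    then have "(\<lambda>n. max 0 (sqrt (grid_log f n \<xi>) - sq_sum f n * err_const f) powr q) \<longlonglongrightarrow> sqrt (ln ((cmod (scat_a f \<xi>))\<^sup>2)) powr q"
      using q by (intro tendsto_powr' tendsto_const) auto
    then have l: "(\<lambda>n. ennreal (max 0 (sqrt (grid_log f n \<xi>) - sq_sum f n * err_const f) powr q)) \<longlonglongrightarrow> ennreal (sqrt (ln ((cmod (scat_a f \<xi>))\<^sup>2)) powr q)"
      by (rule tendsto_ennrealI)
    obtain M :: nat where M: "2 * \<bar>\<xi>\<bar> \<le> real M" using real_arch_simple by blast
    have "\<forall>\<^sub>F n in sequentially. ennreal (max 0 (sqrt (grid_log f n \<xi>) - sq_sum f n * err_const f) powr q) = W n \<xi>"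
      using eventually_ge_at_top[of M]
    proof eventually_elim
      case (elim n)
      then have "\<xi> \<in> {- real (Suc n) / 2..real (Suc n) / 2}" using M by auto
      then show ?case by (simp add: W_def)
    qed
    then show "(\<lambda>n. W n \<xi>) \<longlonglongrightarrow> ennreal (sqrt (ln ((cmod (scat_a f \<xi>))\<^sup>2)) powr q)"
      by (rule Lim_transform_eventually[OF l])
  qed
  have "(\<integral>\<^sup>+\<xi>. ennreal (sqrt (ln ((cmod (scat_a f \<xi>))\<^sup>2)) powr q) \<partial>lebesgue) = (\<integral>\<^sup>+\<xi>. liminf (\<lambda>n. W (n + N) \<xi>) \<partial>lebesgue)"
    by (intro nn_integral_cong lim_imp_Liminf[symmetric] lim) simp
  also have "\<dots> \<le> liminf (\<lambda>n. \<integral>\<^sup>+\<xi>. W (n + N) \<xi> \<partial>lebesgue)"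
  proof (rule nn_integral_liminf)
    fix n
    have [measurable]: "grid_log f (n + N) \<in> borel_measurable borel" by (rule grid_log_meas(2)[OF f N(1)]) simp
    show "W (n + N) \<in> borel_measurable lebesgue" unfolding W_def by (intro borel_imp_lebesgue_measurable) measurable
  qed
  also have "\<dots> \<le> limsup (\<lambda>n. \<integral>\<^sup>+\<xi>. W (n + N) \<xi> \<partial>lebesgue)" by (rule Liminf_le_Limsup) simp
  also have "\<dots> \<le> ?B"
  proof (rule Limsup_bounded, rule always_eventually, rule allI)
    fix n
    have "(\<integral>\<^sup>+\<xi>. W (n + N) \<xi> \<partial>lebesgue) \<le> (\<integral>\<^sup>+\<xi>. ennreal (cmod (line_op f (n + N) (cell_int f (n + N)) \<xi>) powr q) * indicator {- real (Suc (n + N)) / 2..real (Suc (n + N)) / 2} \<xi> \<partial>lebesgue)"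
    proof (rule nn_integral_mono)
      fix \<xi>
      have "max 0 (sqrt (grid_log f (n + N) \<xi>) - sq_sum f (n + N) * err_const f) \<le> cmod (line_op f (n + N) (cell_int f (n + N)) \<xi>)"
        using N(2)[of "n + N" \<xi>] by simp
      then show "W (n + N) \<xi> \<le> ennreal (cmod (line_op f (n + N) (cell_int f (n + N)) \<xi>) powr q) * indicator {- real (Suc (n + N)) / 2..real (Suc (n + N)) / 2} \<xi>"
        unfolding W_def using q by (intro mult_right_mono ennreal_leI powr_mono2) auto
    qed
    also have "\<dots> \<le> ?B" unfolding q_def by (rule line_op_Lp_bound[OF f N(1) p fp]) simp
    finally show "(\<integral>\<^sup>+\<xi>. W (n + N) \<xi> \<partial>lebesgue) \<le> ?B" .
  qed
  finally show ?thesis unfolding q_def .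
qed

text \<open>\<open>log_Parseval\<close> transported to the line, with \<open>- ln (1 - x)\<close>
  lowered to \<open>x\<close>, the direction that enters the lower bound.\<close>

lemma cell_energy_le_log:
  assumes c: "\<And>j. cmod (cell_int f n j) \<le> 1 / 2"
  shows "ennreal (real (Suc n) * (\<Sum>j<ncell n. (cmod (cell_int f n j))\<^sup>2))
    \<le> (\<integral>\<^sup>+\<xi>. ennreal (grid_log f n \<xi>) * indicator {- real (Suc n) / 2..real (Suc n) / 2} \<xi> \<partial>lebesgue)"
proof -
  define m where "m = real (Suc n)"
  have m: "m > 0" by (simp add: m_def)
  have c1: "cmod (cell_int f n j) < 1" for j using c[of j] by simp
  define g where "g t = disc_log (\<lambda>i. cell_int f n i * phase ((Suc n)\<^sup>2) i t) (ncell n)" for t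
  have gm: "g \<in> borel_measurable borel" unfolding g_def by (rule grid_log_meas(1)[OF f c])
  have g0: "0 \<le> g t" for t
  proof -
    have "cmod (cell_int f n j * phase ((Suc n)\<^sup>2) j t) < 1" for j using c1[of j] by (simp add: norm_mult)
    then show ?thesis unfolding g_def by (rule disc_log_nonneg)
  qed
  have lg: "grid_log f n \<xi> = g (\<xi> / m)" for \<xi> by (simp add: grid_log_def[OF f] samples_phase[OF f] g_def m_def)
  have "(\<integral>\<^sup>+\<xi>. ennreal (grid_log f n \<xi>) * indicator {- m / 2..m / 2} \<xi> \<partial>lebesgue) = ennreal m * (\<integral>\<^sup>+t. ennreal (g t) \<partial>period)"
    unfolding lg using gm m by (intro nn_integral_period_scale) measurable
  also have "(\<integral>\<^sup>+t. ennreal (g t) \<partial>period) = ennreal (\<integral>t. g t \<partial>period)"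
    using g0 unfolding g_def by (intro nn_integral_eq_integral log_Parseval(1)[OF c1]) auto
  also have "(\<integral>t. g t \<partial>period) = (\<Sum>j<ncell n. - ln (1 - (cmod (cell_int f n j))\<^sup>2))"
    unfolding g_def by (rule log_Parseval(2)[OF c1])
  also have "ennreal m * ennreal \<dots> \<ge> ennreal m * ennreal (\<Sum>j<ncell n. (cmod (cell_int f n j))\<^sup>2)"
  proof (intro mult_left_mono ennreal_leI sum_mono)
    fix j
    have "(cmod (cell_int f n j))\<^sup>2 < 1" using c1[of j] by (simp add: abs_square_less_1)
    then show "(cmod (cell_int f n j))\<^sup>2 \<le> - ln (1 - (cmod (cell_int f n j))\<^sup>2)"
      using ln_le_minus_one[of "1 - (cmod (cell_int f n j))\<^sup>2"] by simp
  qed simp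
  finally show ?thesis using m by (simp add: m_def ennreal_mult sum_nonneg)
qed

text \<open>Tightness in frequency. Inside \<open>[-R, R]\<close> the logarithm is kept; outside,
  its square root is bounded by the operator applied to \<open>h\<close> and to
  \<open>cell_int f n - h\<close>. The part \<open>h\<close>, later the cell integrals of a
  Lipschitz function, decays like \<open>D / |\<xi>|\<close>, and the difference is controlled in
  \<open>L^2\<close> by the contraction property.\<close>

lemma cell_energy_le:
  assumes c: "\<And>j. cmod (cell_int f n j) \<le> 1 / 2"
    and k: "\<And>\<xi>. sqrt (grid_log f n \<xi>) \<le> cmod (line_op f n (cell_int f n) \<xi>) + \<kappa>" "0 \<le> \<kappa>"
    and h: "\<And>\<xi>. \<xi> \<noteq> 0 \<Longrightarrow> \<bar>\<xi>\<bar> \<le> real (Suc n) / 2 \<Longrightarrow> cmod (line_op f n h \<xi>) \<le> D / \<bar>\<xi>\<bar>" and D: "0 \<le> D"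
    and R: "0 < R"
  shows "real (Suc n) * (\<Sum>j<ncell n. (cmod (cell_int f n j))\<^sup>2)
     \<le> (\<integral>\<xi>. indicator {- R..R} \<xi> * grid_log f n \<xi> \<partial>lebesgue) + 8 * D\<^sup>2 / R
       + 4 * (real (Suc n) * (\<Sum>j<ncell n. (cmod (cell_int f n j - h j))\<^sup>2)) + 2 * \<kappa>\<^sup>2 * real (Suc n)"
proof -
  define m where "m = real (Suc n)"
  have m: "m > 0" by (simp add: m_def)
  define d where "d j = cell_int f n j - h j" for j
  define I where "I = {- m / 2..m / 2}"
  have lm: "grid_log f n \<in> borel_measurable borel" by (rule grid_log_meas(2)[OF f c])
  have l0: "0 \<le> grid_log f n \<xi>" for \<xi> by (rule grid_log_bounds(1)[OF f c])
  have dm [measurable]: "line_op f n d \<in> borel_measurable borel"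
  proof -
    have "(\<lambda>\<xi>. period_op f n d (\<xi> / real (Suc n))) \<in> borel_measurable borel"
      by (rule measurable_compose[OF _ period_op_meas[OF f c]]) simp
    then show ?thesis unfolding line_op_period_op[OF f, abs_def] .
  qed
  have J: "integrable lebesgue (\<lambda>\<xi>. indicator {- R..R} \<xi> * grid_log f n \<xi>)"
  proof (rule Bochner_Integration.integrable_bound)
    show "integrable lebesgue (\<lambda>\<xi>. 4 * mass f * indicat_real {- R..R} \<xi>)"
      using integrable_real_indicator[of "{- R..R}" "lebesgue :: real measure"] by (simp add: emeasure_lborel_Icc_eq)
    show "(\<lambda>\<xi>. indicat_real {- R..R} \<xi> * grid_log f n \<xi>) \<in> borel_measurable lebesgue"
      using lm by (intro borel_imp_lebesgue_measurable) measurable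
    show "AE \<xi> in lebesgue. norm (indicat_real {- R..R} \<xi> * grid_log f n \<xi>) \<le> norm (4 * mass f * indicat_real {- R..R} \<xi>)"
    proof (rule AE_I2)
      fix \<xi> show "norm (indicat_real {- R..R} \<xi> * grid_log f n \<xi>) \<le> norm (4 * mass f * indicat_real {- R..R} \<xi>)"
        using grid_log_bounds(1,2)[OF f c, where \<xi> = \<xi>] by (cases "\<xi> \<in> {- R..R}") auto
    qed
  qed
  have lsplit: "line_op f n (cell_int f n) \<xi> = line_op f n h \<xi> + line_op f n d \<xi>" for \<xi>
    unfolding line_op_def[OF f] sum.distrib[symmetric] by (intro sum.cong refl) (simp add: d_def algebra_simps)
  have tail: "grid_log f n \<xi> \<le> 4 * D\<^sup>2 / \<xi>\<^sup>2 + (4 * (cmod (line_op f n d \<xi>))\<^sup>2 + 2 * \<kappa>\<^sup>2)" if "\<xi> \<in> I" "\<xi> \<noteq> 0" for \<xi>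
  proof -
    define x y where "x = D / \<bar>\<xi>\<bar>" and "y = cmod (line_op f n d \<xi>)"
    have "cmod (line_op f n h \<xi>) \<le> x" unfolding x_def using that by (intro h) (auto simp: I_def m_def)
    then have "sqrt (grid_log f n \<xi>) \<le> x + y + \<kappa>"
      using k(1)[of \<xi>] norm_triangle_ineq[of "line_op f n h \<xi>" "line_op f n d \<xi>"] unfolding lsplit y_def by linarith
    then have "(sqrt (grid_log f n \<xi>))\<^sup>2 \<le> (x + y + \<kappa>)\<^sup>2" using l0 by (intro power_mono) auto
    then have "grid_log f n \<xi> \<le> (x + y + \<kappa>)\<^sup>2" using l0 by simp
    \<comment> \<open>The weights \<open>4, 4, 2\<close> are those of
      \<open>(u + \<kappa>)^2 \<le> 2 u^2 + 2 \<kappa>^2\<close> followed by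
      \<open>(x + y)^2 \<le> 2 x^2 + 2 y^2\<close>.\<close>
    also have "\<dots> \<le> 4 * x\<^sup>2 + (4 * y\<^sup>2 + 2 * \<kappa>\<^sup>2)"
    proof -
      have "0 \<le> 2 * (x - y)\<^sup>2 + (x + y - \<kappa>)\<^sup>2" by simp
      then show ?thesis by (simp add: power2_eq_square algebra_simps)
    qed
    also have "4 * x\<^sup>2 = 4 * D\<^sup>2 / \<xi>\<^sup>2" by (simp add: x_def power_divide)
    finally show ?thesis unfolding y_def .
  qed
  define T1 where "T1 \<xi> = ennreal (indicator {- R..R} \<xi> * grid_log f n \<xi>)" for \<xi>
  define T2 where "T2 \<xi> = ennreal (4 * D\<^sup>2 / \<xi>\<^sup>2) * indicator (- {- R..R}) \<xi>" for \<xi> :: real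
  define T3 where "T3 \<xi> = ennreal 4 * (ennreal ((cmod (line_op f n d \<xi>))\<^sup>2) * indicator I \<xi>)" for \<xi>
  define T4 where "T4 \<xi> = ennreal (2 * \<kappa>\<^sup>2) * indicator I \<xi>" for \<xi> :: real
  have Tm: "T1 \<in> borel_measurable lebesgue" "T2 \<in> borel_measurable lebesgue" "T3 \<in> borel_measurable lebesgue" "T4 \<in> borel_measurable lebesgue"
    using lm dm unfolding T1_def T2_def T3_def T4_def I_def by (auto intro!: borel_imp_lebesgue_measurable)
  have "(\<integral>\<^sup>+\<xi>. ennreal (grid_log f n \<xi>) * indicator I \<xi> \<partial>lebesgue) \<le> (\<integral>\<^sup>+\<xi>. T1 \<xi> + (T2 \<xi> + (T3 \<xi> + T4 \<xi>)) \<partial>lebesgue)"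
  proof (rule nn_integral_mono)
    fix \<xi>
    show "ennreal (grid_log f n \<xi>) * indicator I \<xi> \<le> T1 \<xi> + (T2 \<xi> + (T3 \<xi> + T4 \<xi>))"
    proof (cases "\<xi> \<in> {- R..R}")
      case True
      then have "ennreal (grid_log f n \<xi>) * indicator I \<xi> \<le> T1 \<xi>" by (simp add: T1_def indicator_def)
      then show ?thesis by (simp add: add_increasing2)
    next
      case False
      show ?thesis
      proof (cases "\<xi> \<in> I")
        case True
        have "\<xi> \<noteq> 0" using False R by auto
        then have "ennreal (grid_log f n \<xi>) \<le> ennreal (4 * D\<^sup>2 / \<xi>\<^sup>2 + (4 * (cmod (line_op f n d \<xi>))\<^sup>2 + 2 * \<kappa>\<^sup>2))"
          by (intro ennreal_leI tail True)
        also have "\<dots> = T2 \<xi> + (T3 \<xi> + T4 \<xi>)"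
          using True False by (simp add: T2_def T3_def T4_def ennreal_plus ennreal_mult')
        finally show ?thesis using True by (simp add: add_increasing)
      qed simp
    qed
  qed
  also have "\<dots> = integral\<^sup>N lebesgue T1 + (integral\<^sup>N lebesgue T2 + (integral\<^sup>N lebesgue T3 + integral\<^sup>N lebesgue T4))"
    using Tm by (simp add: nn_integral_add)
  also have "integral\<^sup>N lebesgue T1 = ennreal (\<integral>\<xi>. indicator {- R..R} \<xi> * grid_log f n \<xi> \<partial>lebesgue)"
    unfolding T1_def using l0 J by (intro nn_integral_eq_integral) auto
  also have "integral\<^sup>N lebesgue T4 = ennreal (2 * \<kappa>\<^sup>2 * m)"
    unfolding T4_def I_def using m by (simp add: nn_integral_cmult_indicator ennreal_mult[symmetric])
  also have "integral\<^sup>N lebesgue T3 \<le> ennreal 4 * ennreal (m * (\<Sum>j<ncell n. (cmod (d j))\<^sup>2))"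
  proof -
    have "integral\<^sup>N lebesgue T3 = ennreal 4 * (\<integral>\<^sup>+\<xi>. ennreal ((cmod (line_op f n d \<xi>))\<^sup>2) * indicator I \<xi> \<partial>lebesgue)"
      unfolding T3_def I_def by (intro nn_integral_cmult borel_imp_lebesgue_measurable) measurable
    also have "(\<integral>\<^sup>+\<xi>. ennreal ((cmod (line_op f n d \<xi>))\<^sup>2) * indicator I \<xi> \<partial>lebesgue) \<le> ennreal (m * (\<Sum>j<ncell n. (cmod (d j))\<^sup>2))"
      using line_op_Lp_sum[OF f c, of 2 d] by (simp add: I_def m_def sum_nonneg del: of_nat_Suc)
    finally show ?thesis by (simp add: mult_left_mono)
  qed
  also have "integral\<^sup>N lebesgue T2 \<le> ennreal (2 * (4 * D\<^sup>2) / R)"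
    unfolding T2_def by (rule inverse_square_tail) (use R in auto)
  finally have "(\<integral>\<^sup>+\<xi>. ennreal (grid_log f n \<xi>) * indicator I \<xi> \<partial>lebesgue)
     \<le> ennreal (\<integral>\<xi>. indicator {- R..R} \<xi> * grid_log f n \<xi> \<partial>lebesgue) + (ennreal (2 * (4 * D\<^sup>2) / R) + (ennreal 4 * ennreal (m * (\<Sum>j<ncell n. (cmod (d j))\<^sup>2)) + ennreal (2 * \<kappa>\<^sup>2 * m)))"
    by (simp add: add_mono)
  also have "\<dots> = ennreal ((\<integral>\<xi>. indicator {- R..R} \<xi> * grid_log f n \<xi> \<partial>lebesgue) + (2 * (4 * D\<^sup>2) / R + (4 * (m * (\<Sum>j<ncell n. (cmod (d j))\<^sup>2)) + 2 * \<kappa>\<^sup>2 * m)))"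
    using m R l0 by (simp add: ennreal_plus ennreal_mult' sum_nonneg Bochner_Integration.integral_nonneg)
  finally have "ennreal (m * (\<Sum>j<ncell n. (cmod (cell_int f n j))\<^sup>2)) \<le> \<dots>"
    using cell_energy_le_log[OF c] unfolding I_def m_def by (rule order_trans[rotated])
  then have "m * (\<Sum>j<ncell n. (cmod (cell_int f n j))\<^sup>2) \<le> (\<integral>\<xi>. indicator {- R..R} \<xi> * grid_log f n \<xi> \<partial>lebesgue) + (2 * (4 * D\<^sup>2) / R + (4 * (m * (\<Sum>j<ncell n. (cmod (d j))\<^sup>2)) + 2 * \<kappa>\<^sup>2 * m))"
    using m R l0 by (subst (asm) ennreal_le_iff) (auto intro!: add_nonneg_nonneg mult_nonneg_nonneg sum_nonneg Bochner_Integration.integral_nonneg)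
  then show ?thesis unfolding m_def d_def by simp
qed

text \<open>The cell integrals of \<open>g\<close> and their total variation are
  \<open>O(1/m)\<close>, while \<open>kernel_sum_decay\<close> is used at
  \<open>t = \<xi> / m\<close>. The powers of \<open>m\<close> cancel, so the decay is uniform in
  the grid.\<close>

lemma line_op_decay:
  fixes g :: "real \<Rightarrow> complex"
  assumes c: "\<And>j. cmod (cell_int f n j) \<le> 1 / 2"
    and L: "0 \<le> L" "\<And>y z. cmod (g y - g z) \<le> L * \<bar>y - z\<bar>" and B: "0 \<le> B" "\<And>y. cmod (g y) \<le> B"
    and R: "0 \<le> R" and out: "\<And>y. y \<notin> {- R..R} \<Longrightarrow> g y = 0"
    and \<xi>: "\<xi> \<noteq> 0" "\<bar>\<xi>\<bar> \<le> real (Suc n) / 2"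
  shows "cmod (line_op f n (cell_int g n) \<xi>) \<le> growth f * (2 * B + 2 * L * (2 * R + 4) + 8 * growth f ^ 3 * B * mass f) / \<bar>\<xi>\<bar>"
proof -
  define m where "m = real (Suc n)"
  have m: "m > 0" by (simp add: m_def)
  have "cmod (line_op f n (cell_int g n) \<xi>) \<le> growth f * (2 * (B / m) + 2 * L * (2 * R + 4) / m + 8 * growth f ^ 3 * (B / m) * mass f) / \<bar>\<xi> / m\<bar>"
    unfolding line_op_def[OF f] m_def[symmetric]
  proof (rule kernel_sum_decay)
    show "cmod (samples f n \<xi> j) \<le> 1 / 2" for j using c by (simp only: cmod_samples[OF f])
    show "cmod (disc_a (samples f n \<xi>) j) \<le> growth f" "cmod (disc_b (samples f n \<xi>) j) \<le> growth f" for j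
      by (rule disc_a_disc_b_bound[OF f c])+
    show "\<xi> / m \<noteq> 0" using \<xi> m by simp
    show "\<bar>\<xi> / m\<bar> \<le> 1 / 2" using \<xi>(2) m unfolding m_def[symmetric] by (simp add: pos_divide_le_eq)
    show "cmod (cell_int g n j) \<le> B / m" for j by (rule cmod_cell_int_le[OF L B R out m_def])
    show "(\<Sum>j<ncell n. cmod (cell_int g n (Suc j) - cell_int g n j)) \<le> 2 * L * (2 * R + 4) / m"
      by (rule cell_int_variation[OF L B R out m_def])
    show "(\<Sum>j<ncell n. cmod (samples f n \<xi> j)) \<le> mass f" unfolding mass_def[OF f] by (rule sum_cmod_samples[OF f])
  qed
  also have "\<dots> = growth f * (2 * B + 2 * L * (2 * R + 4) + 8 * growth f ^ 3 * B * mass f) / \<bar>\<xi>\<bar>"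
  proof -
    have "2 * (B / m) + 2 * L * (2 * R + 4) / m + 8 * growth f ^ 3 * (B / m) * mass f = (2 * B + 2 * L * (2 * R + 4) + 8 * growth f ^ 3 * B * mass f) / m"
      by (simp add: add_divide_distrib)
    then show ?thesis using m by simp
  qed
  finally show ?thesis .
qed

end

lemma cmod_sq_le_split:
  fixes x y :: complex
  assumes \<eta>: "0 < \<eta>"
  shows "(cmod x)\<^sup>2 \<le> (1 + \<eta>) * (cmod y)\<^sup>2 + (1 + 1 / \<eta>) * (cmod (x - y))\<^sup>2"
proof -
  define a d where "a = cmod y" and "d = cmod (x - y)"
  have "cmod x \<le> a + d" unfolding a_def d_def using norm_triangle_ineq[of y "x - y"] by simp
  then have "(cmod x)\<^sup>2 \<le> (a + d)\<^sup>2" by (intro power_mono) auto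
  also have "\<dots> \<le> (1 + \<eta>) * a\<^sup>2 + (1 + 1 / \<eta>) * d\<^sup>2"
  proof -
    have "0 \<le> (\<eta> * a - d)\<^sup>2 / \<eta>" using \<eta> by simp
    also have "\<dots> = \<eta> * a\<^sup>2 - 2 * a * d + d\<^sup>2 / \<eta>" using \<eta> by (simp add: power2_eq_square field_simps)
    finally show ?thesis by (simp add: power2_eq_square algebra_simps)
  qed
  finally show ?thesis unfolding a_def d_def .
qed

lemma cell_Bessel:
  fixes f :: "real \<Rightarrow> complex"
  assumes f: "integrable lebesgue f" and f2: "integrable lebesgue (\<lambda>y. (cmod (f y))\<^sup>2)"
  shows "real (Suc n) * (\<Sum>j<N. (cmod (cell_int f n j))\<^sup>2) \<le> (\<integral>y. (cmod (f y))\<^sup>2 \<partial>lebesgue)"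
  using sum_cell_Jensen[OF f, of 2 n N] f2 by (simp del: of_nat_Suc)

lemma cell_int_diff:
  assumes "integrable lebesgue f" "integrable lebesgue g"
  shows "cell_int (\<lambda>y. f y - g y) n j = cell_int f n j - cell_int g n j"
  unfolding cell_int_def using assms by (intro set_integral_diff(2) set_integrable_lebesgue cell_meas)

context
  fixes f :: "real \<Rightarrow> complex"
  assumes f: "integrable lebesgue f"
begin

lemma grid_log_tendsto: "(\<lambda>n. grid_log f n \<xi>) \<longlonglongrightarrow> ln ((cmod (scat_a f \<xi>))\<^sup>2)"
proof -
  have s0: "0 \<le> ln ((cmod (scat_a f \<xi>))\<^sup>2)" using scat_a_ge_1[OF f, of \<xi>] by (simp add: one_le_power)
  have "\<forall>\<^sub>F n in sequentially. \<forall>j. cmod (cell_int f n j) \<le> 1 / 2"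
    using eventually_cell_int_small[OF f, of "1/2"] by simp
  then have ev: "\<forall>\<^sub>F n in sequentially. (sqrt (grid_log f n \<xi>))\<^sup>2 = grid_log f n \<xi>"
  proof eventually_elim
    case (elim n)
    then have "0 \<le> grid_log f n \<xi>" by (intro grid_log_bounds(1)[OF f]) blast
    then show ?case by simp
  qed
  have "(\<lambda>n. (sqrt (grid_log f n \<xi>))\<^sup>2) \<longlonglongrightarrow> (sqrt (ln ((cmod (scat_a f \<xi>))\<^sup>2)))\<^sup>2"
    by (intro tendsto_power sqrt_grid_log_tendsto[OF f])
  from Lim_transform_eventually[OF this ev] show ?thesis using s0 by simp
qed

lemma log_integral_window_tendsto:
  "(\<lambda>n. \<integral>\<xi>. indicator {- R..R} \<xi> * grid_log f n \<xi> \<partial>lebesgue) \<longlonglongrightarrow> (\<integral>\<xi>. indicator {- R..R} \<xi> * ln ((cmod (scat_a f \<xi>))\<^sup>2) \<partial>lebesgue)"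
proof -
  obtain N where N: "\<And>n j. n \<ge> N \<Longrightarrow> cmod (cell_int f n j) \<le> 1 / 2"
    using eventually_cell_int_small[OF f, of "1/2"] unfolding eventually_sequentially by auto
  have c: "cmod (cell_int f (n + N) j) \<le> 1 / 2" for n j using N[of "n + N" j] by simp
  have lm [measurable]: "grid_log f (n + N) \<in> borel_measurable borel" for n by (rule grid_log_meas(2)[OF f c])
  have l: "(\<lambda>n. grid_log f (n + N) \<xi>) \<longlonglongrightarrow> ln ((cmod (scat_a f \<xi>))\<^sup>2)" for \<xi>
    by (rule LIMSEQ_ignore_initial_segment[OF grid_log_tendsto])
  have sm [measurable]: "(\<lambda>\<xi>. ln ((cmod (scat_a f \<xi>))\<^sup>2)) \<in> borel_measurable borel"
    by (rule borel_measurable_LIMSEQ_metric[OF lm l])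
  have "(\<lambda>n. \<integral>\<xi>. indicator {- R..R} \<xi> * grid_log f (n + N) \<xi> \<partial>lebesgue) \<longlonglongrightarrow> (\<integral>\<xi>. indicator {- R..R} \<xi> * ln ((cmod (scat_a f \<xi>))\<^sup>2) \<partial>lebesgue)"
  proof (rule integral_dominated_convergence[where w = "\<lambda>\<xi>. 4 * mass f * indicat_real {- R..R} \<xi>"])
    show "(\<lambda>\<xi>. indicat_real {- R..R} \<xi> * ln ((cmod (scat_a f \<xi>))\<^sup>2)) \<in> borel_measurable lebesgue"
      by (intro borel_imp_lebesgue_measurable) measurable
    show "(\<lambda>\<xi>. indicat_real {- R..R} \<xi> * grid_log f (n + N) \<xi>) \<in> borel_measurable lebesgue" for n
      by (intro borel_imp_lebesgue_measurable) measurable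
    show "integrable lebesgue (\<lambda>\<xi>. 4 * mass f * indicat_real {- R..R} \<xi>)"
      using integrable_real_indicator[of "{- R..R}" "lebesgue :: real measure"] by (simp add: emeasure_lborel_Icc_eq)
    show "AE \<xi> in lebesgue. (\<lambda>n. indicat_real {- R..R} \<xi> * grid_log f (n + N) \<xi>) \<longlonglongrightarrow> indicat_real {- R..R} \<xi> * ln ((cmod (scat_a f \<xi>))\<^sup>2)"
      by (intro AE_I2 tendsto_mult tendsto_const l)
    show "AE \<xi> in lebesgue. norm (indicat_real {- R..R} \<xi> * grid_log f (n + N) \<xi>) \<le> 4 * mass f * indicat_real {- R..R} \<xi>" for n
    proof (rule AE_I2)
      fix \<xi> show "norm (indicat_real {- R..R} \<xi> * grid_log f (n + N) \<xi>) \<le> 4 * mass f * indicat_real {- R..R} \<xi>"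
        using grid_log_bounds[OF f c, of n \<xi>] by (cases "\<xi> \<in> {- R..R}") auto
    qed
  qed
  then show ?thesis by (rule LIMSEQ_offset)
qed

lemma log_integral_window_le:
  assumes A: "(\<integral>\<^sup>+\<xi>. ennreal (ln ((cmod (scat_a f \<xi>))\<^sup>2)) \<partial>lebesgue) \<le> ennreal A" and A0: "0 \<le> A"
  shows "(\<integral>\<xi>. indicator {- R..R} \<xi> * ln ((cmod (scat_a f \<xi>))\<^sup>2) \<partial>lebesgue) \<le> A"
proof -
  have "ennreal (\<integral>\<xi>. indicator {- R..R} \<xi> * ln ((cmod (scat_a f \<xi>))\<^sup>2) \<partial>lebesgue) \<le> ennreal A"
  proof (cases "integrable lebesgue (\<lambda>\<xi>. indicator {- R..R} \<xi> * ln ((cmod (scat_a f \<xi>))\<^sup>2))")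
    case True
    have s0: "0 \<le> ln ((cmod (scat_a f \<xi>))\<^sup>2)" for \<xi> using scat_a_ge_1[OF f, of \<xi>] by (simp add: one_le_power)
    have "ennreal (\<integral>\<xi>. indicator {- R..R} \<xi> * ln ((cmod (scat_a f \<xi>))\<^sup>2) \<partial>lebesgue) = (\<integral>\<^sup>+\<xi>. ennreal (indicator {- R..R} \<xi> * ln ((cmod (scat_a f \<xi>))\<^sup>2)) \<partial>lebesgue)"
      using True s0 by (intro nn_integral_eq_integral[symmetric] AE_I2 mult_nonneg_nonneg) auto
    also have "\<dots> \<le> (\<integral>\<^sup>+\<xi>. ennreal (ln ((cmod (scat_a f \<xi>))\<^sup>2)) \<partial>lebesgue)"
      using s0 by (intro nn_integral_mono ennreal_leI) (auto simp: indicator_def)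
    finally show ?thesis using A by (rule order_trans)
  next
    case False
    \<comment> \<open>A non-integrable function has Bochner integral \<open>0\<close>, and the bound
      is then trivial.\<close>
    show ?thesis unfolding not_integrable_integral_eq[OF False] by simp
  qed
  then show ?thesis using A0 by (simp only: ennreal_le_iff)
qed

text \<open>\<open>f\<close> and its Lipschitz approximant \<open>g\<close> are exchanged twice,
  once in \<open>L^2\<close> and once between cell integrals, the latter by Bessel's inequality for
  \<open>f - g\<close>. The parameters are fixed in the order \<open>\<eta>\<close>,
  \<open>g\<close>, \<open>R\<close> before \<open>n\<close> tends to infinity, so \<open>D\<close>
  and \<open>R\<close> may depend on \<open>g\<close>.\<close>

lemma scat_L2_lower_approx:
  assumes f2: "integrable lebesgue (\<lambda>y. (cmod (f y))\<^sup>2)" and \<eta>: "0 < \<eta>" "\<eta> \<le> 1"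
    and A: "(\<integral>\<^sup>+\<xi>. ennreal (ln ((cmod (scat_a f \<xi>))\<^sup>2)) \<partial>lebesgue) \<le> ennreal A" and A0: "0 \<le> A"
  shows "(\<integral>y. (cmod (f y))\<^sup>2 \<partial>lebesgue) \<le> (1 + \<eta>) * ((1 + \<eta>) * (A + 5 * \<eta>\<^sup>2) + 2 * \<eta>) + 2 * \<eta>"
proof -
  define I2 where "I2 = (\<integral>y. (cmod (f y))\<^sup>2 \<partial>lebesgue)"
  have fm: "f \<in> borel_measurable lebesgue" using f by auto
  have \<eta>2: "\<eta>\<^sup>2 > 0" using \<eta> by simp
  \<comment> \<open>The weight \<open>1 + 1 / \<eta>\<close> in \<open>cmod_sq_le_split\<close> is
    the reason for approximating to within \<open>\<eta>^2\<close>.\<close>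
  have \<eta>s: "(1 + 1 / \<eta>) * x \<le> 2 * \<eta>" if "x \<le> \<eta>\<^sup>2" for x
  proof -
    have "(1 + 1 / \<eta>) * x \<le> (1 + 1 / \<eta>) * \<eta>\<^sup>2" using \<eta> that by (intro mult_left_mono) auto
    also have "\<dots> = \<eta> * \<eta> + \<eta>" using \<eta> by (simp add: power2_eq_square distrib_right)
    also have "\<dots> \<le> 2 * \<eta>" using \<eta> mult_left_mono[of \<eta> 1 \<eta>] by simp
    finally show ?thesis .
  qed
  obtain g L B and R0 :: nat where L: "0 \<le> L" "\<And>y z. cmod (g y - g z) \<le> L * \<bar>y - z\<bar>" and B: "0 \<le> B" "\<And>y. cmod (g y) \<le> B"
    and out: "\<And>y. y \<notin> {- real R0..real R0} \<Longrightarrow> g y = 0"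
    and d2: "integrable lebesgue (\<lambda>y. (cmod (f y - g y))\<^sup>2)" "(\<integral>y. (cmod (f y - g y))\<^sup>2 \<partial>lebesgue) \<le> \<eta>\<^sup>2"
    by (rule Lipschitz_dense_L2[OF fm f2 \<eta>2]) blast
  have gc: "continuous_on UNIV g"
  proof -
    have "lipschitz_on L UNIV g" using L by (intro lipschitz_onI) (auto simp: dist_norm)
    then show ?thesis by (rule lipschitz_on_continuous_on)
  qed
  have gi: "integrable lebesgue g" "integrable lebesgue (\<lambda>y. (cmod (g y))\<^sup>2)"
    by (rule continuous_bounded_support_integrable[OF gc B(2), of "real R0"], erule out)+
  define G where "G = (\<integral>y. (cmod (g y))\<^sup>2 \<partial>lebesgue)"
  have IG: "I2 \<le> (1 + \<eta>) * G + 2 * \<eta>"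
  proof -
    have "I2 \<le> (\<integral>y. (1 + \<eta>) * (cmod (g y))\<^sup>2 + (1 + 1 / \<eta>) * (cmod (f y - g y))\<^sup>2 \<partial>lebesgue)"
      unfolding I2_def using f2 gi(2) d2(1) by (intro integral_mono cmod_sq_le_split \<eta>) auto
    also have "\<dots> = (1 + \<eta>) * G + (1 + 1 / \<eta>) * (\<integral>y. (cmod (f y - g y))\<^sup>2 \<partial>lebesgue)"
      unfolding G_def using gi(2) d2(1) by simp
    finally show ?thesis using \<eta>s[OF d2(2)] by linarith
  qed
  define D where "D = growth f * (2 * B + 2 * L * (2 * real R0 + 4) + 8 * growth f ^ 3 * B * mass f)"
  have D: "0 \<le> D" unfolding D_def using L(1) B(1) mass_nonneg[OF f]
    by (intro mult_nonneg_nonneg add_nonneg_nonneg) (auto simp: growth_def[OF f])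
  \<comment> \<open>Large enough that the tail term \<open>8 D^2 / R\<close> of
    \<open>cell_energy_le\<close> is at most \<open>\<eta>^2\<close>; the summand \<open>1\<close>
    keeps \<open>R\<close> positive when \<open>D = 0\<close>.\<close>
  define R where "R = 8 * D\<^sup>2 / \<eta>\<^sup>2 + 1"
  have R: "0 < R" unfolding R_def using \<eta> by (intro add_nonneg_pos) auto
  have DR: "8 * D\<^sup>2 / R \<le> \<eta>\<^sup>2"
  proof -
    have "\<eta>\<^sup>2 * R = 8 * D\<^sup>2 + \<eta>\<^sup>2" using \<eta> by (simp add: R_def distrib_left)
    then show ?thesis using R \<eta>2 by (simp add: pos_divide_le_eq)
  qed
  define J where "J n = (\<integral>\<xi>. indicator {- R..R} \<xi> * grid_log f n \<xi> \<partial>lebesgue)" for n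
  define C1 where "C1 = (2 * B * L + L\<^sup>2) * (2 * real R0)"
  define C2 where "C2 = 2 * (I2\<^sup>2 * (err_const f)\<^sup>2)"
  have err_const: "0 \<le> err_const f" using mass_nonneg[OF f] by (simp add: err_const_def[OF f])
  have ev: "\<forall>\<^sub>F n in sequentially. G \<le> (1 + \<eta>) * (J n + \<eta>\<^sup>2 + 4 * \<eta>\<^sup>2 + C2 / real (Suc n)) + 2 * \<eta> + C1 / real (Suc n)"
    using sqrt_grid_log_le[OF f] eventually_ge_at_top[of R0]
  proof eventually_elim
    case (elim n)
    define m where "m = real (Suc n)"
    have m: "0 < m" by (simp add: m_def)
    have c: "cmod (cell_int f n j) \<le> 1 / 2" for j using elim by blast
    define S where "S = (\<Sum>j<ncell n. (cmod (cell_int f n j))\<^sup>2)"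
    define T where "T = (\<Sum>j<ncell n. (cmod (cell_int f n j - cell_int g n j))\<^sup>2)"
    have S0: "0 \<le> S" by (simp add: S_def sum_nonneg)
    have sq: "sq_sum f n = S" by (simp add: sq_sum_def[OF f] S_def)
    have S1: "m * S \<le> I2" unfolding m_def S_def I2_def by (rule cell_Bessel[OF f f2])
    have T1: "m * T \<le> \<eta>\<^sup>2"
    proof -
      have "m * T \<le> (\<integral>y. (cmod (f y - g y))\<^sup>2 \<partial>lebesgue)"
        unfolding m_def T_def cell_int_diff[OF f gi(1), symmetric]
        using f gi(1) d2(1) by (intro cell_Bessel) auto
      then show ?thesis using d2(2) by linarith
    qed
    have "m * S \<le> J n + 8 * D\<^sup>2 / R + 4 * (m * T) + 2 * (S * err_const f)\<^sup>2 * m"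
      unfolding m_def S_def T_def J_def
    proof (rule cell_energy_le[OF f c])
      show "sqrt (grid_log f n \<xi>) \<le> cmod (line_op f n (cell_int f n) \<xi>) + (\<Sum>j<ncell n. (cmod (cell_int f n j))\<^sup>2) * err_const f" for \<xi>
        using elim unfolding sq S_def by blast
      show "0 \<le> (\<Sum>j<ncell n. (cmod (cell_int f n j))\<^sup>2) * err_const f" using err_const by (simp add: sum_nonneg)
      show "cmod (line_op f n (cell_int g n) \<xi>) \<le> D / \<bar>\<xi>\<bar>" if "\<xi> \<noteq> 0" "\<bar>\<xi>\<bar> \<le> real (Suc n) / 2" for \<xi>
        unfolding D_def by (rule line_op_decay[OF f c L B _ out that]) auto
    qed (use D R in auto)
    \<comment> \<open>The squared linearisation error is integrated over a window of length
      \<open>m\<close>. It still vanishes, because \<open>m S\<close> is bounded by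
      \<open>I2\<close> and so \<open>S^2 m\<close> is \<open>O(1/m)\<close>.\<close>
    moreover have "2 * (S * err_const f)\<^sup>2 * m \<le> C2 / m"
    proof -
      have "2 * (S * err_const f)\<^sup>2 * m = 2 * ((m * S)\<^sup>2 * (err_const f)\<^sup>2) / m" using m by (simp add: power2_eq_square)
      also have "\<dots> \<le> C2 / m"
        unfolding C2_def using S1 S0 m by (intro divide_right_mono mult_left_mono mult_right_mono power_mono) auto
      finally show ?thesis .
    qed
    ultimately have S2: "m * S \<le> J n + \<eta>\<^sup>2 + 4 * \<eta>\<^sup>2 + C2 / m" using DR T1 by linarith
    have "G \<le> m * (\<Sum>j<ncell n. (cmod (cell_int g n j))\<^sup>2) + C1 / m"
      unfolding G_def C1_def by (rule L2_le_cell_sum[OF L B _ out m_def]) (use elim in \<open>auto simp: m_def\<close>)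
    also have "m * (\<Sum>j<ncell n. (cmod (cell_int g n j))\<^sup>2) \<le> m * (\<Sum>j<ncell n. (1 + \<eta>) * (cmod (cell_int f n j))\<^sup>2 + (1 + 1 / \<eta>) * (cmod (cell_int f n j - cell_int g n j))\<^sup>2)"
    proof (intro mult_left_mono sum_mono)
      fix j
      show "(cmod (cell_int g n j))\<^sup>2 \<le> (1 + \<eta>) * (cmod (cell_int f n j))\<^sup>2 + (1 + 1 / \<eta>) * (cmod (cell_int f n j - cell_int g n j))\<^sup>2"
        using cmod_sq_le_split[OF \<eta>(1), of "cell_int g n j" "cell_int f n j"] by (simp only: norm_minus_commute)
    qed (use m in simp)
    also have "\<dots> = (1 + \<eta>) * (m * S) + (1 + 1 / \<eta>) * (m * T)"
      by (simp only: S_def T_def sum.distrib sum_distrib_left[symmetric] distrib_left mult.left_commute[of m])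
    finally have "G \<le> (1 + \<eta>) * (m * S) + (1 + 1 / \<eta>) * (m * T) + C1 / m" by simp
    moreover have "(1 + \<eta>) * (m * S) \<le> (1 + \<eta>) * (J n + \<eta>\<^sup>2 + 4 * \<eta>\<^sup>2 + C2 / m)"
      using S2 \<eta> by (intro mult_left_mono) auto
    ultimately show ?case using \<eta>s[OF T1] unfolding m_def by linarith
  qed
  have C0: "(\<lambda>n. C / real (Suc n)) \<longlonglongrightarrow> 0" for C
    by (rule LIMSEQ_Suc[OF lim_const_over_n])
  define J' where "J' = (\<integral>\<xi>. indicator {- R..R} \<xi> * ln ((cmod (scat_a f \<xi>))\<^sup>2) \<partial>lebesgue)"
  have "(\<lambda>n. (1 + \<eta>) * (J n + \<eta>\<^sup>2 + 4 * \<eta>\<^sup>2 + C2 / real (Suc n)) + 2 * \<eta> + C1 / real (Suc n))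
      \<longlonglongrightarrow> (1 + \<eta>) * (J' + \<eta>\<^sup>2 + 4 * \<eta>\<^sup>2 + 0) + 2 * \<eta> + 0"
    unfolding J_def J'_def by (intro tendsto_add tendsto_mult tendsto_const log_integral_window_tendsto C0)
  then have "G \<le> (1 + \<eta>) * (J' + \<eta>\<^sup>2 + 4 * \<eta>\<^sup>2 + 0) + 2 * \<eta> + 0"
    by (rule tendsto_lowerbound[OF _ ev]) simp
  also have "\<dots> \<le> (1 + \<eta>) * (A + 5 * \<eta>\<^sup>2) + 2 * \<eta>"
  proof -
    have "J' \<le> A" unfolding J'_def by (rule log_integral_window_le[OF A A0])
    then have "(1 + \<eta>) * (J' + \<eta>\<^sup>2 + 4 * \<eta>\<^sup>2 + 0) \<le> (1 + \<eta>) * (A + 5 * \<eta>\<^sup>2)" using \<eta> by (intro mult_left_mono) auto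
    then show ?thesis by simp
  qed
  finally have "(1 + \<eta>) * G \<le> (1 + \<eta>) * ((1 + \<eta>) * (A + 5 * \<eta>\<^sup>2) + 2 * \<eta>)" using \<eta> by (intro mult_left_mono) auto
  then show ?thesis using IG unfolding I2_def by linarith
qed

lemma scat_L2_lower:
  assumes f2: "integrable lebesgue (\<lambda>y. (cmod (f y))\<^sup>2)"
    and A: "(\<integral>\<^sup>+\<xi>. ennreal (ln ((cmod (scat_a f \<xi>))\<^sup>2)) \<partial>lebesgue) \<le> ennreal A" and A0: "0 \<le> A"
  shows "(\<integral>y. (cmod (f y))\<^sup>2 \<partial>lebesgue) \<le> A"
proof -
  have "((\<lambda>\<eta>. (1 + \<eta>) * ((1 + \<eta>) * (A + 5 * \<eta>\<^sup>2) + 2 * \<eta>) + 2 * \<eta>) \<longlongrightarrow> (1 + 0) * ((1 + 0) * (A + 5 * 0\<^sup>2) + 2 * 0) + 2 * 0) (at_right 0)"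
    by (intro tendsto_intros)
  moreover have "\<forall>\<^sub>F \<eta> in at_right 0. (\<integral>y. (cmod (f y))\<^sup>2 \<partial>lebesgue) \<le> (1 + \<eta>) * ((1 + \<eta>) * (A + 5 * \<eta>\<^sup>2) + 2 * \<eta>) + 2 * \<eta>"
    using eventually_at_right_real[of 0 1] by (rule eventually_mono) (auto intro!: scat_L2_lower_approx f2 A A0)
  ultimately have "(\<integral>y. (cmod (f y))\<^sup>2 \<partial>lebesgue) \<le> (1 + 0) * ((1 + 0) * (A + 5 * 0\<^sup>2) + 2 * 0) + 2 * 0"
    by (intro tendsto_lowerbound) auto
  then show ?thesis by simp
qed

end

section \<open>Assembling the norm inequality\<close>

lemma Lp_space_realD:
  fixes f :: "real \<Rightarrow> complex"
  assumes p: "0 < p" and f: "f \<in> Lp_space (ennreal p)"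
  shows "f \<in> borel_measurable lebesgue" "integrable lebesgue (\<lambda>y. cmod (f y) powr p)"
    "Lp_norm (ennreal p) f = ennreal ((\<integral>y. cmod (f y) powr p \<partial>lebesgue) powr (1 / p))"
proof -
  show m [measurable]: "f \<in> borel_measurable lebesgue" using f by (simp add: Lp_space_def)
  have fin: "(\<integral>\<^sup>+y. ennreal (cmod (f y) powr p) \<partial>lebesgue) \<noteq> \<infinity>"
    using f p by (auto simp: Lp_space_def Lp_norm_def Let_def split: if_splits)
  show i: "integrable lebesgue (\<lambda>y. cmod (f y) powr p)"
    using fin by (intro integrableI_nonneg) (auto simp: top.not_eq_extremum)
  have "(\<integral>\<^sup>+y. ennreal (cmod (f y) powr p) \<partial>lebesgue) = ennreal (\<integral>y. cmod (f y) powr p \<partial>lebesgue)"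
    by (rule nn_integral_eq_integral[OF i]) simp
  then show "Lp_norm (ennreal p) f = ennreal ((\<integral>y. cmod (f y) powr p \<partial>lebesgue) powr (1 / p))"
    using p by (simp add: Lp_norm_def Let_def Bochner_Integration.integral_nonneg)
qed

theorem theorem1p2:
  fixes p :: real and f :: "real \<Rightarrow> complex"
  assumes "1 \<le> p" and "p \<le> 2"
    and "f \<in> Lp_space 1 \<inter> Lp_space (ennreal p)"
  shows "Lp_norm (conj_exponent p) (\<lambda>\<xi>. sqrt (ln ((cmod (scat_a f \<xi>))\<^sup>2))) \<le> Lp_norm (ennreal p) f
    \<and> (p = 2 \<longrightarrow>
        Lp_norm (conj_exponent p) (\<lambda>\<xi>. sqrt (ln ((cmod (scat_a f \<xi>))\<^sup>2))) = Lp_norm (ennreal p) f)"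
proof -
  define U where "U \<xi> = sqrt (ln ((cmod (scat_a f \<xi>))\<^sup>2))" for \<xi>
  have "f \<in> Lp_space (ennreal 1)" "f \<in> Lp_space (ennreal p)" using assms(3) by auto
  note f1 = Lp_space_realD[OF zero_less_one this(1)] and fp = Lp_space_realD[OF _ this(2)]
  have f: "integrable lebesgue f"
    using f1(1,2) by (simp add: integrable_norm_iff)
  have p0: "0 < p" using assms(1) by simp
  define Ip where "Ip = (\<integral>y. cmod (f y) powr p \<partial>lebesgue)"
  have Ip0: "0 \<le> Ip" unfolding Ip_def by (rule Bochner_Integration.integral_nonneg) simp
  have Lf: "Lp_norm (ennreal p) f = ennreal (Ip powr (1 / p))" unfolding Ip_def by (rule fp(3)[OF p0])
  have l0: "0 \<le> ln ((cmod (scat_a f \<xi>))\<^sup>2)" for \<xi> using scat_a_ge_1[OF f, of \<xi>] by (simp add: one_le_power)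
  have U0: "0 \<le> U \<xi>" for \<xi> using l0 by (simp add: U_def)
  have "Lp_norm (conj_exponent p) U \<le> Lp_norm (ennreal p) f \<and> (p = 2 \<longrightarrow> Lp_norm (conj_exponent p) U = Lp_norm (ennreal p) f)"
  proof (cases "p = 1")
    case True
    have Um: "(\<lambda>\<xi>. ennreal (norm (U \<xi>))) \<in> borel_measurable lebesgue"
      using borel_imp_lebesgue_measurable[OF scat_log_meas[OF f]] unfolding U_def by measurable
    have Ipm: "Ip = mass f" using True by (simp add: Ip_def mass_def[OF f])
    have "esssup lebesgue (\<lambda>\<xi>. ennreal (norm (U \<xi>))) \<le> ennreal Ip"
    proof (rule esssup_I[OF Um], rule AE_I2, rule ennreal_leI)
      show "norm (U \<xi>) \<le> Ip" for \<xi> using sqrt_log_a_le_mass[OF f, of \<xi>] U0[of \<xi>] unfolding Ipm by (simp add: U_def)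
    qed
    then show ?thesis using True Ip0 unfolding Lf by (simp add: conj_exponent_def Lp_norm_def)
  next
    case False
    define q where "q = p / (p - 1)"
    have p1: "1 < p" using False assms(1) by simp
    have q0: "0 < q" using p1 by (simp add: q_def)
    define I where "I = (\<integral>\<^sup>+\<xi>. ennreal (norm (U \<xi>) powr q) \<partial>lebesgue)"
    have I: "I \<le> ennreal (Ip powr (1 / (p - 1)))"
      unfolding I_def Ip_def q_def using scat_Lp_bound[OF f p1 assms(2) fp(2)[OF p0]] U0 by (simp add: U_def)
    then have Ifin: "I \<noteq> \<infinity>" using neq_top_trans[OF ennreal_neq_top I] by simp
    have LU: "Lp_norm (conj_exponent p) U = ennreal (enn2real I powr (1 / q))"
      using False q0 Ifin by (simp add: conj_exponent_def Lp_norm_def Let_def q_def[symmetric] I_def[unfolded real_norm_def, symmetric])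
    have Ir: "enn2real I \<le> Ip powr (1 / (p - 1))" using I by (intro enn2real_leI) auto
    have "enn2real I powr (1 / q) \<le> (Ip powr (1 / (p - 1))) powr (1 / q)"
      using Ir q0 by (intro powr_mono2) auto
    also have "\<dots> = Ip powr (1 / p)" using p1 by (simp add: powr_powr q_def)
    finally have le: "Lp_norm (conj_exponent p) U \<le> Lp_norm (ennreal p) f"
      unfolding LU Lf by (rule ennreal_leI)
    moreover have "Lp_norm (conj_exponent p) U = Lp_norm (ennreal p) f" if "p = 2"
    proof -
      \<comment> \<open>At \<open>p = 2\<close> also \<open>q = 2\<close>, so the power removes the
        square root.\<close>
      have "norm (U \<xi>) powr q = ln ((cmod (scat_a f \<xi>))\<^sup>2)" for \<xi>
        using l0[of \<xi>] that by (simp add: U_def q_def)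
      then have "I = (\<integral>\<^sup>+\<xi>. ennreal (ln ((cmod (scat_a f \<xi>))\<^sup>2)) \<partial>lebesgue)" by (simp only: I_def)
      then have A: "(\<integral>\<^sup>+\<xi>. ennreal (ln ((cmod (scat_a f \<xi>))\<^sup>2)) \<partial>lebesgue) \<le> ennreal (enn2real I)"
        using Ifin by (simp add: ennreal_enn2real_if)
      have "(\<integral>y. (cmod (f y))\<^sup>2 \<partial>lebesgue) \<le> enn2real I"
        using fp(2)[OF p0] that by (intro scat_L2_lower[OF f _ A]) auto
      then have "Ip \<le> enn2real I" using that by (simp add: Ip_def)
      then have "Ip powr (1 / 2) \<le> enn2real I powr (1 / 2)" using Ip0 by (intro powr_mono2) auto
      then have "Ip powr (1 / p) \<le> enn2real I powr (1 / q)" using that by (simp add: q_def)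
      then show ?thesis using le unfolding LU Lf by (metis antisym ennreal_leI)
    qed
    ultimately show ?thesis by blast
  qed
  then show ?thesis unfolding U_def .
qed

end
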